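(* Let $\rho$ be a Riemannian metric on the 2-torus $\mathbb{T}^2$ whose geodesic flow, with Hamiltonian $H$, has a first integral $F_3$ that is a homogeneous polynomial of degree $3$ in the momenta, written in normalized semi-geodesic coordinates. Let $\Omega_e\subset\mathbb{T}^2$ be an elliptic region for $F_3$. Then one has the following alternative: either the metric $\rho$ is flat in $\Omega_e$, or $F_3$ is reducible on $\Omega_e$, that is, there exist a first integral $F_1$ of the geodesic flow over $\Omega_e$ which is a homogeneous polynomial of degree $1$ in the momenta, and constants $k_1,k_2$, such that $$F_3=k_1F_1^3+2k_2HF_1 \quad\text{on } \Omega_e .$$
   Context: All objects are smooth. $\mathbb{T}^2=\mathbb{R}^2/\Gamma$, $\Gamma$ a lattice; $H:T^*\mathbb{T}^2\to\mathbb{R}$ is half the squared norm of the momentum. A first integral over an open set $\Omega$ is a function $F$ on $T^*\Omega$ with $\{F,H\}=0$. Normalized semi-geodesic coordinates (standing assumption; it is known that they exist): using a regular Liouville torus $L$ of the geodesic flow (a common level set of $F_n$ and $H$ on which $dF_n,dH$ are independent) that projects diffeomorphically onto $\mathbb{T}^2$, one has global coordinates $(t,x)$ on the covering plane, with conjugate momenta $(p_1,p_2)$, such that the curves $\{t=\text{const}\}$ are the geodesics of $L$ and $$ds^2=g^2(t,x)\,dt^2+dx^2,\quad g>0,\qquad H=\tfrac12\Big(\tfrac{p_1^2}{g^2}+p_2^2\Big).$$ The integral is written $F_n=\sum_{k=0}^n a_k(t,x)\frac{p_1^{n-k}}{g^{n-k}}p_2^k$ and is normalized so that $a_{n-1}\equiv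 g$ and $a_n\equiv 1$. For $n=3$, with $U=(a_0,a_1,a_2)^T$, the condition $\{F_3,H\}=0$ becomes the quasi-linear system $U_t+A(U)U_x=0$ with $$A(U)=\begin{pmatrix}0&0&a_1\\ a_2&0&2a_2-3a_0\\ 0&a_2&3-2a_1\end{pmatrix}.$$ Elliptic region: a (nonempty) connected component $\Omega_e$ of the set of points of $\mathbb{T}^2$ at which the eigenvalues of $A(U)$ are distinct and two of them are non-real complex conjugates (so the third is real). The eigenvalues are $\lambda_i=gs_i$ where $s_i$ are the roots of $\hat G_3(s)=a_2s^3+(2a_1-3)s^2+(3a_0-2a_2)s-a_1$. *)

theory Defs
  imports "HOL-Analysis.Analysis"
begin

section \<open>Smooth maps\<close>

text \<open>All the sets \<open>S\<close> on which smoothness is used below are open.\<close>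

primrec Ck_on :: "nat \<Rightarrow> 'a::euclidean_space set \<Rightarrow> ('a \<Rightarrow> 'b::real_normed_vector) \<Rightarrow> bool" where
  "Ck_on 0 S f \<longleftrightarrow> continuous_on S f"
| "Ck_on (Suc k) S f \<longleftrightarrow>
     (\<forall>x\<in>S. f differentiable (at x)) \<and>
     (\<forall>v. Ck_on k S (\<lambda>x. frechet_derivative f (at x) v))"

definition smooth_on :: "'a::euclidean_space set \<Rightarrow> ('a \<Rightarrow> 'b::real_normed_vector) \<Rightarrow> bool" where
  "smooth_on S f \<longleftrightarrow> (\<forall>k. Ck_on k S f)"

definition diffeomorphism :: "('a::euclidean_space \<Rightarrow> 'b::euclidean_space) \<Rightarrow> bool" where
  "diffeomorphism \<Phi> \<longleftrightarrow> bij \<Phi> \<and> smooth_on UNIV \<Phi> \<and> smooth_on UNIV (inv \<Phi>)"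


section \<open>The torus \<open>\<real>\<^sup>2/\<Gamma>\<close>\<close>

definition is_lattice :: "(real^2) set \<Rightarrow> bool" where
  "is_lattice \<Gamma> \<longleftrightarrow>
     (\<exists>w1 w2. w1 \<noteq> w2 \<and> independent {w1, w2} \<and>
        \<Gamma> = {of_int i *\<^sub>R w1 + of_int j *\<^sub>R w2 | i j. True})"

definition torus_proj :: "(real^2) set \<Rightarrow> real^2 \<Rightarrow> (real^2) set" where
  "torus_proj \<Gamma> u = {v. v - u \<in> \<Gamma>}"

definition torus :: "(real^2) set \<Rightarrow> (real^2) set topology" where
  "torus \<Gamma> = topology (\<lambda>U. U \<subseteq> range (torus_proj \<Gamma>) \<and> open (torus_proj \<Gamma> -` U))"

lemma openin_torus:
  "openin (torus \<Gamma>) U \<longleftrightarrow> U \<subseteq> range (torus_proj \<Gamma>) \<and> open (torus_proj \<Gamma> -` U)"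
proof -
  have "istopology (\<lambda>U. U \<subseteq> range (torus_proj \<Gamma>) \<and> open (torus_proj \<Gamma> -` U))"
    unfolding istopology_def by (auto simp: vimage_Union intro!: open_Union)
  then show ?thesis
    by (simp add: torus_def topology_inverse')
qed

lemma topspace_torus: "topspace (torus \<Gamma>) = range (torus_proj \<Gamma>)"
proof -
  have "torus_proj \<Gamma> -` range (torus_proj \<Gamma>) = UNIV"
    by auto
  then have "openin (torus \<Gamma>) (range (torus_proj \<Gamma>))"
    by (simp add: openin_torus)
  then show ?thesis
    by (meson openin_subset openin_topspace openin_torus subset_antisym)
qed

lemma quotient_map_torus: "quotient_map euclidean (torus \<Gamma>) (torus_proj \<Gamma>)"
  by (simp add: quotient_map_def topspace_torus openin_torus vimage_def)

text \<open>
  Tensors and functions on the torus and on its cotangent bundle are represented by their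
  \<open>\<Gamma>\<close>-periodic lifts to the covering plane, a covector at \<open>u\<close> being identified with an element of
  \<^typ>\<open>real^2\<close> through the linear coordinates of the plane. The set \<open>cotangent \<Gamma> \<Omega>\<close> is the lift of
  \<open>T\<^sup>*\<Omega>\<close>, for \<open>\<Omega>\<close> a subset of the torus.
\<close>

type_synonym phase = "(real^2) \<times> (real^2)"

definition cotangent :: "(real^2) set \<Rightarrow> (real^2) set set \<Rightarrow> phase set" where
  "cotangent \<Gamma> \<Omega> = {(u, p). torus_proj \<Gamma> u \<in> \<Omega>}"


section \<open>Metrics, geodesic Hamiltonian and first integrals\<close>

definition metric_form :: "(real^2 \<Rightarrow> real^2^2) \<Rightarrow> real^2 \<Rightarrow> real^2 \<Rightarrow> real^2 \<Rightarrow> real" where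
  "metric_form \<rho> u v w = v \<bullet> (\<rho> u *v w)"

definition riemannian_metric :: "(real^2) set \<Rightarrow> (real^2 \<Rightarrow> real^2^2) \<Rightarrow> bool" where
  "riemannian_metric \<Gamma> \<rho> \<longleftrightarrow>
     smooth_on UNIV \<rho> \<and>
     (\<forall>u. \<forall>\<gamma>\<in>\<Gamma>. \<rho> (u + \<gamma>) = \<rho> u) \<and>
     (\<forall>u. transpose (\<rho> u) = \<rho> u) \<and>
     (\<forall>u v. v \<noteq> 0 \<longrightarrow> metric_form \<rho> u v v > 0)"

definition hamiltonian :: "(real^2 \<Rightarrow> real^2^2) \<Rightarrow> phase \<Rightarrow> real" where
  "hamiltonian \<rho> = (\<lambda>(u, p). (p \<bullet> (matrix_inv (\<rho> u) *v p)) / 2)"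

definition poisson_bracket :: "(phase \<Rightarrow> real) \<Rightarrow> (phase \<Rightarrow> real) \<Rightarrow> phase \<Rightarrow> real" where
  "poisson_bracket F G z =
     (\<Sum>i\<in>UNIV.
        frechet_derivative F (at z) (axis i 1, 0) * frechet_derivative G (at z) (0, axis i 1)
      - frechet_derivative F (at z) (0, axis i 1) * frechet_derivative G (at z) (axis i 1, 0))"

text \<open>The values of \<open>F\<close> outside \<open>cotangent \<Gamma> \<Omega>\<close> are irrelevant (for open \<open>\<Omega>\<close>).\<close>

definition first_integral_over ::
  "(real^2) set \<Rightarrow> (real^2 \<Rightarrow> real^2^2) \<Rightarrow> (real^2) set set \<Rightarrow> (phase \<Rightarrow> real) \<Rightarrow> bool" where
  "first_integral_over \<Gamma> \<rho> \<Omega> F \<longleftrightarrow>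
     smooth_on (cotangent \<Gamma> \<Omega>) F \<and>
     (\<forall>(u, p)\<in>cotangent \<Gamma> \<Omega>. \<forall>\<gamma>\<in>\<Gamma>. F (u + \<gamma>, p) = F (u, p)) \<and>
     (\<forall>z\<in>cotangent \<Gamma> \<Omega>. poisson_bracket F (hamiltonian \<rho>) z = 0)"

definition homogeneous_in_momenta ::
  "(real^2) set \<Rightarrow> (real^2) set set \<Rightarrow> nat \<Rightarrow> (phase \<Rightarrow> real) \<Rightarrow> bool" where
  "homogeneous_in_momenta \<Gamma> \<Omega> n F \<longleftrightarrow>
     (\<exists>b :: nat \<Rightarrow> real^2 \<Rightarrow> real. \<forall>(u, p)\<in>cotangent \<Gamma> \<Omega>.
        F (u, p) = (\<Sum>k\<le>n. b k u * (p$1)^(n - k) * (p$2)^k))"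

text \<open>Flatness: each point has a neighbourhood isometric to a region of the Euclidean plane.\<close>

definition flat_on :: "(real^2) set \<Rightarrow> (real^2 \<Rightarrow> real^2^2) \<Rightarrow> (real^2) set set \<Rightarrow> bool" where
  "flat_on \<Gamma> \<rho> \<Omega> \<longleftrightarrow>
     (\<forall>u. torus_proj \<Gamma> u \<in> \<Omega> \<longrightarrow>
        (\<exists>V (\<phi> :: real^2 \<Rightarrow> real^2). open V \<and> u \<in> V \<and> smooth_on V \<phi> \<and> inj_on \<phi> V \<and>
           (\<forall>q\<in>V. \<forall>v w. metric_form \<rho> q v w
              = frechet_derivative \<phi> (at q) v \<bullet> frechet_derivative \<phi> (at q) w)))"


section \<open>Normalized semi-geodesic coordinates\<close>

text \<open>
  The torus \<open>L\<close> is the graph of the section \<open>\<alpha>\<close>, so that it projects diffeomorphically. Being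
  compact and contained in the regular part of the level set, such a graph is a connected
  component of it.
\<close>

definition regular_liouville_torus ::
  "(real^2) set \<Rightarrow> (real^2 \<Rightarrow> real^2^2) \<Rightarrow> (phase \<Rightarrow> real) \<Rightarrow> (real^2 \<Rightarrow> real^2) \<Rightarrow> bool" where
  "regular_liouville_torus \<Gamma> \<rho> F \<alpha> \<longleftrightarrow>
     smooth_on UNIV \<alpha> \<and>
     (\<forall>u. \<forall>\<gamma>\<in>\<Gamma>. \<alpha> (u + \<gamma>) = \<alpha> u) \<and>
     (\<exists>c h. \<forall>u. F (u, \<alpha> u) = c \<and> hamiltonian \<rho> (u, \<alpha> u) = h) \<and>
     (\<forall>u c d. (\<forall>w. c * frechet_derivative F (at (u, \<alpha> u)) w
                 + d * frechet_derivative (hamiltonian \<rho>) (at (u, \<alpha> u)) w = 0)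
        \<longrightarrow> c = 0 \<and> d = 0)"

text \<open>
  The map \<open>\<Phi>\<close> sends a point \<open>u\<close> of the covering plane to its coordinates \<open>(t, x)\<close>, and \<open>g\<close> and
  \<open>a k\<close> are functions of \<open>(t, x)\<close>. A covector with components \<open>q = (p\<^sub>1, p\<^sub>2)\<close> in the coordinates
  \<open>(t, x)\<close> is \<open>adjoint (d\<Phi>\<^sub>u) q\<close> in the linear coordinates of the plane. The vector
  \<open>matrix_inv (\<rho> u) *v \<alpha> u\<close> is the velocity at \<open>u\<close> of the geodesic of \<open>L\<close> through \<open>u\<close>; these
  geodesics are the curves \<open>t = const\<close> iff it is annihilated by \<open>dt\<close>.
\<close>

definition normalized_semigeodesic ::
  "(real^2) set \<Rightarrow> (real^2 \<Rightarrow> real^2^2) \<Rightarrow> nat \<Rightarrow> (phase \<Rightarrow> real) \<Rightarrow>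
   (real^2 \<Rightarrow> real^2) \<Rightarrow> (real^2 \<Rightarrow> real) \<Rightarrow> (nat \<Rightarrow> real^2 \<Rightarrow> real) \<Rightarrow> bool" where
  "normalized_semigeodesic \<Gamma> \<rho> n F \<Phi> g a \<longleftrightarrow>
     diffeomorphism \<Phi> \<and> smooth_on UNIV g \<and> (\<forall>k\<le>n. smooth_on UNIV (a k)) \<and>
     (\<exists>\<alpha>. regular_liouville_torus \<Gamma> \<rho> F \<alpha> \<and>
        (\<forall>u. frechet_derivative \<Phi> (at u) (matrix_inv (\<rho> u) *v \<alpha> u) $ 1 = 0)) \<and>
     (\<forall>y. g y > 0) \<and>
     (\<forall>u v w. metric_form \<rho> u v w =
          (g (\<Phi> u))\<^sup>2 * (frechet_derivative \<Phi> (at u) v $ 1) * (frechet_derivative \<Phi> (at u) w $ 1)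
        + (frechet_derivative \<Phi> (at u) v $ 2) * (frechet_derivative \<Phi> (at u) w $ 2)) \<and>
     (\<forall>u q. F (u, adjoint (frechet_derivative \<Phi> (at u)) q) =
          (\<Sum>k\<le>n. a k (\<Phi> u) * ((q$1) ^ (n - k) / g (\<Phi> u) ^ (n - k)) * (q$2) ^ k)) \<and>
     (\<forall>y. a (n - 1) y = g y) \<and> (\<forall>y. a n y = 1)"


section \<open>Elliptic regions\<close>

definition system_matrix :: "real^3 \<Rightarrow> real^3^3" where
  "system_matrix U = vector
     [vector [0,     0,     U$2],
      vector [U$3,   0,     2 * U$3 - 3 * U$1],
      vector [0,     U$3,   3 - 2 * U$2]]"

definition complex_eigenvalues :: "real^'n^'n \<Rightarrow> complex set" where
  "complex_eigenvalues A =
     {z. \<exists>v. v \<noteq> 0 \<and> map_matrix complex_of_real A *v v = z *s v}"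

definition elliptic_point ::
  "(real^2 \<Rightarrow> real^2) \<Rightarrow> (nat \<Rightarrow> real^2 \<Rightarrow> real) \<Rightarrow> real^2 \<Rightarrow> bool" where
  "elliptic_point \<Phi> a u \<longleftrightarrow>
     (let E = complex_eigenvalues
                (system_matrix (vector [a 0 (\<Phi> u), a 1 (\<Phi> u), a 2 (\<Phi> u)]))
      in card E = 3 \<and> (\<exists>z\<in>E. Im z \<noteq> 0 \<and> cnj z \<in> E))"

definition elliptic_region ::
  "(real^2) set \<Rightarrow> (real^2 \<Rightarrow> real^2) \<Rightarrow> (nat \<Rightarrow> real^2 \<Rightarrow> real) \<Rightarrow> (real^2) set set \<Rightarrow> bool" where
  "elliptic_region \<Gamma> \<Phi> a \<Omega> \<longleftrightarrow>
     \<Omega> \<in> connected_components_of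
           (subtopology (torus \<Gamma>) (torus_proj \<Gamma> ` {u. elliptic_point \<Phi> a u}))"

end

theory Submission
  imports Defs
begin

text \<open>
  On the unit circle of a fibre, \<open>F\<^sub>3\<close> is \<open>Re (A e\<^sup>3\<^sup>i\<^sup>\<phi>) + Re (B e\<^sup>i\<^sup>\<phi>)\<close>. The coefficient \<open>A\<close> satisfies a
  Cauchy-Riemann type system, so its zeros have positive index; on a torus the indices add up to
  zero, hence \<open>A\<close> vanishes identically or nowhere. In the first case \<open>F\<^sub>3 = 2 H F\<^sub>1\<close>.

  In the second case let \<open>s\<close> be the non-real root of the cubic \<open>a\<^sub>2 s\<^sup>3 + (2a\<^sub>1 - 3) s\<^sup>2 + (3a\<^sub>0 - 2a\<^sub>2) s - a\<^sub>1\<close>, i.e.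
  the tangent of the angle of a complex critical point of \<open>F\<^sub>3\<close> on the unit circle, and let \<open>w\<close> be the
  square of the critical value. It is finite because \<open>s\<close> is never an imaginary unit, it satisfies
  \<open>w\<^sub>t + g s w\<^sub>x = 0\<close>, hence has a Jacobian of constant sign, and it becomes real at the boundary of the
  elliptic set. Integrating a cut-off of this Jacobian over the torus
  shows \<open>dw = 0\<close>.

  Now the solution is a simple wave for the real eigenvalue \<open>\<lambda>\<close>. Its characteristics are straight lines
  that never leave the elliptic set; two of different slopes would meet, so \<open>\<lambda>\<close> is constant and
  \<open>p\<^sub>1 + \<lambda> p\<^sub>2\<close> is a first integral. Either \<open>g\<^sub>x = 0\<close>, and then the metric is flat, or the remaining
  ordinary differential equations integrate to the reducible form of \<open>F\<^sub>3\<close>.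
\<close>

section \<open>Calculus of \<open>C\<^sup>k\<close> maps\<close>

text \<open>Zeros of A matter because s equals an imaginary unit exactly there. Without them w stays
  finite up to the boundary of the elliptic set and turns real as s and its conjugate collide.
  Nothing is known about the regularity of this boundary, so w is multiplied by a function of Im w
  that vanishes near 0; the product extends by zero. Squaring the critical value avoids a branch of
  (1 + s^2)^(3/2). The equation for w holds because ds drops out at a critical point and (1, s, s^2)
  is a left eigenvector of the system matrix for the eigenvalue g s.

  Zeros of A are not known to be isolated, so an estimate replaces their indices. On the torus dP
  \<and> dQ / (P^2 + Q^2 + e) is exact for each e > 0, and its vanishing integral bounds the energy
  of the logarithm of P + \<i> Q independently of e; a zero of a map that is not identically zero
  would make it unbounded. Rays from a zero must reach every point: in a doubled period
  parallelogram with the zero at a corner, the square [1, 2] x [0, 1] contains a representative of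
  each point, seen along slopes in [0, 1].\<close>

abbreviation dir_deriv :: "('a::euclidean_space \<Rightarrow> 'b::real_normed_vector) \<Rightarrow> 'a \<Rightarrow> 'a \<Rightarrow> 'b" where
  "dir_deriv f v x \<equiv> frechet_derivative f (at x) v"

lemma has_derivative_frechetI:
  "f differentiable (at x) \<Longrightarrow> (f has_derivative frechet_derivative f (at x)) (at x)"
  by (simp add: frechet_derivative_works)

lemma dir_deriv_eq:
  "(f has_derivative f') (at x) \<Longrightarrow> dir_deriv f v x = f' v"
  using frechet_derivative_at by metis

lemma Ck_on_SucD:
  assumes "Ck_on (Suc k) S f" "x \<in> S"
  shows "(f has_derivative frechet_derivative f (at x)) (at x)"
  using assms by (simp add: has_derivative_frechetI)

lemma Ck_on_differentiable: "Ck_on (Suc k) S f \<Longrightarrow> x \<in> S \<Longrightarrow> f differentiable (at x)"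
  by simp

lemma Ck_on_dir_deriv: "Ck_on (Suc k) S f \<Longrightarrow> Ck_on k S (dir_deriv f v)"
  by simp

lemma Ck_on_subset: "Ck_on k S f \<Longrightarrow> T \<subseteq> S \<Longrightarrow> Ck_on k T f"
  by (induction k arbitrary: f) (auto intro: continuous_on_subset)

lemma Ck_on_Suc_imp: "Ck_on (Suc k) S f \<Longrightarrow> Ck_on k S f"
proof (induction k arbitrary: f)
  case 0
  then show ?case
    by (auto intro!: continuous_at_imp_continuous_on differentiable_imp_continuous_within)
qed auto

lemma Ck_on_le: "Ck_on k S f \<Longrightarrow> j \<le> k \<Longrightarrow> Ck_on j S f"
  by (induction k) (use Ck_on_Suc_imp le_SucE in blast)+

lemma Ck_on_continuous_on: "Ck_on k S f \<Longrightarrow> continuous_on S f"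
  using Ck_on_le[of k S f 0] by simp

text \<open>Openness turns equality on \<open>S\<close> into equality near each of its points, so
  the derivatives agree as well and the induction can pass to them.\<close>

lemma Ck_on_cong:
  assumes "open S" "\<And>x. x \<in> S \<Longrightarrow> f x = g x" "Ck_on k S f"
  shows "Ck_on k S g"
  using assms(2,3)
proof (induction k arbitrary: f g)
  case 0
  then show ?case
    by (metis Ck_on.simps(1) continuous_on_cong)
next
  case (Suc k)
  have d: "(g has_derivative frechet_derivative f (at x)) (at x)" if "x \<in> S" for x
    using has_derivative_transform_within_open[OF Ck_on_SucD[OF Suc.prems(2) that] assms(1) that]
      Suc.prems(1) by blast
  have "Ck_on k S (dir_deriv g v)" for v
    using Suc.IH[of "dir_deriv f v" "dir_deriv g v"] Suc.prems(2) dir_deriv_eq[OF d] by simp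
  then show ?case
    using d by (auto simp: differentiable_def)
qed

text \<open>Any explicitly known derivative may stand for \<open>frechet_derivative\<close>; the
  closure properties below use this with the usual differentiation rules.\<close>

lemma Ck_on_SucI:
  assumes "open S" "\<And>x. x \<in> S \<Longrightarrow> (f has_derivative f' x) (at x)"
    "\<And>v. Ck_on k S (\<lambda>x. f' x v)"
  shows "Ck_on (Suc k) S f"
proof -
  have "Ck_on k S (dir_deriv f v)" for v
    by (rule Ck_on_cong[OF assms(1) _ assms(3)[of v]]) (simp add: dir_deriv_eq[OF assms(2)])
  then show ?thesis
    using assms(2) by (auto simp: differentiable_def)
qed

text \<open>Serves to glue a function on the elliptic set to its extension by zero.\<close>

lemma Ck_on_Un:
  assumes "Ck_on k S f" "Ck_on k T f" "open S" "open T"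
  shows "Ck_on k (S \<union> T) f"
  using assms(1,2) by (induction k arbitrary: f) (auto intro: continuous_on_open_Un assms(3,4))

lemma Ck_on_const: "Ck_on k S (\<lambda>x. c)"
proof (induction k arbitrary: c)
  case (Suc k)
  then show ?case by simp
qed simp

lemma Ck_on_bounded_linear_compose:
  assumes "bounded_linear L" "open S" "Ck_on k S f"
  shows "Ck_on k S (\<lambda>x. L (f x))"
  using assms(3)
proof (induction k arbitrary: f)
  case 0
  then show ?case
    using bounded_linear.continuous_on[OF assms(1)] by simp
next
  case (Suc k)
  show ?case
    by (rule Ck_on_SucI[where f' = "\<lambda>x v. L (dir_deriv f v x)"])
      (auto intro: assms(2) bounded_linear.has_derivative[OF assms(1)] Ck_on_SucD[OF Suc.prems]
        Suc.IH Ck_on_dir_deriv[OF Suc.prems])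
qed

lemma Ck_on_bounded_linear:
  assumes "bounded_linear L"
  shows "Ck_on k S L"
proof -
  have "Ck_on k UNIV L"
  proof (cases k)
    case 0
    then show ?thesis
      using linear_continuous_on[OF assms] by simp
  next
    case (Suc j)
    have "Ck_on (Suc j) UNIV L"
      by (rule Ck_on_SucI[where f' = "\<lambda>x v. L v"])
        (auto intro: bounded_linear_imp_has_derivative assms Ck_on_const)
    then show ?thesis
      using Suc by simp
  qed
  then show ?thesis
    using Ck_on_subset by blast
qed

lemma Ck_on_add:
  assumes "open S" "Ck_on k S f" "Ck_on k S g"
  shows "Ck_on k S (\<lambda>x. f x + g x)"
  using assms(2,3)
proof (induction k arbitrary: f g)
  case (Suc k)
  show ?case
    by (rule Ck_on_SucI[where f' = "\<lambda>x v. dir_deriv f v x + dir_deriv g v x"])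
      (auto intro: assms(1) has_derivative_add Ck_on_SucD[OF Suc.prems(1)]
        Ck_on_SucD[OF Suc.prems(2)] Suc.IH Ck_on_dir_deriv[OF Suc.prems(1)]
        Ck_on_dir_deriv[OF Suc.prems(2)])
qed (auto intro: continuous_on_add)

lemma Ck_on_sum:
  assumes "open S" "\<And>i. i \<in> I \<Longrightarrow> Ck_on k S (f i)"
  shows "Ck_on k S (\<lambda>x. \<Sum>i\<in>I. f i x)"
  using assms(2)
  by (induction I rule: infinite_finite_induct) (auto intro: Ck_on_const Ck_on_add assms(1))

lemma Ck_on_bilinear:
  assumes "bounded_bilinear B" "open S" "Ck_on k S f" "Ck_on k S g"
  shows "Ck_on k S (\<lambda>x. B (f x) (g x))"
  using assms(3,4)
proof (induction k arbitrary: f g)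
  case 0
  then show ?case
    using bounded_bilinear.continuous_on[OF assms(1)] by simp
next
  case (Suc k)
  show ?case
  proof (rule Ck_on_SucI[where f' = "\<lambda>x v. B (f x) (dir_deriv g v x) + B (dir_deriv f v x) (g x)"])
    show "((\<lambda>x. B (f x) (g x)) has_derivative
        (\<lambda>v. B (f x) (dir_deriv g v x) + B (dir_deriv f v x) (g x))) (at x)" if "x \<in> S" for x
      by (rule bounded_bilinear.FDERIV[OF assms(1) Ck_on_SucD[OF Suc.prems(1) that]
            Ck_on_SucD[OF Suc.prems(2) that]])
    show "Ck_on k S (\<lambda>x. B (f x) (dir_deriv g v x) + B (dir_deriv f v x) (g x))" for v
      by (intro Ck_on_add[OF assms(2)] Suc.IH Ck_on_dir_deriv[OF Suc.prems(1)]
          Ck_on_dir_deriv[OF Suc.prems(2)] Ck_on_Suc_imp[OF Suc.prems(1)]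
          Ck_on_Suc_imp[OF Suc.prems(2)])
  qed (rule assms(2))
qed

lemmas Ck_on_scaleR = Ck_on_bilinear[OF bounded_bilinear_scaleR]
lemmas Ck_on_inner = Ck_on_bilinear[OF bounded_bilinear_inner]
lemmas Ck_on_mult = Ck_on_bilinear[OF bounded_bilinear_mult]
lemmas Ck_on_uminus = Ck_on_bounded_linear_compose[OF bounded_linear_minus[OF bounded_linear_ident]]

lemma Ck_on_diff:
  "open S \<Longrightarrow> Ck_on k S f \<Longrightarrow> Ck_on k S g \<Longrightarrow> Ck_on k S (\<lambda>x. f x - g x)"
  using Ck_on_add[of S k f "\<lambda>x. - g x"] Ck_on_uminus[of S k g] by simp

lemma Ck_on_power:
  fixes f :: "'a::euclidean_space \<Rightarrow> 'b::real_normed_algebra_1"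
  shows "open S \<Longrightarrow> Ck_on k S f \<Longrightarrow> Ck_on k S (\<lambda>x. f x ^ n)"
  by (induction n) (auto intro: Ck_on_const Ck_on_mult)

lemma Ck_on_inverse:
  fixes f :: "'a::euclidean_space \<Rightarrow> 'b::real_normed_field"
  assumes "open S" "Ck_on k S f" "\<And>x. x \<in> S \<Longrightarrow> f x \<noteq> 0"
  shows "Ck_on k S (\<lambda>x. inverse (f x))"
  using assms(2)
proof (induction k)
  case 0
  then show ?case
    using assms(3) by (auto intro: continuous_on_inverse)
next
  case (Suc k)
  show ?case
    by (rule Ck_on_SucI[where f' = "\<lambda>x v. - (inverse (f x) * dir_deriv f v x * inverse (f x))"])
      (auto intro!: assms(1,3) Deriv.has_derivative_inverse Ck_on_SucD[OF Suc.prems] Ck_on_uminus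
        Ck_on_mult Suc.IH Ck_on_dir_deriv[OF Suc.prems] Ck_on_Suc_imp[OF Suc.prems])
qed

lemma Ck_on_divide:
  fixes f g :: "'a::euclidean_space \<Rightarrow> 'b::real_normed_field"
  shows "open S \<Longrightarrow> Ck_on k S f \<Longrightarrow> Ck_on k S g \<Longrightarrow> (\<And>x. x \<in> S \<Longrightarrow> g x \<noteq> 0)
    \<Longrightarrow> Ck_on k S (\<lambda>x. f x / g x)"
  using Ck_on_mult[of S k f "\<lambda>x. inverse (g x)"] Ck_on_inverse[of S k g]
  by (simp add: divide_inverse)

lemma Ck_on_compose:
  fixes f :: "'b::euclidean_space \<Rightarrow> 'c::real_normed_vector"
    and g :: "'a::euclidean_space \<Rightarrow> 'b"
  assumes "open S" "g ` S \<subseteq> T" "Ck_on k S g" "Ck_on k T f"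
  shows "Ck_on k S (\<lambda>x. f (g x))"
  using assms(3,4)
proof (induction k arbitrary: f)
  case 0
  then show ?case
    using continuous_on_compose2[of T f S g] assms(2) by simp
next
  case (Suc k)
  \<comment> \<open>The chain rule differentiates \<open>f\<close> in a direction that varies with
    \<open>x\<close>, where the induction hypothesis says nothing; expanding this direction in the
    standard basis leaves derivatives in fixed directions.\<close>
  define f' where "f' x v = (\<Sum>i\<in>Basis. (dir_deriv g v x \<bullet> i) *\<^sub>R dir_deriv f i (g x))" for x v
  have "((\<lambda>x. f (g x)) has_derivative f' x) (at x)" if "x \<in> S" for x
  proof -
    have gx: "g x \<in> T"
      using that assms(2) by blast
    have lin: "linear (frechet_derivative f (at (g x)))"
      using has_derivative_linear[OF Ck_on_SucD[OF Suc.prems(2) gx]] .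
    have "f' x v = frechet_derivative f (at (g x)) (dir_deriv g v x)" for v
    proof -
      have "frechet_derivative f (at (g x)) (\<Sum>i\<in>Basis. (dir_deriv g v x \<bullet> i) *\<^sub>R i) = f' x v"
        unfolding f'_def by (simp add: linear_sum[OF lin] linear_scale[OF lin])
      then show ?thesis by (simp add: euclidean_representation)
    qed
    then have "f' x = (\<lambda>v. frechet_derivative f (at (g x)) (dir_deriv g v x))"
      by blast
    then show ?thesis
      using has_derivative_compose[OF Ck_on_SucD[OF Suc.prems(1) that] Ck_on_SucD[OF Suc.prems(2) gx]]
      by simp
  qed
  moreover have "Ck_on k S (\<lambda>x. f' x v)" for v
    unfolding f'_def
    by (intro Ck_on_sum Ck_on_scaleR Ck_on_inner Ck_on_const assms(1) Suc.IH
        Ck_on_dir_deriv[OF Suc.prems(1)] Ck_on_dir_deriv[OF Suc.prems(2)]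
        Ck_on_Suc_imp[OF Suc.prems(1)])
  ultimately show ?case
    using Ck_on_SucI[OF assms(1)] by blast
qed

lemma Ck_on_vec_nth: "open S \<Longrightarrow> Ck_on k S f \<Longrightarrow> Ck_on k S (\<lambda>x. f x $ i)"
  by (rule Ck_on_bounded_linear_compose[OF bounded_linear_vec_nth])

lemmas Ck_on_Re = Ck_on_bounded_linear_compose[OF bounded_linear_Re]
lemmas Ck_on_Im = Ck_on_bounded_linear_compose[OF bounded_linear_Im]
lemmas Ck_on_of_real = Ck_on_bounded_linear_compose[OF bounded_linear_of_real]

lemma Ck_on_real_SucI:
  fixes f :: "real \<Rightarrow> real"
  assumes "\<And>x. (f has_real_derivative f' x) (at x)" "Ck_on k UNIV f'"
  shows "Ck_on (Suc k) UNIV f"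
  by (rule Ck_on_SucI[where f' = "\<lambda>x v. f' x * v"])
    (use assms in \<open>auto intro!: Ck_on_mult Ck_on_const simp: has_field_derivative_def\<close>)

lemma Ck_on_UNIV_isCont:
  "Ck_on k UNIV f \<Longrightarrow> isCont f x"
  using Ck_on_continuous_on[of k UNIV f] by (simp add: continuous_on_eq_continuous_at)

section \<open>Derivatives along lines and symmetry of second derivatives\<close>

lemma has_derivative_along_line:
  fixes f :: "'a::euclidean_space \<Rightarrow> 'b::real_normed_vector"
  assumes "f differentiable (at (x + t *\<^sub>R v))"
  shows "((\<lambda>t. f (x + t *\<^sub>R v)) has_vector_derivative dir_deriv f v (x + t *\<^sub>R v)) (at t)"
proof -
  have "((\<lambda>t. f (x + t *\<^sub>R v)) has_derivative
      (\<lambda>s. frechet_derivative f (at (x + t *\<^sub>R v)) (s *\<^sub>R v))) (at t)"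
    by (rule has_derivative_compose[where f = "\<lambda>t. x + t *\<^sub>R v"])
      (auto intro!: derivative_eq_intros has_derivative_frechetI[OF assms])
  then show ?thesis
    unfolding has_vector_derivative_def
    using linear_scale[OF linear_frechet_derivative[OF assms]] by simp
qed

lemma has_real_derivative_along_line:
  fixes f :: "'a::euclidean_space \<Rightarrow> real"
  assumes "f differentiable (at (x + t *\<^sub>R v))"
  shows "((\<lambda>t. f (x + t *\<^sub>R v)) has_real_derivative dir_deriv f v (x + t *\<^sub>R v)) (at t)"
  using has_derivative_along_line[OF assms] by (simp add: has_real_derivative_iff_has_vector_derivative)

text \<open>The second difference quotient is a value of each of the two mixed derivatives.\<close>

lemma second_difference:
  fixes f :: "'a::euclidean_space \<Rightarrow> real"
  assumes "Ck_on 2 UNIV f" "h > 0"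
  obtains a b where "0 < a" "a < h" "0 < b" "b < h"
    "f (x + h *\<^sub>R v + h *\<^sub>R w) - f (x + h *\<^sub>R v) - f (x + h *\<^sub>R w) + f x
      = h * h * dir_deriv (dir_deriv f v) w (x + a *\<^sub>R v + b *\<^sub>R w)"
proof -
  have d1: "f differentiable (at y)" and d2: "dir_deriv f v differentiable (at y)" for y
    using assms(1) by (auto simp: numeral_2_eq_2)
  define F where "F t = f (x + h *\<^sub>R w + t *\<^sub>R v) - f (x + t *\<^sub>R v)" for t
  define F' where "F' t = dir_deriv f v (x + h *\<^sub>R w + t *\<^sub>R v) - dir_deriv f v (x + t *\<^sub>R v)" for t
  have "(F has_real_derivative F' t) (at t)" for t
    unfolding F_def F'_def
    by (intro DERIV_diff has_real_derivative_along_line d1)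
  then obtain a where a: "0 < a" "a < h" "F h - F 0 = (h - 0) * F' a"
    using MVT2[of 0 h F F'] assms(2) by auto
  define G where "G t = dir_deriv f v (x + a *\<^sub>R v + t *\<^sub>R w)" for t
  have "(G has_real_derivative dir_deriv (dir_deriv f v) w (x + a *\<^sub>R v + t *\<^sub>R w)) (at t)" for t
    unfolding G_def by (rule has_real_derivative_along_line[OF d2])
  then obtain b where b: "0 < b" "b < h"
      "G h - G 0 = (h - 0) * dir_deriv (dir_deriv f v) w (x + a *\<^sub>R v + b *\<^sub>R w)"
    using MVT2[of 0 h G "\<lambda>t. dir_deriv (dir_deriv f v) w (x + a *\<^sub>R v + t *\<^sub>R w)"] assms(2) by auto
  have "F' a = G h - G 0"
    unfolding F'_def G_def by (simp add: algebra_simps)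
  then have "F h - F 0 = h * h * dir_deriv (dir_deriv f v) w (x + a *\<^sub>R v + b *\<^sub>R w)"
    using a b by simp
  moreover have "F h - F 0 = f (x + h *\<^sub>R v + h *\<^sub>R w) - f (x + h *\<^sub>R v) - f (x + h *\<^sub>R w) + f x"
    unfolding F_def by (simp add: algebra_simps)
  ultimately show ?thesis
    using that a b by simp
qed

lemma dir_deriv_commute_real:
  fixes f :: "'a::euclidean_space \<Rightarrow> real"
  assumes "Ck_on 2 UNIV f"
  shows "dir_deriv (dir_deriv f v) w x = dir_deriv (dir_deriv f w) v x"
proof (rule ccontr)
  define A where "A = dir_deriv (dir_deriv f v) w"
  define B where "B = dir_deriv (dir_deriv f w) v"
  assume "dir_deriv (dir_deriv f v) w x \<noteq> dir_deriv (dir_deriv f w) v x"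
  then have "A x \<noteq> B x" by (simp add: A_def B_def)
  define e where "e = dist (A x) (B x) / 2"
  have e: "e > 0" using \<open>A x \<noteq> B x\<close> by (simp add: e_def)
  have contA: "isCont A x" and contB: "isCont B x"
    using assms by (auto simp: numeral_2_eq_2 A_def B_def continuous_on_eq_continuous_at)
  obtain d1 where d1: "d1 > 0" "\<And>y. dist y x < d1 \<Longrightarrow> dist (A y) (A x) < e"
    using contA e unfolding continuous_at_eps_delta by blast
  obtain d2 where d2: "d2 > 0" "\<And>y. dist y x < d2 \<Longrightarrow> dist (B y) (B x) < e"
    using contB e unfolding continuous_at_eps_delta by blast
  \<comment> \<open>Small enough that x + a v + b w with 0 < a, b < h is closer to x than both d1
    and d2; the added 1 keeps the denominator positive.\<close>
  define h where "h = min d1 d2 / (2 * (norm v + norm w + 1))"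
  have pos: "norm v + norm w + 1 > 0"
    by (simp add: add_nonneg_pos)
  have h: "h > 0" using d1 d2 pos by (simp add: h_def)
  have hb: "h * (norm v + norm w) < min d1 d2"
  proof -
    have "h * (norm v + norm w) \<le> h * (norm v + norm w + 1)" using h by simp
    also have "\<dots> = min d1 d2 / 2" using pos unfolding h_def by (simp add: field_simps)
    also have "\<dots> < min d1 d2" using d1(1) d2(1) by linarith
    finally show ?thesis .
  qed
  have near: "dist (x + a *\<^sub>R v' + b *\<^sub>R w') x < min d1 d2"
    if "0 < a" "a < h" "0 < b" "b < h" "norm v' + norm w' = norm v + norm w" for a b v' w'
  proof -
    have "dist (x + a *\<^sub>R v' + b *\<^sub>R w') x \<le> a * norm v' + b * norm w'"
      using norm_triangle_ineq[of "a *\<^sub>R v'" "b *\<^sub>R w'"] that by (simp add: dist_norm add.assoc)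
    also have "\<dots> \<le> h * norm v' + h * norm w'"
      using that by (intro add_mono mult_right_mono) auto
    also have "\<dots> < min d1 d2" using hb that(5) by (simp add: distrib_left[symmetric])
    finally show ?thesis .
  qed
  obtain a b where ab: "0 < a" "a < h" "0 < b" "b < h"
    "f (x + h *\<^sub>R v + h *\<^sub>R w) - f (x + h *\<^sub>R v) - f (x + h *\<^sub>R w) + f x
      = h * h * A (x + a *\<^sub>R v + b *\<^sub>R w)"
    using second_difference[OF assms h] unfolding A_def by blast
  obtain a' b' where ab': "0 < a'" "a' < h" "0 < b'" "b' < h"
    "f (x + h *\<^sub>R w + h *\<^sub>R v) - f (x + h *\<^sub>R w) - f (x + h *\<^sub>R v) + f x
      = h * h * B (x + a' *\<^sub>R w + b' *\<^sub>R v)"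
    using second_difference[OF assms h] unfolding B_def by blast
  have "h * h * A (x + a *\<^sub>R v + b *\<^sub>R w) = h * h * B (x + a' *\<^sub>R w + b' *\<^sub>R v)"
    using ab(5) ab'(5) by (simp add: algebra_simps)
  then have eq: "A (x + a *\<^sub>R v + b *\<^sub>R w) = B (x + a' *\<^sub>R w + b' *\<^sub>R v)" using h by simp
  have "dist (A (x + a *\<^sub>R v + b *\<^sub>R w)) (A x) < e"
    using d1(2) near[of a b v w] ab by simp
  moreover have "dist (B (x + a' *\<^sub>R w + b' *\<^sub>R v)) (B x) < e"
    using d2(2) near[of a' b' w v] ab' by (simp add: add.commute)
  ultimately have "dist (A x) (B x) < 2 * e"
    using eq dist_triangle_less_add[of "A x" "A (x + a *\<^sub>R v + b *\<^sub>R w)" e "B x" e]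
    by (simp add: dist_commute)
  then show False by (simp add: e_def)
qed

lemma dir_deriv_commute:
  fixes f :: "'a::euclidean_space \<Rightarrow> 'b::euclidean_space"
  assumes "Ck_on 2 UNIV f"
  shows "dir_deriv (dir_deriv f v) w x = dir_deriv (dir_deriv f w) v x"
proof (rule euclidean_eqI)
  fix b :: 'b
  define fb where "fb y = f y \<bullet> b" for y
  have bl: "bounded_linear (\<lambda>y::'b. y \<bullet> b)" by (rule bounded_linear_inner_left)
  have 1: "dir_deriv fb v y = dir_deriv f v y \<bullet> b" for v y
    unfolding fb_def using assms
    by (intro dir_deriv_eq bounded_linear.has_derivative[OF bl] has_derivative_frechetI)
      (simp add: numeral_2_eq_2)
  have 2: "dir_deriv (dir_deriv fb v) w x = dir_deriv (dir_deriv f v) w x \<bullet> b" for v w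
  proof -
    have "dir_deriv fb v = (\<lambda>y. dir_deriv f v y \<bullet> b)" using 1 by blast
    moreover have "dir_deriv (\<lambda>y. dir_deriv f v y \<bullet> b) w x = dir_deriv (dir_deriv f v) w x \<bullet> b"
      using assms
      by (intro dir_deriv_eq bounded_linear.has_derivative[OF bl] has_derivative_frechetI)
        (simp add: numeral_2_eq_2)
    ultimately show ?thesis by simp
  qed
  have "Ck_on 2 UNIV fb"
    unfolding fb_def by (intro Ck_on_bounded_linear_compose[OF bl] assms) simp
  then show "dir_deriv (dir_deriv f v) w x \<bullet> b = dir_deriv (dir_deriv f w) v x \<bullet> b"
    using dir_deriv_commute_real[where f = fb and v = v and w = w and x = x] 2 by simp
qed

section \<open>Integrals of Jacobians over a period parallelogram\<close>

definition jac :: "('a::euclidean_space \<Rightarrow> real) \<Rightarrow> ('a \<Rightarrow> real) \<Rightarrow> 'a \<Rightarrow> 'a \<Rightarrow> 'a \<Rightarrow> real" where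
  "jac f q v w x = dir_deriv f v x * dir_deriv q w x - dir_deriv f w x * dir_deriv q v x"

lemma continuous_on_dir_deriv:
  assumes "Ck_on (Suc k) UNIV f"
  shows "continuous_on UNIV (dir_deriv f v)"
  using Ck_on_continuous_on[OF Ck_on_dir_deriv[OF assms]] .

lemma continuous_on_parallelogram:
  fixes f :: "'a::real_normed_vector \<Rightarrow> 'b::topological_space"
  assumes "continuous_on UNIV f"
  shows "continuous_on A (\<lambda>(s, t). f (p + s *\<^sub>R w1 + t *\<^sub>R w2))"
  unfolding split_def
  by (rule continuous_on_compose2[OF assms]) (auto intro!: continuous_intros)

lemma integral_derivative_period:
  fixes f :: "'a::euclidean_space \<Rightarrow> real"
  assumes "\<And>x. f differentiable (at x)" "0 \<le> T" "f (p + T *\<^sub>R w) = f p"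
  shows "integral {0..T} (\<lambda>s. dir_deriv f w (p + s *\<^sub>R w)) = 0"
proof -
  have "((\<lambda>s. dir_deriv f w (p + s *\<^sub>R w)) has_integral f (p + T *\<^sub>R w) - f (p + 0 *\<^sub>R w)) {0..T}"
    by (intro fundamental_theorem_of_calculus assms(2)
        has_vector_derivative_at_within[OF has_derivative_along_line] assms(1))
  then show ?thesis
    using assms(3) by (simp add: integral_unique)
qed

text \<open>Green's formula on a torus: by Fubini each term is integrated first along the direction
  in which it is differentiated, and the fundamental theorem gives the difference over a
  period.\<close>

lemma integral_curl_periodic:
  fixes f1 f2 :: "'a::euclidean_space \<Rightarrow> real"
  assumes "Ck_on (Suc 0) UNIV f1" "Ck_on (Suc 0) UNIV f2" "0 \<le> T"
    and per: "\<And>x. f2 (x + T *\<^sub>R w1) = f2 x" "\<And>x. f1 (x + T *\<^sub>R w2) = f1 x"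
  shows "integral (cbox (0, 0) (T, T))
    (\<lambda>(s, t). dir_deriv f2 w1 (p + s *\<^sub>R w1 + t *\<^sub>R w2) - dir_deriv f1 w2 (p + s *\<^sub>R w1 + t *\<^sub>R w2)) = 0"
proof -
  let ?x = "\<lambda>s t. p + s *\<^sub>R w1 + t *\<^sub>R w2"
  define g where "g = (\<lambda>(s, t). dir_deriv f2 w1 (?x s t))"
  define h where "h = (\<lambda>(s, t). dir_deriv f1 w2 (?x s t))"
  have cont: "continuous_on (cbox (0, 0) (T, T)) g" "continuous_on (cbox (0, 0) (T, T)) h"
    unfolding g_def h_def
    by (rule continuous_on_parallelogram[OF continuous_on_dir_deriv], rule assms)+
  have dif: "f1 differentiable (at x)" "f2 differentiable (at x)" for x
    using assms(1,2) by auto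
  have "integral (cbox (0, 0) (T, T)) h = integral (cbox 0 T) (\<lambda>s. integral (cbox 0 T) (\<lambda>t. h (s, t)))"
    by (rule integral_prod_continuous[OF cont(2)])
  also have "\<dots> = 0"
    using integral_derivative_period[OF dif(1) assms(3) per(2)] by (simp add: h_def)
  finally have h0: "integral (cbox (0, 0) (T, T)) h = 0" .
  have "integral (cbox (0, 0) (T, T)) g = integral (cbox 0 T) (\<lambda>s. integral (cbox 0 T) (\<lambda>t. g (s, t)))"
    by (rule integral_prod_continuous[OF cont(1)])
  also have "\<dots> = integral (cbox 0 T) (\<lambda>t. integral (cbox 0 T) (\<lambda>s. g (s, t)))"
    using integral_swap_continuous[of 0 0 T T "\<lambda>s t. g (s, t)"] cont(1) by simp
  also have "\<dots> = 0"
    using integral_derivative_period[OF dif(2) assms(3) per(1), of "p + t *\<^sub>R w2" for t]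
    by (simp add: g_def add.commute add.left_commute)
  finally have g0: "integral (cbox (0, 0) (T, T)) g = 0" .
  have "integral (cbox (0, 0) (T, T)) (\<lambda>z. g z - h z) = 0"
    using g0 h0 by (simp add: integral_diff integrable_continuous cont)
  then show ?thesis
    by (simp add: g_def h_def split_def)
qed

lemma dir_deriv_periodic:
  assumes "\<And>x. f (x + c) = f x" "f differentiable (at x)"
  shows "dir_deriv f v (x + c) = dir_deriv f v x"
proof -
  have "f differentiable (at (x + c))"
  proof -
    have "((\<lambda>y. f (y + (- c))) has_derivative frechet_derivative f (at x)) (at (x + c))"
      by (rule has_derivative_compose[where g = f, of "\<lambda>y. y + (- c)", THEN has_derivative_eq_rhs])
        (auto intro!: derivative_eq_intros has_derivative_frechetI assms(2))
    moreover have "f (y + (- c)) = f y" for y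
      using assms(1)[of "y + (- c)"] by simp
    ultimately show ?thesis by (auto simp: differentiable_def)
  qed
  then have "((\<lambda>y. f (y + c)) has_derivative frechet_derivative f (at (x + c))) (at x)"
    by (intro has_derivative_compose[where g = f, of "\<lambda>y. y + c", THEN has_derivative_eq_rhs])
      (auto intro!: derivative_eq_intros has_derivative_frechetI)
  then have "(f has_derivative frechet_derivative f (at (x + c))) (at x)"
    by (simp add: assms(1))
  then show ?thesis
    by (simp add: dir_deriv_eq)
qed

text \<open>The Jacobian is the curl of f dq: in d(f dq) = df \<and> dq the second derivatives of q
  cancel. This is the source of the asymmetric regularity, one derivative for f and two for
  q.\<close>

lemma integral_jac_periodic:
  fixes f q :: "'a::euclidean_space \<Rightarrow> real"
  assumes f: "Ck_on (Suc 0) UNIV f" and q: "Ck_on 2 UNIV q" and T: "0 \<le> T"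
    and per: "\<And>x. f (x + T *\<^sub>R w1) = f x" "\<And>x. f (x + T *\<^sub>R w2) = f x"
      "\<And>x. q (x + T *\<^sub>R w1) = q x" "\<And>x. q (x + T *\<^sub>R w2) = q x"
  shows "integral (cbox (0, 0) (T, T)) (\<lambda>(s, t). jac f q w1 w2 (p + s *\<^sub>R w1 + t *\<^sub>R w2)) = 0"
proof -
  have q1: "Ck_on (Suc 0) UNIV (dir_deriv q v)" for v
    using q Ck_on_dir_deriv[of "Suc 0" UNIV q v] by (simp only: numeral_2_eq_2)
  have qd: "q differentiable (at x)" for x
    using q by (simp add: numeral_2_eq_2)
  define f1 where "f1 x = f x * dir_deriv q w1 x" for x
  define f2 where "f2 x = f x * dir_deriv q w2 x" for x
  have D: "dir_deriv (\<lambda>x. f x * dir_deriv q w x) v x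
      = f x * dir_deriv (dir_deriv q w) v x + dir_deriv f v x * dir_deriv q w x" for v w x
    by (rule dir_deriv_eq[OF has_derivative_mult])
      (rule Ck_on_SucD[OF f] Ck_on_SucD[OF q1], simp)+
  have "integral (cbox (0, 0) (T, T))
    (\<lambda>(s, t). dir_deriv f2 w1 (p + s *\<^sub>R w1 + t *\<^sub>R w2) - dir_deriv f1 w2 (p + s *\<^sub>R w1 + t *\<^sub>R w2)) = 0"
  proof (rule integral_curl_periodic[OF _ _ T])
    show "Ck_on (Suc 0) UNIV f1" "Ck_on (Suc 0) UNIV f2"
      unfolding f1_def f2_def by (intro Ck_on_mult f q1 open_UNIV)+
    show "f2 (x + T *\<^sub>R w1) = f2 x" "f1 (x + T *\<^sub>R w2) = f1 x" for x
      unfolding f1_def f2_def using per dir_deriv_periodic[of q] qd by simp_all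
  qed
  moreover have "dir_deriv f2 w1 x - dir_deriv f1 w2 x = jac f q w1 w2 x" for x
    unfolding f1_def f2_def D jac_def using dir_deriv_commute[OF q, where v = w1 and w = w2 and x = x] by simp
  ultimately show ?thesis by simp
qed

section \<open>Zeros of maps of finite logarithmic energy\<close>

text \<open>The squared gradient of the logarithm of P + \<i> Q, which is |dP|^2 + |dQ|^2 over P^2 +
  Q^2, with \<open>e\<close> added to the denominator to make it finite at zeros.\<close>

definition log_energy :: "(real \<times> real \<Rightarrow> real) \<Rightarrow> (real \<times> real \<Rightarrow> real) \<Rightarrow> real \<Rightarrow> real \<times> real \<Rightarrow> real" where
  "log_energy P Q e z =
    ((dir_deriv P (1, 0) z)\<^sup>2 + (dir_deriv P (0, 1) z)\<^sup>2 + (dir_deriv Q (1, 0) z)\<^sup>2 + (dir_deriv Q (0, 1) z)\<^sup>2)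
      / ((P z)\<^sup>2 + (Q z)\<^sup>2 + e)"

text \<open>The left side is the derivative of half the logarithm of P^2 + Q^2 + e along the ray of
  slope \<open>t\<close>. Cauchy-Schwarz bounds its square by twice the energy density, and X \<le>
  1 / (2 r) + r X^2 / 2 does the rest. The coefficient 1/2 of 1/r is what counts: near a zero the
  logarithm has to rise at least at the rate 1/r on average.\<close>

lemma log_derivative_bound:
  fixes r e c a b a' b' P Q t :: real
  assumes "r > 0" "e > 0" "0 \<le> t" "t \<le> 1"
  shows "(P * (a + t * b) + Q * (a' + t * b')) / (P\<^sup>2 + Q\<^sup>2 + e)
    \<le> 1 / (2 * r) + r * ((a\<^sup>2 + b\<^sup>2 + a'\<^sup>2 + b'\<^sup>2) / (P\<^sup>2 + Q\<^sup>2 + e))"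
proof -
  define N where "N = P\<^sup>2 + Q\<^sup>2 + e"
  define A where "A = a + t * b"
  define B where "B = a' + t * b'"
  have N: "N > 0" unfolding N_def using assms by (simp add: add_nonneg_pos)
  have t: "t\<^sup>2 \<le> 1" using assms(3,4) by (simp add: power_le_one)
  have sq: "(x + t * y)\<^sup>2 \<le> 2 * (x\<^sup>2 + y\<^sup>2)" for x y :: real
  proof -
    have "(x + t * y)\<^sup>2 \<le> 2 * (x\<^sup>2 + (t * y)\<^sup>2)"
      using sum_squares_bound[of x "t * y"] by (simp add: power2_sum)
    also have "(t * y)\<^sup>2 \<le> y\<^sup>2" using t by (simp add: power_mult_distrib mult_left_le_one_le)
    finally show ?thesis by simp
  qed
  have "(P * A + Q * B)\<^sup>2 \<le> (P\<^sup>2 + Q\<^sup>2) * (A\<^sup>2 + B\<^sup>2)"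
    using zero_le_power2[of "P * B - Q * A"] by (simp add: power2_eq_square algebra_simps)
  also have "\<dots> \<le> N * (A\<^sup>2 + B\<^sup>2)"
    unfolding N_def using assms by (intro mult_right_mono) auto
  also have "\<dots> \<le> N * (2 * (a\<^sup>2 + b\<^sup>2 + a'\<^sup>2 + b'\<^sup>2))"
    using sq[of a b] sq[of a' b'] N unfolding A_def B_def by (intro mult_left_mono) auto
  finally have 1: "(P * A + Q * B)\<^sup>2 \<le> N * (2 * (a\<^sup>2 + b\<^sup>2 + a'\<^sup>2 + b'\<^sup>2))" .
  define X where "X = (P * A + Q * B) / N"
  have "X\<^sup>2 = (P * A + Q * B)\<^sup>2 / (N * N)"
    unfolding X_def by (simp add: power_divide power2_eq_square)
  also have "\<dots> \<le> N * (2 * (a\<^sup>2 + b\<^sup>2 + a'\<^sup>2 + b'\<^sup>2)) / (N * N)"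
    using 1 N by (intro divide_right_mono) auto
  also have "\<dots> = 2 * ((a\<^sup>2 + b\<^sup>2 + a'\<^sup>2 + b'\<^sup>2) / N)" using N by simp
  finally have X2: "X\<^sup>2 \<le> 2 * ((a\<^sup>2 + b\<^sup>2 + a'\<^sup>2 + b'\<^sup>2) / N)" .
  have "2 * r * X \<le> 1 + (r * X)\<^sup>2" using sum_squares_bound[of 1 "r * X"] by simp
  then have "X \<le> 1 / (2 * r) + r * X\<^sup>2 / 2"
    using assms(1) by (simp add: field_simps power2_eq_square)
  also have "\<dots> \<le> 1 / (2 * r) + r * ((a\<^sup>2 + b\<^sup>2 + a'\<^sup>2 + b'\<^sup>2) / N)"
  proof -
    have "r * X\<^sup>2 \<le> 2 * (r * ((a\<^sup>2 + b\<^sup>2 + a'\<^sup>2 + b'\<^sup>2) / N))"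
      using mult_left_mono[OF X2, of r] assms(1) by (simp only: mult.left_commute less_imp_le)
    then show ?thesis by linarith
  qed
  finally show ?thesis unfolding X_def A_def B_def N_def .
qed

lemma log_energy_nonneg: "e > 0 \<Longrightarrow> 0 \<le> log_energy P Q e z"
  unfolding log_energy_def by simp

lemma log_energy_continuous_on:
  assumes "Ck_on (Suc 0) UNIV P" "Ck_on (Suc 0) UNIV Q" "e > 0"
  shows "continuous_on S (log_energy P Q e)"
proof -
  have pos: "(P z)\<^sup>2 + (Q z)\<^sup>2 + e \<noteq> 0" for z
    using assms(3) by (smt (verit) zero_le_power2)
  have "continuous_on UNIV (log_energy P Q e)"
    unfolding log_energy_def[abs_def]
    by (intro continuous_intros continuous_on_dir_deriv[OF assms(1)]
        continuous_on_dir_deriv[OF assms(2)] Ck_on_continuous_on[OF assms(1)]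
        Ck_on_continuous_on[OF assms(2)]) (use pos in auto)
  then show ?thesis by (rule continuous_on_subset) simp
qed

text \<open>Integrating along rays from the origin and then over a sector costs only the Jacobian
  factor \<open>r\<close>, which is the weight in \<open>log_derivative_bound\<close>.\<close>

lemma sector_integral_le:
  fixes f :: "real \<times> real \<Rightarrow> real"
  assumes cont: "continuous_on UNIV f" and nn: "\<And>z. 0 \<le> f z"
    and r: "0 < r0" "r0 \<le> x" "x \<le> 2" and t: "0 \<le> t1" "t1 \<le> t2" "t2 \<le> 1"
  shows "integral {t1..t2} (\<lambda>t. integral {r0..x} (\<lambda>r. r * f (r, r * t)))
    \<le> integral (cbox (0, 0) (2, 2)) f"
proof -
  have c: "continuous_on S (\<lambda>z. f (h z))" if "continuous_on S h" for h :: "'c::topological_space \<Rightarrow> real \<times> real" and S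
    using continuous_on_compose2[OF cont that] by simp
  have "integral {t1..t2} (\<lambda>t. integral {r0..x} (\<lambda>r. r * f (r, r * t)))
      = integral {r0..x} (\<lambda>r. integral {t1..t2} (\<lambda>t. r * f (r, r * t)))"
    using integral_swap_continuous[of t1 r0 t2 x "\<lambda>t r. r * f (r, r * t)"]
    by (simp add: split_def continuous_on_mult c continuous_intros)
  also have "\<dots> \<le> integral {r0..x} (\<lambda>r. integral {0..2} (\<lambda>y. f (r, y)))"
  proof (rule integral_le)
    show "(\<lambda>r. integral {t1..t2} (\<lambda>t. r * f (r, r * t))) integrable_on {r0..x}"
      using integral_continuous_on_param[of "{r0..x}" t1 t2 "\<lambda>r t. r * f (r, r * t)"]
      by (intro integrable_continuous_real) (simp add: split_def c continuous_intros)
    show "(\<lambda>r. integral {0..2} (\<lambda>y. f (r, y))) integrable_on {r0..x}"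
      using integral_continuous_on_param[of "{r0..x}" 0 2 "\<lambda>r y. f (r, y)"]
      by (intro integrable_continuous_real) (simp add: split_def c continuous_intros)
    fix r assume "r \<in> {r0..x}"
    then have r': "0 < r" "r \<le> 2" using r by auto
    have int: "(\<lambda>y. f (r, y)) integrable_on {a..b}" for a b
      by (intro integrable_continuous_real c continuous_intros)
    \<comment> \<open>Substitution y = r t at fixed r; its factor 1/r is cancelled by the weight
      r.\<close>
    have "((\<lambda>t. f (r, r * t)) has_integral (1 / r) *\<^sub>R integral {0..r} (\<lambda>y. f (r, y))) {0..1}"
      using has_integral_stretch_real[OF integrable_integral[OF int, of 0 r], of r] r'
      by (simp add: image_divide_atLeastAtMost)
    then have "((\<lambda>t. r * f (r, r * t)) has_integral integral {0..r} (\<lambda>y. f (r, y))) {0..1}"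
      using has_integral_mult_right[of "\<lambda>t. f (r, r * t)" _ "{0..1}" r] r' by fastforce
    then have "integral {0..1} (\<lambda>t. r * f (r, r * t)) = integral {0..r} (\<lambda>y. f (r, y))"
      by (rule integral_unique)
    moreover have "integral {t1..t2} (\<lambda>t. r * f (r, r * t)) \<le> integral {0..1} (\<lambda>t. r * f (r, r * t))"
      using r' t nn
      by (intro integral_subset_le integrable_continuous_real continuous_intros c) auto
    moreover have "integral {0..r} (\<lambda>y. f (r, y)) \<le> integral {0..2} (\<lambda>y. f (r, y))"
      using r' nn by (intro integral_subset_le int) auto
    ultimately show "integral {t1..t2} (\<lambda>t. r * f (r, r * t)) \<le> integral {0..2} (\<lambda>y. f (r, y))"
      by linarith
  qed
  also have "\<dots> \<le> integral {0..2} (\<lambda>r. integral {0..2} (\<lambda>y. f (r, y)))"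
  proof -
    have "continuous_on UNIV (\<lambda>r. integral (cbox 0 2) (\<lambda>y. f (r, y)))"
      by (rule integral_continuous_on_param) (simp add: split_def c continuous_intros)
    then have int: "(\<lambda>r. integral {0..2} (\<lambda>y. f (r, y))) integrable_on {a..b}" for a b
      by (intro integrable_continuous_real) (auto intro: continuous_on_subset)
    show ?thesis
      using r nn by (intro integral_subset_le int)
        (auto intro!: integral_nonneg integrable_continuous_real c continuous_intros)
  qed
  also have "\<dots> = integral (cbox (0, 0) (2, 2)) f"
    using integral_prod_continuous[of 0 0 2 2 f] continuous_on_subset[OF cont] by simp
  finally show ?thesis .
qed

text \<open>\<open>log_derivative_bound\<close> integrated along a ray; the term 1 / (2 r) there
  produces half of ln x - ln r0, and this half is all that is not charged to the energy.\<close>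

lemma ray_integral_bound:
  fixes P Q :: "real \<times> real \<Rightarrow> real"
  assumes P: "Ck_on (Suc 0) UNIV P" and Q: "Ck_on (Suc 0) UNIV Q" and e: "e > 0"
    and r: "0 < r0" "r0 \<le> x" and t: "0 \<le> t" "t \<le> 1"
  defines "L \<equiv> \<lambda>r. ln ((P (r, r * t))\<^sup>2 + (Q (r, r * t))\<^sup>2 + e) / 2"
  shows "L x - L r0 - (ln x - ln r0) / 2 \<le> integral {r0..x} (\<lambda>r. r * log_energy P Q e (r, r * t))"
proof -
  define D where "D r = (P (r, r * t) * (dir_deriv P (1, 0) (r, r * t) + t * dir_deriv P (0, 1) (r, r * t))
    + Q (r, r * t) * (dir_deriv Q (1, 0) (r, r * t) + t * dir_deriv Q (0, 1) (r, r * t)))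
      / ((P (r, r * t))\<^sup>2 + (Q (r, r * t))\<^sup>2 + e)" for r
  have pos: "(P z)\<^sup>2 + (Q z)\<^sup>2 + e > 0" for z
    using e by (simp add: add_nonneg_pos)
  have der: "((\<lambda>r. F (r, r * t)) has_real_derivative
      (dir_deriv F (1, 0) (r, r * t) + t * dir_deriv F (0, 1) (r, r * t))) (at r)"
    if F: "Ck_on (Suc 0) UNIV F" for F :: "real \<times> real \<Rightarrow> real" and r
  proof -
    have d: "F differentiable (at z)" for z by (rule Ck_on_differentiable[OF F]) simp
    have "dir_deriv F (1, t) z = dir_deriv F (1, 0) z + t * dir_deriv F (0, 1) z" for z
      using linear_add[OF linear_frechet_derivative[OF d], of z "(1, 0)" "t *\<^sub>R (0, 1)"]
        linear_scale[OF linear_frechet_derivative[OF d], of z t "(0, 1)"] by simp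
    then show ?thesis
      using has_real_derivative_along_line[where x = 0 and t = r and v = "(1, t)", OF d] by simp
  qed
  define N where "N r = (P (r, r * t))\<^sup>2 + (Q (r, r * t))\<^sup>2 + e" for r
  have "(N has_real_derivative 2 * (D r * N r)) (at r)" for r
    unfolding N_def[abs_def] D_def using pos[of "(r, r * t)"]
    by (auto intro!: derivative_eq_intros der[OF P] der[OF Q])
  moreover have Npos: "N r > 0" for r
    using pos unfolding N_def .
  ultimately have "((\<lambda>r. ln (N r)) has_real_derivative 1 / N r * (2 * (D r * N r))) (at r)" for r
    by (intro DERIV_chain2[OF DERIV_ln_divide])
  moreover have "1 / N r * (2 * (D r * N r)) = 2 * D r" for r
    using Npos[of r] by simp
  ultimately have lnN: "((\<lambda>r. ln (N r)) has_real_derivative 2 * D r) (at r)" for r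
    by simp
  have L: "L = (\<lambda>r. ln (N r) / 2)"
    unfolding L_def N_def by simp
  have dL: "((\<lambda>r. L r - ln r / 2) has_real_derivative D r - 1 / (2 * r)) (at r)" if "r > 0" for r
    using DERIV_diff[OF DERIV_cdivide[OF lnN, of 2] DERIV_cdivide[OF DERIV_ln_divide[OF that], of 2]]
    unfolding L by (simp add: mult.commute)
  have "((\<lambda>r. L r - ln r / 2) has_vector_derivative D s - 1 / (2 * s)) (at s within {r0..x})"
    if "s \<in> {r0..x}" for s
    by (rule has_vector_derivative_at_within,
        unfold has_real_derivative_iff_has_vector_derivative[symmetric], rule dL)
      (use that r in simp)
  then have "((\<lambda>r. D r - 1 / (2 * r)) has_integral (L x - ln x / 2) - (L r0 - ln r0 / 2)) {r0..x}"
    by (rule fundamental_theorem_of_calculus[OF r(2)])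
  moreover have "((\<lambda>r. r * log_energy P Q e (r, r * t)) has_integral
      integral {r0..x} (\<lambda>r. r * log_energy P Q e (r, r * t))) {r0..x}"
    by (intro integrable_integral integrable_continuous_real continuous_intros
        continuous_on_compose2[OF log_energy_continuous_on[OF P Q e, of UNIV]]) simp
  moreover have "D r - 1 / (2 * r) \<le> r * log_energy P Q e (r, r * t)" if "r \<in> {r0..x}" for r
  proof -
    have "D r \<le> 1 / (2 * r) + r * log_energy P Q e (r, r * t)"
      unfolding D_def log_energy_def using that r by (intro log_derivative_bound e t) auto
    then show ?thesis by linarith
  qed
  ultimately have "(L x - ln x / 2) - (L r0 - ln r0 / 2)
      \<le> integral {r0..x} (\<lambda>r. r * log_energy P Q e (r, r * t))"
    by (rule has_integral_le)
  then show ?thesis by (simp add: field_simps)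
qed

text \<open>Differentiability at a zero gives at least linear vanishing, so near it the logarithm of
  |P| lies below ln r plus a constant.\<close>

lemma linear_bound_near_zero:
  fixes P :: "real \<times> real \<Rightarrow> real"
  assumes "P differentiable (at 0)" "P 0 = 0"
  obtains K d where "d > 0" "K \<ge> 0" "\<And>z. norm z < d \<Longrightarrow> \<bar>P z\<bar> \<le> K * norm z"
proof -
  obtain P' where P': "(P has_derivative P') (at 0)" using assms(1) by (auto simp: differentiable_def)
  obtain B where B: "B > 0" "\<And>h. norm (P' h) \<le> norm h * B"
    using bounded_linear.pos_bounded[OF has_derivative_bounded_linear[OF P']] by blast
  obtain d where d: "d > 0" "\<And>y. norm (y - 0) < d \<Longrightarrow> norm (P y - P 0 - P' (y - 0)) \<le> 1 * norm (y - 0)"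
    using P' unfolding has_derivative_at_alt by (metis zero_less_one)
  show ?thesis
  proof (rule that[of d "B + 1"])
    fix z :: "real \<times> real" assume "norm z < d"
    then have "norm (P z - P' z) \<le> norm z" using d(2)[of z] assms(2) by simp
    then show "\<bar>P z\<bar> \<le> (B + 1) * norm z" using B(2)[of z] by (simp add: algebra_simps)
  qed (use d B in auto)
qed

text \<open>If P^2 + Q^2 stayed above \<open>eta\<close> for all these slopes, half its logarithm
  would rise along each ray from about ln r to a constant, that is by - ln r.
  \<open>ray_integral_bound\<close> provides only half of this outside the energy. Integrating over
  an interval of slopes turns the ray integrals into a plane integral bounded by \<open>C\<close>,
  so - ln r would remain bounded as r tends to 0.\<close>

lemma zero_of_bounded_log_energy_aux:
  fixes P Q :: "real \<times> real \<Rightarrow> real"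
  assumes P: "Ck_on (Suc 0) UNIV P" and Q: "Ck_on (Suc 0) UNIV Q"
    and zero: "P 0 = 0" "Q 0 = 0"
    and C: "\<And>e. e > 0 \<Longrightarrow> integral (cbox (0, 0) (2, 2)) (log_energy P Q e) \<le> C"
    and x: "1 \<le> x" "x \<le> 2" and t: "0 \<le> t1" "t1 < t2" "t2 \<le> 1" and eta: "eta > 0"
  shows "\<exists>t\<in>{t1..t2}. (P (x, x * t))\<^sup>2 + (Q (x, x * t))\<^sup>2 < eta"
proof (rule ccontr)
  assume "\<not> ?thesis"
  then have low: "eta \<le> (P (x, x * t))\<^sup>2 + (Q (x, x * t))\<^sup>2" if "t \<in> {t1..t2}" for t
    using that by force
  obtain K1 d1 where K1: "d1 > 0" "K1 \<ge> 0" "\<And>z. norm z < d1 \<Longrightarrow> \<bar>P z\<bar> \<le> K1 * norm z"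
    using linear_bound_near_zero[OF Ck_on_differentiable[OF P UNIV_I] zero(1)] by metis
  obtain K2 d2 where K2: "d2 > 0" "K2 \<ge> 0" "\<And>z. norm z < d2 \<Longrightarrow> \<bar>Q z\<bar> \<le> K2 * norm z"
    using linear_bound_near_zero[OF Ck_on_differentiable[OF Q UNIV_I] zero(2)] by metis
  define M where "M = 2 * K1\<^sup>2 + 2 * K2\<^sup>2 + 1"
  have M: "M > 0" unfolding M_def by (simp add: add_nonneg_pos)
  define b where "b = t2 - t1"
  have b: "b > 0" using t unfolding b_def by simp
  have bound: "b * (- ln r) \<le> 2 * C + b * (ln x + ln M - ln eta)"
    if r: "0 < r" "r < 1" "2 * r < d1" "2 * r < d2" for r
  proof -
    \<comment> \<open>The regularisation is tied to the inner radius: at distance of order r from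
      the zero, P^2 + Q^2 is already at most a multiple of r^2, and adding r^2 preserves this
      bound.\<close>
    define e where "e = r\<^sup>2"
    have e: "e > 0" using r unfolding e_def by simp
    define L where "L s t = ln ((P (s, s * t))\<^sup>2 + (Q (s, s * t))\<^sup>2 + e) / 2" for s t
    have L1: "ln eta / 2 \<le> L x t" if "t \<in> {t1..t2}" for t
      unfolding L_def using low[OF that] eta e by simp
    have L2: "L r t \<le> ln r + ln M / 2" if "t \<in> {t1..t2}" for t
    proof -
      have t': "0 \<le> t" "t \<le> 1" using that t by auto
      have "(norm (r, r * t))\<^sup>2 = r\<^sup>2 + (r * t)\<^sup>2" by (simp add: norm_Pair)
      also have "(r * t)\<^sup>2 \<le> r\<^sup>2"
        using t' r by (simp add: power_mult_distrib mult_left_le power_le_one)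
      finally have n2: "(norm (r, r * t))\<^sup>2 \<le> 2 * r\<^sup>2" by simp
      also have "\<dots> \<le> (2 * r)\<^sup>2" by (simp add: power2_eq_square)
      finally have "(norm (r, r * t))\<^sup>2 \<le> (2 * r)\<^sup>2" .
      then have n: "norm (r, r * t) \<le> 2 * r"
        by (rule power2_le_imp_le) (use r in simp)
      have "(P (r, r * t))\<^sup>2 \<le> (K1 * norm (r, r * t))\<^sup>2"
        using K1(3)[of "(r, r * t)"] n r by (intro abs_le_square_iff[THEN iffD1]) simp
      also have "\<dots> \<le> K1\<^sup>2 * (2 * r\<^sup>2)"
        unfolding power_mult_distrib using n2 by (intro mult_left_mono) auto
      finally have 1: "(P (r, r * t))\<^sup>2 \<le> K1\<^sup>2 * (2 * r\<^sup>2)" .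
      have "(Q (r, r * t))\<^sup>2 \<le> (K2 * norm (r, r * t))\<^sup>2"
        using K2(3)[of "(r, r * t)"] n r by (intro abs_le_square_iff[THEN iffD1]) simp
      also have "\<dots> \<le> K2\<^sup>2 * (2 * r\<^sup>2)"
        unfolding power_mult_distrib using n2 by (intro mult_left_mono) auto
      finally have 2: "(Q (r, r * t))\<^sup>2 \<le> K2\<^sup>2 * (2 * r\<^sup>2)" .
      have 3: "(P (r, r * t))\<^sup>2 + (Q (r, r * t))\<^sup>2 + e \<le> r\<^sup>2 * M"
      proof -
        have "r\<^sup>2 * M = K1\<^sup>2 * (2 * r\<^sup>2) + K2\<^sup>2 * (2 * r\<^sup>2) + e"
          unfolding M_def e_def by algebra
        then show ?thesis using 1 2 by linarith
      qed
      then have "ln ((P (r, r * t))\<^sup>2 + (Q (r, r * t))\<^sup>2 + e) \<le> ln (r\<^sup>2 * M)"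
        using e by (intro ln_mono) (simp_all add: add_nonneg_pos)
      also have "\<dots> = 2 * ln r + ln M"
        using r M by (simp add: ln_mult ln_realpow)
      finally show ?thesis unfolding L_def by simp
    qed
    define c where "c = ln eta / 2 - (ln r + ln M / 2) - (ln x - ln r) / 2"
    have "c \<le> integral {r..x} (\<lambda>s. s * log_energy P Q e (s, s * t))" if "t \<in> {t1..t2}" for t
      using ray_integral_bound[OF P Q e, of r x t] L1[OF that] L2[OF that] r x t that
      unfolding c_def L_def by simp
    moreover have "continuous_on {t1..t2} (\<lambda>t. integral (cbox r x) (\<lambda>s. s * log_energy P Q e (s, s * t)))"
      by (rule integral_continuous_on_param) (auto simp: split_def intro!: continuous_intros
          continuous_on_compose2[OF log_energy_continuous_on[OF P Q e, of UNIV]])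
    ultimately have "integral {t1..t2} (\<lambda>t. c)
        \<le> integral {t1..t2} (\<lambda>t. integral {r..x} (\<lambda>s. s * log_energy P Q e (s, s * t)))"
      by (intro integral_le integrable_continuous_real) auto
    also have "\<dots> \<le> integral (cbox (0, 0) (2, 2)) (log_energy P Q e)"
      using r x t by (intro sector_integral_le log_energy_continuous_on[OF P Q e]
          log_energy_nonneg e) auto
    also have "\<dots> \<le> C" using C[OF e] .
    finally have "b * c \<le> C" using t by (simp add: b_def)
    moreover have "2 * (b * c) = b * (- ln r) - b * (ln x + ln M - ln eta)"
      unfolding c_def by algebra
    ultimately show ?thesis by linarith
  qed
  \<comment> \<open>The upper bound for - ln r contained in \<open>bound\<close>; it does not depend
    on r.\<close>
  define X where "X = (2 * C + b * (ln x + ln M - ln eta)) / b"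
  have "\<forall>\<^sub>F r in at_right 0. ln r < - X - 1"
    using ln_at_0 unfolding filterlim_at_bot_dense by blast
  moreover have "\<forall>\<^sub>F r in at_right 0. 0 < r \<and> r < min 1 (min (d1 / 2) (d2 / 2))"
    using K1(1) K2(1) by (intro eventually_at_rightI[of 0 "min 1 (min (d1 / 2) (d2 / 2))"]) auto
  ultimately have "\<forall>\<^sub>F r in at_right (0::real). False"
  proof eventually_elim
    case (elim r)
    then have "b * (- ln r) \<le> 2 * C + b * (ln x + ln M - ln eta)"
      by (intro bound) auto
    then have "- ln r \<le> X" unfolding X_def using b by (simp add: pos_le_divide_eq mult.commute)
    then show ?case using elim by linarith
  qed
  then show False by simp
qed

text \<open>Points of this rectangle lie on rays of slope y / x in [0, 1]. Arbitrarily small values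
  occur on every short interval of slopes, so continuity gives an exact zero.\<close>

lemma zero_of_bounded_log_energy:
  fixes P Q :: "real \<times> real \<Rightarrow> real"
  assumes P: "Ck_on (Suc 0) UNIV P" and Q: "Ck_on (Suc 0) UNIV Q"
    and zero: "P 0 = 0" "Q 0 = 0"
    and C: "\<And>e. e > 0 \<Longrightarrow> integral (cbox (0, 0) (2, 2)) (log_energy P Q e) \<le> C"
    and x: "1 \<le> x" "x \<le> 2" and y: "0 \<le> y" "y \<le> 1"
  shows "P (x, y) = 0 \<and> Q (x, y) = 0"
proof (rule ccontr)
  define N where "N t = (P (x, x * t))\<^sup>2 + (Q (x, x * t))\<^sup>2" for t
  define t0 where "t0 = y / x"
  assume "\<not> ?thesis"
  then have N0: "N t0 > 0"
    unfolding N_def t0_def using x by (simp add: sum_power2_gt_zero_iff)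
  have t0: "0 \<le> t0" "t0 \<le> 1" unfolding t0_def using x y by auto
  have "isCont N t0"
    unfolding N_def[abs_def]
    by (intro continuous_intros isCont_o2[OF _ Ck_on_UNIV_isCont[OF P]]
        isCont_o2[OF _ Ck_on_UNIV_isCont[OF Q]])
  then obtain d where d: "d > 0" "\<And>t. \<bar>t - t0\<bar> < d \<Longrightarrow> \<bar>N t - N t0\<bar> < N t0 / 2"
    using N0 unfolding continuous_at_eps_delta dist_real_def by (meson half_gt_zero)
  \<comment> \<open>At most half the length of [0, 1], so that one of the two one-sided intervals at
    \<open>t0\<close> stays inside [0, 1].\<close>
  define c where "c = min (d / 2) (1 / 2)"
  have c: "0 < c" "c < d" "c \<le> 1 / 2" unfolding c_def using d by auto
  obtain t1 t2 where t: "0 \<le> t1" "t1 < t2" "t2 \<le> 1" "{t1..t2} \<subseteq> {t0 - c..t0 + c}"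
  proof (cases "t0 \<le> 1 / 2")
    case True
    then show ?thesis using that[of t0 "t0 + c"] t0 c by auto
  next
    case False
    then show ?thesis using that[of "t0 - c" t0] t0 c by auto
  qed
  obtain t where "t \<in> {t1..t2}" "N t < N t0 / 2"
    using zero_of_bounded_log_energy_aux[OF P Q zero C x t(1-3), of "N t0 / 2"] N0
    unfolding N_def by auto
  moreover from this have "\<bar>t - t0\<bar> < d" using t(4) c by force
  ultimately show False using d(2)[of t] by linarith
qed

section \<open>The non-real root of a real cubic\<close>

definition cubic :: "real \<Rightarrow> real \<Rightarrow> real \<Rightarrow> complex \<Rightarrow> complex" where
  "cubic c2 c1 c0 z = z ^ 3 + of_real c2 * z\<^sup>2 + of_real c1 * z + of_real c0"

text \<open>A non-real double root and its conjugate would make four roots of a real cubic, counted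
  with multiplicity.\<close>

lemma cubic_double_root_real:
  assumes "cubic c2 c1 c0 z = 0" "3 * z\<^sup>2 + 2 * of_real c2 * z + of_real c1 = 0"
  shows "Im z = 0"
proof (rule ccontr)
  obtain x y where z: "z = Complex x y" by (cases z)
  assume "Im z \<noteq> 0"
  then have y: "y \<noteq> 0" by (simp add: z)
  have 1: "3 * x\<^sup>2 * y - y ^ 3 + 2 * c2 * x * y + c1 * y = 0"
    using arg_cong[OF assms(1), of Im]
    by (simp add: z cubic_def power2_eq_square power3_eq_cube algebra_simps)
  have 2: "6 * x * y + 2 * c2 * y = 0" "3 * (x\<^sup>2 - y\<^sup>2) + 2 * c2 * x + c1 = 0"
    using arg_cong[OF assms(2), of Im] arg_cong[OF assms(2), of Re]
    by (simp_all add: z power2_eq_square algebra_simps)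
  have "y * (6 * x + 2 * c2) = 0" using 2(1) by (simp add: algebra_simps)
  then have c2: "c2 = - 3 * x" using y by simp
  have c1: "c1 = 3 * x\<^sup>2 + 3 * y\<^sup>2" using 2(2) unfolding c2 by (simp add: algebra_simps power2_eq_square)
  have "2 * y ^ 3 = 0" using 1 unfolding c1 c2 by (simp add: algebra_simps power2_eq_square power3_eq_cube)
  then show False using y by simp
qed

text \<open>Vieta's formulas: the roots add up to - c2, so the third one is the real number - c2 - 2
  Re s.\<close>

lemma cubic_factor:
  assumes "cubic c2 c1 c0 s = 0" "Im s \<noteq> 0"
  shows "c1 = (cmod s)\<^sup>2 - 2 * (c2 + 2 * Re s) * Re s" "c0 = (c2 + 2 * Re s) * (cmod s)\<^sup>2"
    "cubic c2 c1 c0 z = (z - s) * (z - cnj s) * (z - of_real (- c2 - 2 * Re s))"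
proof -
  obtain x y where s: "s = Complex x y" by (cases s)
  have y: "y \<noteq> 0" using assms(2) s by simp
  have 1: "3 * x\<^sup>2 * y - y ^ 3 + 2 * c2 * x * y + c1 * y = 0"
    using arg_cong[OF assms(1), of Im]
    by (simp add: s cubic_def power2_eq_square power3_eq_cube algebra_simps)
  have 2: "x ^ 3 - 3 * x * y\<^sup>2 + c2 * (x\<^sup>2 - y\<^sup>2) + c1 * x + c0 = 0"
    using arg_cong[OF assms(1), of Re]
    by (simp add: s cubic_def power2_eq_square power3_eq_cube algebra_simps)
  have "y * (3 * x\<^sup>2 - y\<^sup>2 + 2 * c2 * x + c1) = 0"
    using 1 by (simp add: power2_eq_square power3_eq_cube algebra_simps)
  then have c1: "c1 = y\<^sup>2 - 3 * x\<^sup>2 - 2 * c2 * x" using y by auto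
  have n: "(cmod s)\<^sup>2 = x\<^sup>2 + y\<^sup>2" by (simp add: s cmod_power2)
  show g1: "c1 = (cmod s)\<^sup>2 - 2 * (c2 + 2 * Re s) * Re s"
    unfolding c1 n by (simp add: s power2_eq_square algebra_simps)
  have c0: "c0 = 2 * x ^ 3 + 2 * x * y\<^sup>2 + c2 * (x\<^sup>2 + y\<^sup>2)"
    using 2 unfolding c1 by (simp add: power2_eq_square power3_eq_cube algebra_simps)
  show "c0 = (c2 + 2 * Re s) * (cmod s)\<^sup>2"
    unfolding c0 n by (simp add: s power2_eq_square power3_eq_cube algebra_simps)
  obtain u v where z: "z = Complex u v" by (cases z)
  show "cubic c2 c1 c0 z = (z - s) * (z - cnj s) * (z - of_real (- c2 - 2 * Re s))"
    unfolding c0 c1 cubic_def z s complex_eq_iff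
    by (simp add: power2_eq_square power3_eq_cube algebra_simps)
qed

lemma cubic_upper_root_unique:
  assumes "cubic c2 c1 c0 s = 0" "Im s > 0" "cubic c2 c1 c0 t = 0" "Im t > 0"
  shows "s = t"
proof -
  have "(t - s) * (t - cnj s) * (t - of_real (- c2 - 2 * Re s)) = 0"
    using cubic_factor(3)[OF assms(1), of t] assms by simp
  then have "t = s \<or> t = cnj s \<or> t = of_real (- c2 - 2 * Re s)" by auto
  then show ?thesis
  proof (elim disjE)
    assume "t = cnj s"
    then have "Im t = - Im s" by simp
    then show ?thesis using assms by linarith
  next
    assume "t = of_real (- c2 - 2 * Re s)"
    then have "Im t = 0" by (metis Im_complex_of_real)
    then show ?thesis using assms by linarith
  qed simp
qed

lemma cubic_cnj: "cubic c2 c1 c0 (cnj z) = cnj (cubic c2 c1 c0 z)"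
  by (simp add: cubic_def)

text \<open>The coefficients of \<open>(z - m) * ((z - x)\<^sup>2 + y\<^sup>2)\<close>.\<close>

definition root_coeffs :: "real \<times> real \<times> real \<Rightarrow> real \<times> real \<times> real" where
  "root_coeffs = (\<lambda>(m, x, y). (- (m + 2 * x), x\<^sup>2 + y\<^sup>2 + 2 * m * x, - (m * (x\<^sup>2 + y\<^sup>2))))"

definition upper_roots :: "(real \<times> real \<times> real) set" where
  "upper_roots = {(m, x, y). y > 0}"

lemma open_upper_roots: "open upper_roots"
proof -
  have "upper_roots = (\<lambda>p. snd (snd p)) -` {0<..}" by (auto simp: upper_roots_def)
  moreover have "continuous_on UNIV (\<lambda>p :: real \<times> real \<times> real. snd (snd p))" by (intro continuous_intros)
  ultimately show ?thesis by (metis open_vimage open_greaterThan)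
qed

lemma root_coeffs_cubic: "root_coeffs (m, x, y) = (c2, c1, c0) \<Longrightarrow> cubic c2 c1 c0 (Complex x y) = 0"
  unfolding root_coeffs_def prod.case prod.inject
  by (elim conjE, hypsubst) (simp add: cubic_def complex_eq_iff power2_eq_square power3_eq_cube algebra_simps)

lemma cubic_root_coeffs:
  assumes "Im s > 0" "cubic c2 c1 c0 s = 0"
  shows "(c2, c1, c0) = root_coeffs (- c2 - 2 * Re s, Re s, Im s)"
  using cubic_factor(1,2)[OF assms(2)] assms(1)
  by (simp add: root_coeffs_def cmod_power2 algebra_simps)

lemma image_root_coeffs:
  "(c2, c1, c0) \<in> root_coeffs ` upper_roots \<longleftrightarrow> (\<exists>s. Im s > 0 \<and> cubic c2 c1 c0 s = 0)"
proof
  assume "(c2, c1, c0) \<in> root_coeffs ` upper_roots"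
  then obtain m x y where "y > 0" "root_coeffs (m, x, y) = (c2, c1, c0)"
    by (auto simp: upper_roots_def)
  then show "\<exists>s. Im s > 0 \<and> cubic c2 c1 c0 s = 0"
    using root_coeffs_cubic by (intro exI[of _ "Complex x y"]) simp
next
  assume "\<exists>s. Im s > 0 \<and> cubic c2 c1 c0 s = 0"
  then obtain s where s: "Im s > 0" "cubic c2 c1 c0 s = 0" by blast
  then show "(c2, c1, c0) \<in> root_coeffs ` upper_roots"
    using cubic_root_coeffs[OF s] by (auto simp: upper_roots_def)
qed

lemma inj_on_root_coeffs: "inj_on root_coeffs upper_roots"
proof (rule inj_onI)
  fix p p'
  assume a: "p \<in> upper_roots" "p' \<in> upper_roots" "root_coeffs p = root_coeffs p'"
  obtain m x y m' x' y' where p: "p = (m, x, y)" "p' = (m', x', y')" by (metis surj_pair)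
  obtain c2 c1 c0 where c: "root_coeffs (m, x, y) = (c2, c1, c0)"
    by (metis surj_pair)
  have c': "root_coeffs (m', x', y') = (c2, c1, c0)" using a(3) c p by simp
  have "Complex x y = Complex x' y'"
    by (rule cubic_upper_root_unique[OF root_coeffs_cubic[OF c] _ root_coeffs_cubic[OF c']])
      (use a p in \<open>simp_all add: upper_roots_def\<close>)
  then show "p = p'" using a(3) p by (simp add: root_coeffs_def)
qed

definition root_coeffs' :: "real \<times> real \<times> real \<Rightarrow> real \<times> real \<times> real \<Rightarrow> real \<times> real \<times> real" where
  "root_coeffs' = (\<lambda>(m, x, y) (d, a, b). (- (d + 2 * a), 2 * (x * a + y * b) + 2 * (d * x + m * a),
     - (d * (x\<^sup>2 + y\<^sup>2) + 2 * m * (x * a + y * b))))"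

lemma root_coeffs_derivative: "(root_coeffs has_derivative root_coeffs' p) (at p)"
proof -
  obtain m x y where p: "p = (m, x, y)" by (metis surj_pair)
  show ?thesis
    unfolding root_coeffs_def root_coeffs'_def split_def p
    by (rule has_derivative_eq_rhs, (rule has_derivative_Pair)+)
      (auto intro!: derivative_eq_intros simp: fun_eq_iff algebra_simps)
qed

text \<open>The map from roots to coefficients degenerates only where roots collide. Here the
  distance from \<open>m\<close> to the conjugate pair, squared, is (x - m)^2 + y^2 > 0, and the
  pair itself is separated by y > 0.\<close>

lemma inj_root_coeffs':
  assumes "p \<in> upper_roots"
  shows "inj (root_coeffs' p)"
proof -
  obtain m x y where p: "p = (m, x, y)" "y > 0" using assms by (auto simp: upper_roots_def)
  have lin: "linear (root_coeffs' p)"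
    using root_coeffs_derivative has_derivative_linear by blast
  show ?thesis
  proof (subst linear_injective_0[OF lin], clarify)
    fix d a b assume "root_coeffs' p (d, a, b) = 0"
    then have 1: "d = - 2 * a" "x * a + y * b + d * x + m * a = 0"
      "d * (x\<^sup>2 + y\<^sup>2) + 2 * m * (x * a + y * b) = 0"
      by (auto simp: p root_coeffs'_def zero_prod_def algebra_simps)
    have 2: "x * a + y * b = 2 * a * x - m * a" using 1(2) unfolding 1(1) by simp
    have "2 * a * ((x - m)\<^sup>2 + y\<^sup>2) = 0"
      using 1(3) unfolding 2 unfolding 1(1) by (simp add: power2_eq_square algebra_simps)
    moreover have "(x - m)\<^sup>2 + y\<^sup>2 > 0" using p(2) by (simp add: add_nonneg_pos)
    ultimately have "a = 0" by (metis less_irrefl mult_eq_0_iff zero_neq_numeral)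
    then show "(d, a, b) = 0" using 1 p(2) by (simp add: zero_prod_def)
  qed
qed

lemma open_image_root_coeffs: "open (root_coeffs ` upper_roots)"
  using invariance_of_domain open_upper_roots inj_on_root_coeffs
  by (meson continuous_at_imp_continuous_on has_derivative_continuous root_coeffs_derivative)

text \<open>The inverse function theorem for \<open>root_coeffs\<close>. Since the root in the upper
  half plane is unique, an arbitrary selection \<open>s\<close> must be the root read off from the
  inverse map.\<close>

lemma upper_root_differentiable:
  assumes s: "\<And>c2 c1 c0. (c2, c1, c0) \<in> root_coeffs ` upper_roots
      \<Longrightarrow> Im (s (c2, c1, c0)) > 0 \<and> cubic c2 c1 c0 (s (c2, c1, c0)) = 0"
    and c: "c \<in> root_coeffs ` upper_roots"
  shows "s differentiable (at c)"
proof -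
  define h where "h = inv_into upper_roots root_coeffs"
  obtain p where p: "p \<in> upper_roots" "c = root_coeffs p" using c by blast
  have lin: "linear (root_coeffs' p)"
    using root_coeffs_derivative has_derivative_linear by blast
  then obtain L where L: "root_coeffs' p \<circ> L = id"
    using linear_surjective_right_inverse linear_injective_imp_surjective[OF lin inj_root_coeffs'[OF p(1)]]
    by blast
  have "continuous_on upper_roots root_coeffs"
    by (meson continuous_at_imp_continuous_on has_derivative_continuous root_coeffs_derivative)
  then have "(h has_derivative L) (at c)"
    unfolding p(2) h_def
    using has_derivative_inverse_strong[OF open_upper_roots p(1) _ _ root_coeffs_derivative L]
      inv_into_f_f[OF inj_on_root_coeffs] by blast
  then have dh: "((\<lambda>c. Complex (fst (snd (h c))) (snd (snd (h c)))) has_derivative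
      (\<lambda>v. Complex (fst (snd (L v))) (snd (snd (L v))))) (at c)"
    unfolding Complex_eq
    by (auto intro!: derivative_eq_intros has_derivative_fst has_derivative_snd)
  have "Complex (fst (snd (h c'))) (snd (snd (h c'))) = s c'"
    if c': "c' \<in> root_coeffs ` upper_roots" for c'
  proof -
    obtain c2 c1 c0 where c'': "c' = (c2, c1, c0)" by (metis surj_pair)
    obtain m x y where h: "h c' = (m, x, y)" by (metis surj_pair)
    have "h c' \<in> upper_roots" "root_coeffs (h c') = c'"
      using c' unfolding h_def by (auto intro: inv_into_into f_inv_into_f)
    then have "y > 0" "cubic c2 c1 c0 (Complex x y) = 0"
      unfolding h unfolding c'' by (simp_all add: upper_roots_def root_coeffs_cubic)
    then show ?thesis
      using s[of c2 c1 c0] c' unfolding h fst_conv snd_conv unfolding c''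
      by - (rule cubic_upper_root_unique[of c2 c1 c0], simp_all)
  qed
  then show ?thesis
    unfolding differentiable_def
    by (intro exI, rule has_derivative_transform_within_open[OF dh open_image_root_coeffs c])
qed

lemma smooth_on_UNIV_Ck: "smooth_on S f \<Longrightarrow> Ck_on k S f"
  by (simp add: smooth_on_def)

locale cubic_family =
  fixes c2 c1 c0 :: "'a::euclidean_space \<Rightarrow> real"
  assumes smooth: "smooth_on UNIV c2" "smooth_on UNIV c1" "smooth_on UNIV c0"
begin

definition elliptic :: "'a set" where
  "elliptic = {y. \<exists>s. Im s > 0 \<and> cubic (c2 y) (c1 y) (c0 y) s = 0}"

text \<open>The choice depends on \<open>y\<close> only through the three coefficients, so the root
  inherits their periodicity; uniqueness in the upper half plane makes it canonical on
  \<open>elliptic\<close>.\<close>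

definition upper_root :: "'a \<Rightarrow> complex" where
  "upper_root y = (SOME s. Im s > 0 \<and> cubic (c2 y) (c1 y) (c0 y) s = 0)"

lemma upper_root:
  assumes "y \<in> elliptic"
  shows "Im (upper_root y) > 0" "cubic (c2 y) (c1 y) (c0 y) (upper_root y) = 0"
proof -
  have "\<exists>s. Im s > 0 \<and> cubic (c2 y) (c1 y) (c0 y) s = 0"
    using assms by (simp add: elliptic_def)
  from someI_ex[OF this] show "Im (upper_root y) > 0" "cubic (c2 y) (c1 y) (c0 y) (upper_root y) = 0"
    unfolding upper_root_def by blast+
qed

lemma upper_root_eqI:
  "Im s > 0 \<Longrightarrow> cubic (c2 y) (c1 y) (c0 y) s = 0 \<Longrightarrow> upper_root y = s"
proof -
  assume s: "Im s > 0" "cubic (c2 y) (c1 y) (c0 y) s = 0"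
  then have "y \<in> elliptic" by (auto simp: elliptic_def)
  then show ?thesis
    using cubic_upper_root_unique[OF upper_root(2) upper_root(1) s(2,1)] by blast
qed

lemma elliptic_vimage: "elliptic = (\<lambda>y. (c2 y, c1 y, c0 y)) -` (root_coeffs ` upper_roots)"
  unfolding elliptic_def by (simp add: vimage_def image_root_coeffs)

lemma coeffs_differentiable: "c2 differentiable (at y)" "c1 differentiable (at y)" "c0 differentiable (at y)"
  by (rule Ck_on_differentiable[OF smooth_on_UNIV_Ck[of UNIV _ "Suc 0"]]; simp add: smooth)+

lemma open_elliptic: "open elliptic"
  unfolding elliptic_vimage
  using smooth[THEN smooth_on_UNIV_Ck, THEN Ck_on_continuous_on]
  by (intro open_vimage open_image_root_coeffs continuous_on_Pair) auto

lemma upper_root_differentiable_at: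
  assumes "y \<in> elliptic"
  shows "upper_root differentiable (at y)"
proof -
  define r where "r = (\<lambda>(c2, c1, c0). SOME s. Im s > 0 \<and> cubic c2 c1 c0 s = 0)"
  have r: "Im (r (b2, b1, b0)) > 0 \<and> cubic b2 b1 b0 (r (b2, b1, b0)) = 0"
    if "(b2, b1, b0) \<in> root_coeffs ` upper_roots" for b2 b1 b0
    using someI_ex[of "\<lambda>s. Im s > 0 \<and> cubic b2 b1 b0 s = 0"] that
    by (simp add: r_def image_root_coeffs)
  have "r differentiable (at (c2 y, c1 y, c0 y))"
    using assms by (intro upper_root_differentiable[OF r]) (auto simp: elliptic_vimage)
  then have "(r \<circ> (\<lambda>y. (c2 y, c1 y, c0 y))) differentiable (at y)"
    by (rule differentiable_chain_at[rotated])
      (rule differentiableI has_derivative_Pair has_derivative_frechetI[OF coeffs_differentiable(1)]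
        has_derivative_frechetI[OF coeffs_differentiable(2)]
        has_derivative_frechetI[OF coeffs_differentiable(3)])+
  moreover have "upper_root = r \<circ> (\<lambda>y. (c2 y, c1 y, c0 y))"
    by (simp add: fun_eq_iff upper_root_def r_def)
  ultimately show ?thesis by simp
qed

lemma cubic_derivative_nonzero:
  assumes "y \<in> elliptic"
  shows "3 * (upper_root y)\<^sup>2 + 2 * of_real (c2 y) * upper_root y + of_real (c1 y) \<noteq> 0"
  using cubic_double_root_real[OF upper_root(2)[OF assms]] upper_root(1)[OF assms] by linarith

lemma dir_deriv_upper_root:
  assumes "y \<in> elliptic"
  shows "dir_deriv upper_root v y =
    - (of_real (dir_deriv c2 v y) * (upper_root y)\<^sup>2 + of_real (dir_deriv c1 v y) * upper_root y
        + of_real (dir_deriv c0 v y))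
      / (3 * (upper_root y)\<^sup>2 + 2 * of_real (c2 y) * upper_root y + of_real (c1 y))"
proof -
  let ?s = "upper_root y" and ?D = "dir_deriv upper_root v y"
  note d = coeffs_differentiable[THEN has_derivative_frechetI, of y]
    upper_root_differentiable_at[OF assms, THEN has_derivative_frechetI]
  have "((\<lambda>y. cubic (c2 y) (c1 y) (c0 y) (upper_root y)) has_derivative
    (\<lambda>v. (3 * ?s\<^sup>2 + 2 * of_real (c2 y) * ?s + of_real (c1 y)) * dir_deriv upper_root v y
      + of_real (dir_deriv c2 v y) * ?s\<^sup>2 + of_real (dir_deriv c1 v y) * ?s
        + of_real (dir_deriv c0 v y))) (at y)"
    unfolding cubic_def
    by (rule has_derivative_eq_rhs, (rule derivative_intros d)+)
      (auto simp: fun_eq_iff algebra_simps power2_eq_square power3_eq_cube)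
  moreover have "((\<lambda>y. 0) has_derivative (\<lambda>v. 0)) (at y)" by simp
  then have "((\<lambda>y. cubic (c2 y) (c1 y) (c0 y) (upper_root y)) has_derivative (\<lambda>v. 0)) (at y)"
    by (rule has_derivative_transform_within_open[OF _ open_elliptic assms])
      (simp add: upper_root)
  ultimately have "(3 * ?s\<^sup>2 + 2 * of_real (c2 y) * ?s + of_real (c1 y)) * ?D
      + of_real (dir_deriv c2 v y) * ?s\<^sup>2 + of_real (dir_deriv c1 v y) * ?s
        + of_real (dir_deriv c0 v y) = 0"
    using fun_cong[OF has_derivative_unique, of _ _ y _ v] by blast
  then show ?thesis
    using cubic_derivative_nonzero[OF assms]
    by (simp add: nonzero_eq_divide_eq eq_neg_iff_add_eq_0 algebra_simps)
qed

text \<open>Bootstrapping: the derivative of the root is rational in the coefficients, their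
  derivatives and the root itself, so each order of smoothness of the root yields the next.\<close>

lemma Ck_on_upper_root: "Ck_on k elliptic upper_root"
proof (induction k)
  case 0
  show ?case
    using upper_root_differentiable_at
    by (auto intro!: continuous_at_imp_continuous_on differentiable_imp_continuous_within)
next
  case (Suc k)
  have c: "Ck_on k elliptic f" "Ck_on k elliptic (dir_deriv f v)" if "smooth_on UNIV f" for f :: "'a \<Rightarrow> real" and v
    using that Ck_on_subset[OF smooth_on_UNIV_Ck[OF that], of elliptic k]
      Ck_on_subset[OF Ck_on_dir_deriv[OF smooth_on_UNIV_Ck[OF that]], of elliptic k v] by auto
  let ?D = "\<lambda>y v. - (of_real (dir_deriv c2 v y) * (upper_root y)\<^sup>2 + of_real (dir_deriv c1 v y) * upper_root y
        + of_real (dir_deriv c0 v y))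
      / (3 * (upper_root y)\<^sup>2 + 2 * of_real (c2 y) * upper_root y + of_real (c1 y))"
  show ?case
  proof (rule Ck_on_SucI[OF open_elliptic, where f' = ?D])
    fix y assume y: "y \<in> elliptic"
    show "(upper_root has_derivative ?D y) (at y)"
      by (rule has_derivative_eq_rhs[OF has_derivative_frechetI[OF upper_root_differentiable_at[OF y]]])
        (rule ext, rule dir_deriv_upper_root[OF y])
  next
    fix v
    show "Ck_on k elliptic (\<lambda>y. ?D y v)"
      by (rule Ck_on_divide Ck_on_uminus Ck_on_add Ck_on_mult Ck_on_power Ck_on_of_real Suc.IH
          open_elliptic c[OF smooth(1)] c[OF smooth(2)] c[OF smooth(3)] Ck_on_const
          cubic_derivative_nonzero | assumption)+
  qed
qed

end

section \<open>Jacobians in a chart of the torus\<close>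

abbreviation e1 :: "real^2" where "e1 \<equiv> axis 1 1"
abbreviation e2 :: "real^2" where "e2 \<equiv> axis 2 1"

lemma vec2_expand: "(v :: real^2) = v $ 1 *\<^sub>R e1 + v $ 2 *\<^sub>R e2"
  by (simp add: vec_eq_iff forall_2 axis_def)

lemma dir_deriv_expand:
  fixes f :: "real^2 \<Rightarrow> 'b::real_normed_vector"
  assumes "f differentiable (at y)"
  shows "dir_deriv f v y = v $ 1 *\<^sub>R dir_deriv f e1 y + v $ 2 *\<^sub>R dir_deriv f e2 y"
proof -
  have lin: "linear (frechet_derivative f (at y))" by (rule linear_frechet_derivative[OF assms])
  have "dir_deriv f v y = dir_deriv f (v $ 1 *\<^sub>R e1 + v $ 2 *\<^sub>R e2) y"
    using vec2_expand[of v] by simp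
  also have "\<dots> = v $ 1 *\<^sub>R dir_deriv f e1 y + v $ 2 *\<^sub>R dir_deriv f e2 y"
    by (simp add: linear_add[OF lin] linear_scale[OF lin])
  finally show ?thesis .
qed

lemma dir_deriv_compose:
  assumes "f differentiable (at (h u))" "h differentiable (at u)"
  shows "dir_deriv (\<lambda>u. f (h u)) v u = dir_deriv f (dir_deriv h v u) (h u)"
  by (rule dir_deriv_eq[OF has_derivative_compose[OF has_derivative_frechetI[OF assms(2)]
          has_derivative_frechetI[OF assms(1)]]])

text \<open>The Jacobian determinant of \<open>\<Phi>\<close> relative to the lattice basis; it
  carries integrands in (t, x) over to the period parallelogram.\<close>

definition chart_det :: "(real^2 \<Rightarrow> real^2) \<Rightarrow> real^2 \<Rightarrow> real^2 \<Rightarrow> real^2 \<Rightarrow> real" where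
  "chart_det \<Phi> w1 w2 u = dir_deriv \<Phi> w1 u $ 1 * dir_deriv \<Phi> w2 u $ 2
     - dir_deriv \<Phi> w2 u $ 1 * dir_deriv \<Phi> w1 u $ 2"

lemma jac_compose:
  fixes f q :: "real^2 \<Rightarrow> real"
  assumes "f differentiable (at (\<Phi> u))" "q differentiable (at (\<Phi> u))" "\<Phi> differentiable (at u)"
  shows "jac (\<lambda>u. f (\<Phi> u)) (\<lambda>u. q (\<Phi> u)) w1 w2 u = chart_det \<Phi> w1 w2 u * jac f q e1 e2 (\<Phi> u)"
  unfolding jac_def chart_det_def dir_deriv_compose[OF assms(1,3)] dir_deriv_compose[OF assms(2,3)]
    dir_deriv_expand[OF assms(1), of "dir_deriv \<Phi> w1 u"] dir_deriv_expand[OF assms(1), of "dir_deriv \<Phi> w2 u"]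
    dir_deriv_expand[OF assms(2), of "dir_deriv \<Phi> w1 u"] dir_deriv_expand[OF assms(2), of "dir_deriv \<Phi> w2 u"]
  by (simp add: algebra_simps)

lemma periodic_of_int:
  assumes "\<And>x. f (x + w) = f x"
  shows "f (x + of_int i *\<^sub>R w) = f (x :: 'a::real_vector)"
proof -
  have n: "f (x + of_nat n *\<^sub>R w) = f x" for n x
  proof (induction n arbitrary: x)
    case (Suc n)
    have "x + of_nat (Suc n) *\<^sub>R w = (x + of_nat n *\<^sub>R w) + w" by (simp add: algebra_simps)
    then show ?case using assms Suc by metis
  qed simp
  show ?thesis
  proof (cases i)
    case (nonneg n)
    then show ?thesis using n by simp
  next
    case (neg n)
    then have "x + of_int i *\<^sub>R w + of_nat (Suc n) *\<^sub>R w = x"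
      by (simp only: add.assoc scaleR_add_left[symmetric] of_int_minus of_int_of_nat_eq) simp
    then show ?thesis using n[of "x + of_int i *\<^sub>R w" "Suc n"] by metis
  qed
qed

text \<open>A regularised angle of the point \<open>(P, Q)\<close>; its partial derivative in \<open>P\<close> is
  \<open>1 / (P\<^sup>2 + Q\<^sup>2 + e)\<close>.\<close>

definition reg_angle :: "real \<Rightarrow> real \<Rightarrow> real \<Rightarrow> real" where
  "reg_angle e P Q = arctan (P / sqrt (Q\<^sup>2 + e)) / sqrt (Q\<^sup>2 + e)"

definition reg_angle' :: "real \<Rightarrow> real \<Rightarrow> real \<Rightarrow> real" where
  "reg_angle' e P Q = - (Q / sqrt (Q\<^sup>2 + e)) *
    (P / (sqrt (Q\<^sup>2 + e) * (P\<^sup>2 + Q\<^sup>2 + e)) + arctan (P / sqrt (Q\<^sup>2 + e)) / (Q\<^sup>2 + e))"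

lemma reg_angle_has_derivative:
  fixes P Q :: "'a::real_normed_vector \<Rightarrow> real"
  assumes e: "e > 0" and P: "(P has_derivative P') (at x)" and Q: "(Q has_derivative Q') (at x)"
  shows "((\<lambda>x. reg_angle e (P x) (Q x)) has_derivative
    (\<lambda>v. P' v / ((P x)\<^sup>2 + (Q x)\<^sup>2 + e) + reg_angle' e (P x) (Q x) * Q' v)) (at x)"
proof -
  define R where "R x = sqrt ((Q x)\<^sup>2 + e)" for x
  have pos: "(Q x)\<^sup>2 + e > 0" for x using e by (simp add: add_nonneg_pos)
  have R: "R x > 0" "(R x)\<^sup>2 = (Q x)\<^sup>2 + e" for x
    unfolding R_def using pos[of x] by (simp_all add: less_imp_le)
  have pos': "(P x)\<^sup>2 + (R x)\<^sup>2 > 0" for x using R(1)[of x] by (simp add: add_nonneg_pos)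
  have dR: "(R has_derivative (\<lambda>v. Q x * Q' v / R x)) (at x)"
    unfolding R_def
    by (rule has_derivative_eq_rhs, rule has_derivative_real_sqrt)
      (use pos[of x] in \<open>auto intro!: derivative_eq_intros Q simp: field_simps\<close>)
  have dq: "((\<lambda>x. P x / R x) has_derivative (\<lambda>v. (P' v * R x - P x * (Q x * Q' v / R x)) / (R x * R x))) (at x)"
    by (rule has_derivative_divide'[OF P dR]) (use R(1)[of x] in simp)
  have da: "((\<lambda>x. arctan (P x / R x)) has_derivative
      (\<lambda>v. (P' v * R x - P x * (Q x * Q' v / R x)) / (R x * R x) * inverse (1 + (P x / R x)\<^sup>2))) (at x)"
    using DERIV_compose_FDERIV[OF DERIV_arctan dq] by simp
  have "((\<lambda>x. arctan (P x / R x) / R x) has_derivative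
      (\<lambda>v. ((P' v * R x - P x * (Q x * Q' v / R x)) / (R x * R x) * inverse (1 + (P x / R x)\<^sup>2) * R x
        - arctan (P x / R x) * (Q x * Q' v / R x)) / (R x * R x))) (at x)"
    by (rule has_derivative_divide'[OF da dR]) (use R(1)[of x] in simp)
  then show ?thesis
    unfolding reg_angle_def R_def[symmetric]
  proof (rule has_derivative_eq_rhs, intro ext)
    fix v
    have i: "inverse (1 + (P x / R x)\<^sup>2) = (R x)\<^sup>2 / ((P x)\<^sup>2 + (R x)\<^sup>2)"
      using R(1)[of x] pos'[of x] by (simp add: field_simps)
    show "((P' v * R x - P x * (Q x * Q' v / R x)) / (R x * R x) * inverse (1 + (P x / R x)\<^sup>2) * R x
        - arctan (P x / R x) * (Q x * Q' v / R x)) / (R x * R x)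
      = P' v / ((P x)\<^sup>2 + (Q x)\<^sup>2 + e) + reg_angle' e (P x) (Q x) * Q' v"
      unfolding reg_angle'_def R_def[symmetric] i add.assoc R(2)[symmetric]
      using R(1)[of x] pos'[of x] by (simp add: divide_simps) (simp add: algebra_simps power2_eq_square)
  qed
qed

lemma Ck_on_reg_angle:
  fixes P Q :: "'a::euclidean_space \<Rightarrow> real"
  assumes e: "e > 0" and P: "Ck_on (Suc 0) UNIV P" and Q: "Ck_on (Suc 0) UNIV Q"
  shows "Ck_on (Suc 0) UNIV (\<lambda>x. reg_angle e (P x) (Q x))"
    "dir_deriv (\<lambda>x. reg_angle e (P x) (Q x)) v x =
      dir_deriv P v x / ((P x)\<^sup>2 + (Q x)\<^sup>2 + e) + reg_angle' e (P x) (Q x) * dir_deriv Q v x"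
proof -
  note d = reg_angle_has_derivative[OF e Ck_on_SucD[OF P UNIV_I] Ck_on_SucD[OF Q UNIV_I]]
  show "dir_deriv (\<lambda>x. reg_angle e (P x) (Q x)) v x =
      dir_deriv P v x / ((P x)\<^sup>2 + (Q x)\<^sup>2 + e) + reg_angle' e (P x) (Q x) * dir_deriv Q v x"
    by (rule dir_deriv_eq[OF d])
  have "(Q x)\<^sup>2 + e > 0" "(P x)\<^sup>2 + (Q x)\<^sup>2 + e > 0" for x
    using e by (simp_all add: add_nonneg_pos)
  then have nz: "(Q x)\<^sup>2 + e \<noteq> 0" "(P x)\<^sup>2 + (Q x)\<^sup>2 + e \<noteq> 0" for x
    by (metis less_irrefl)+
  note c = Ck_on_continuous_on[OF P] Ck_on_continuous_on[OF Q] continuous_on_dir_deriv[OF P]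
    continuous_on_dir_deriv[OF Q]
  show "Ck_on (Suc 0) UNIV (\<lambda>x. reg_angle e (P x) (Q x))"
    by (rule Ck_on_SucI[OF open_UNIV d], unfold Ck_on.simps reg_angle'_def)
      (intro continuous_intros c; simp add: nz)
qed

text \<open>A multiple of dQ contributes nothing to a Jacobian with Q, so only the derivative in P
  survives. The quotient on the right is therefore the Jacobian of two functions that are periodic
  whenever P and Q are, and it integrates to zero.\<close>

lemma jac_reg_angle:
  fixes P Q :: "'a::euclidean_space \<Rightarrow> real"
  assumes e: "e > 0" and P: "Ck_on (Suc 0) UNIV P" and Q: "Ck_on (Suc 0) UNIV Q"
  shows "jac (\<lambda>x. reg_angle e (P x) (Q x)) Q v w x = jac P Q v w x / ((P x)\<^sup>2 + (Q x)\<^sup>2 + e)"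
  unfolding jac_def Ck_on_reg_angle(2)[OF assms] by (simp add: algebra_simps diff_divide_distrib)

section \<open>Integrals and zeros of periodic functions in the chart\<close>

locale periodic_chart =
  fixes \<Phi> :: "real^2 \<Rightarrow> real^2" and w1 w2 :: "real^2"
  assumes \<Phi>_smooth: "smooth_on UNIV \<Phi>" and \<Phi>_surj: "surj \<Phi>"
    and span: "\<And>v. \<exists>s t. v = s *\<^sub>R w1 + t *\<^sub>R w2"
    and det_nonzero: "\<And>u. chart_det \<Phi> w1 w2 u \<noteq> 0"
begin

text \<open>\<open>\<Phi>\<close> need not turn lattice translations into translations of (t, x);
  periodicity is therefore tested in the covering plane, after composition with
  \<open>\<Phi>\<close>.\<close>

definition periodic :: "(real^2 \<Rightarrow> 'b) \<Rightarrow> bool" where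
  "periodic f \<longleftrightarrow> (\<forall>u. f (\<Phi> (u + w1)) = f (\<Phi> u) \<and> f (\<Phi> (u + w2)) = f (\<Phi> u))"

lemma periodic_add2:
  assumes "periodic f"
  shows "f (\<Phi> (u + 2 *\<^sub>R w1)) = f (\<Phi> u)" "f (\<Phi> (u + 2 *\<^sub>R w2)) = f (\<Phi> u)"
proof -
  have "u + 2 *\<^sub>R w = (u + w) + w" for w by (simp only: scaleR_2 add.assoc)
  then show "f (\<Phi> (u + 2 *\<^sub>R w1)) = f (\<Phi> u)" "f (\<Phi> (u + 2 *\<^sub>R w2)) = f (\<Phi> u)"
    using assms unfolding periodic_def by metis+
qed

lemma \<Phi>_differentiable: "\<Phi> differentiable (at u)"
  using Ck_on_differentiable[OF smooth_on_UNIV_Ck[OF \<Phi>_smooth]] by blast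

lemma continuous_dir_deriv_\<Phi>: "continuous_on UNIV (dir_deriv \<Phi> w)"
  using continuous_on_dir_deriv[OF smooth_on_UNIV_Ck[OF \<Phi>_smooth]] .

lemma continuous_chart_det: "continuous_on UNIV (chart_det \<Phi> w1 w2)"
  unfolding chart_det_def[abs_def] by (intro continuous_intros continuous_dir_deriv_\<Phi>)

lemma chart_det_sign: "(\<forall>u. chart_det \<Phi> w1 w2 u > 0) \<or> (\<forall>u. chart_det \<Phi> w1 w2 u < 0)"
proof (rule ccontr)
  assume "\<not> ?thesis"
  then obtain u v where "chart_det \<Phi> w1 w2 u \<le> 0" "0 \<le> chart_det \<Phi> w1 w2 v"
    by (meson not_less)
  moreover have "connected (range (chart_det \<Phi> w1 w2))"
    by (intro connected_continuous_image continuous_chart_det connected_UNIV)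
  ultimately have "0 \<in> range (chart_det \<Phi> w1 w2)"
    unfolding connected_iff_interval by blast
  then show False using det_nonzero by (metis imageE)
qed

text \<open>Parallelogram coordinates with a freely chosen point \<open>p\<close> at the origin, so
  that a given point or a given zero can be put at the corner.\<close>

definition pos :: "real^2 \<Rightarrow> real \<Rightarrow> real \<Rightarrow> real^2" where
  "pos p s t = p + s *\<^sub>R w1 + t *\<^sub>R w2"

lemma continuous_pos: "continuous_on UNIV f \<Longrightarrow> continuous_on A (\<lambda>(s, t). f (pos p s t))"
  unfolding pos_def by (rule continuous_on_parallelogram)

lemma continuous_\<Phi>_pos:
  assumes "continuous_on UNIV f"
  shows "continuous_on A (\<lambda>(s, t). f (\<Phi> (pos p s t)))"
  by (rule continuous_pos[of "\<lambda>u. f (\<Phi> u)"])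
    (rule continuous_on_compose2[OF assms Ck_on_continuous_on[OF smooth_on_UNIV_Ck[OF \<Phi>_smooth]]], simp)

text \<open>The determinant has a constant sign, so it may be replaced by its absolute value; a
  Jacobian of one sign then gives an integrand of one sign.\<close>

lemma integral_jac:
  fixes f q :: "real^2 \<Rightarrow> real"
  assumes f: "Ck_on (Suc 0) UNIV f" and q: "Ck_on 2 UNIV q" and per: "periodic f" "periodic q"
  shows "integral (cbox (0, 0) (2, 2))
    (\<lambda>(s, t). \<bar>chart_det \<Phi> w1 w2 (pos p s t)\<bar> * jac f q e1 e2 (\<Phi> (pos p s t))) = 0"
proof -
  have \<Phi>C: "Ck_on k UNIV \<Phi>" for k by (rule smooth_on_UNIV_Ck[OF \<Phi>_smooth])
  have "integral (cbox (0, 0) (2, 2)) (\<lambda>(s, t). jac (\<lambda>u. f (\<Phi> u)) (\<lambda>u. q (\<Phi> u)) w1 w2 (p + s *\<^sub>R w1 + t *\<^sub>R w2)) = 0"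
    by (rule integral_jac_periodic[OF Ck_on_compose[OF _ _ \<Phi>C f] Ck_on_compose[OF _ _ \<Phi>C q]])
      (use periodic_add2 per in auto)
  moreover have "jac (\<lambda>u. f (\<Phi> u)) (\<lambda>u. q (\<Phi> u)) w1 w2 u = chart_det \<Phi> w1 w2 u * jac f q e1 e2 (\<Phi> u)" for u
    by (rule jac_compose[OF Ck_on_differentiable[OF f] _ \<Phi>_differentiable])
      (use q in \<open>simp_all add: numeral_2_eq_2\<close>)
  ultimately have "integral (cbox (0, 0) (2, 2))
    (\<lambda>(s, t). chart_det \<Phi> w1 w2 (pos p s t) * jac f q e1 e2 (\<Phi> (pos p s t))) = 0"
    by (simp add: pos_def)
  then show ?thesis
    using chart_det_sign
  proof (elim disjE)
    assume "\<forall>u. chart_det \<Phi> w1 w2 u < 0"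
    then have "\<bar>chart_det \<Phi> w1 w2 u\<bar> = - chart_det \<Phi> w1 w2 u" for u by (simp add: less_imp_le)
    moreover assume "integral (cbox (0, 0) (2, 2))
      (\<lambda>(s, t). chart_det \<Phi> w1 w2 (pos p s t) * jac f q e1 e2 (\<Phi> (pos p s t))) = 0"
    ultimately show ?thesis by (simp add: split_def)
  qed (simp add: less_imp_le)
qed

text \<open>A continuous integrand of one sign with integral zero vanishes, in particular at the
  corner (0, 0), where a preimage of \<open>y\<close> has been placed.\<close>

lemma jac_nonpos_imp_zero:
  fixes f q :: "real^2 \<Rightarrow> real"
  assumes f: "Ck_on (Suc 0) UNIV f" and q: "Ck_on 2 UNIV q" and per: "periodic f" "periodic q"
    and nonpos: "\<And>y. jac f q e1 e2 y \<le> 0"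
  shows "jac f q e1 e2 y = 0"
proof -
  obtain p where p: "y = \<Phi> p" using \<Phi>_surj by (metis surjD)
  have q1: "Ck_on (Suc 0) UNIV q" by (rule Ck_on_le[OF q]) simp
  have cj: "continuous_on UNIV (jac f q e1 e2)"
    unfolding jac_def[abs_def]
    by (intro continuous_intros continuous_on_dir_deriv[OF f] continuous_on_dir_deriv[OF q1])
  define F where "F = (\<lambda>(s, t). - (\<bar>chart_det \<Phi> w1 w2 (pos p s t)\<bar> * jac f q e1 e2 (\<Phi> (pos p s t))))"
  have "continuous_on (cbox (0, 0) (2, 2)) (\<lambda>z. - ((\<lambda>(s, t). \<bar>chart_det \<Phi> w1 w2 (pos p s t)\<bar>) z
      * (\<lambda>(s, t). jac f q e1 e2 (\<Phi> (pos p s t))) z))"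
    by (intro continuous_on_minus continuous_on_mult continuous_\<Phi>_pos[OF cj]
        continuous_pos[OF continuous_on_rabs[OF continuous_chart_det]])
  then have cont: "continuous_on (cbox (0, 0) (2, 2)) F"
    by (simp add: F_def split_def)
  moreover have "(F has_integral 0) (cbox (0, 0) (2, 2))"
    using integrable_integral[OF integrable_continuous[OF cont]] integral_jac[OF f q per, of p]
    by (simp add: F_def split_def)
  moreover have "0 \<le> F z" for z
    unfolding F_def split_def using nonpos by (simp add: mult_nonneg_nonpos)
  moreover have "(1, 1) \<in> box (0, 0) (2 :: real, 2 :: real)"
    by (auto simp: box_def Basis_prod_def)
  then have "box (0, 0) (2 :: real, 2 :: real) \<noteq> {}" by blast
  ultimately have "F (0, 0) = 0"
    by (intro has_integral_0_cbox_imp_0[of "(0, 0)" "(2, 2)" F]) (auto simp: cbox_Pair_eq)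
  then show ?thesis
    unfolding F_def pos_def p using det_nonzero[of p] by simp
qed

lemma compact_bound:
  assumes "continuous_on UNIV (f :: real^2 \<Rightarrow> real)"
  obtains B where "B > 0" "\<And>s t. (s, t) \<in> cbox (0, 0) (2, 2) \<Longrightarrow> \<bar>f (pos p s t)\<bar> \<le> B"
proof -
  have "compact ((\<lambda>(s, t). f (pos p s t)) ` cbox (0, 0) (2, 2))"
    by (intro compact_continuous_image continuous_pos[OF assms] compact_cbox)
  then obtain B where "\<forall>x\<in>(\<lambda>(s, t). f (pos p s t)) ` cbox (0, 0) (2, 2). norm x \<le> B"
    using compact_imp_bounded bounded_iff by metis
  then have "\<bar>f (pos p s t)\<bar> \<le> max B 1" if "(s, t) \<in> cbox (0, 0) (2, 2)" for s t
    using that by force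
  then show ?thesis using that[of "max B 1"] by simp
qed

lemma compact_lower_bound:
  assumes cont: "continuous_on UNIV (f :: real^2 \<Rightarrow> real)" and "\<And>u. f u > 0"
  obtains b where "b > 0" "\<And>s t. (s, t) \<in> cbox (0, 0) (2, 2) \<Longrightarrow> b \<le> f (pos p s t)"
proof -
  have nz: "f u \<noteq> 0" for u using assms(2)[of u] by simp
  have "continuous_on UNIV (\<lambda>u. 1 / f u)"
    by (intro continuous_intros cont) (simp add: nz)
  then obtain B where B: "B > 0" "\<And>s t. (s, t) \<in> cbox (0, 0) (2, 2) \<Longrightarrow> \<bar>1 / f (pos p s t)\<bar> \<le> B"
    using compact_bound by blast
  have "1 / B \<le> f (pos p s t)" if "(s, t) \<in> cbox (0, 0) (2, 2)" for s t
    using B(2)[OF that] B(1) assms(2)[of "pos p s t"] by (simp add: field_simps)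
  then show ?thesis using that[of "1 / B"] B(1) by simp
qed

lemma dir_deriv_pos:
  fixes P :: "real^2 \<Rightarrow> real" and p :: "real^2"
  assumes P: "Ck_on (Suc 0) UNIV P"
  defines "P' \<equiv> \<lambda>z. P (\<Phi> (pos p (fst z) (snd z)))"
  shows "Ck_on (Suc 0) UNIV P'"
    "dir_deriv P' (1, 0) (s, t) = dir_deriv P (dir_deriv \<Phi> w1 (pos p s t)) (\<Phi> (pos p s t))"
    "dir_deriv P' (0, 1) (s, t) = dir_deriv P (dir_deriv \<Phi> w2 (pos p s t)) (\<Phi> (pos p s t))"
proof -
  have pos': "((\<lambda>z. pos p (fst z) (snd z)) has_derivative (\<lambda>v. fst v *\<^sub>R w1 + snd v *\<^sub>R w2)) (at z)" for z
    unfolding pos_def by (auto intro!: derivative_eq_intros)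
  have C: "Ck_on k UNIV (\<lambda>z. pos p (fst z) (snd z))" for k
    unfolding pos_def
    by (intro Ck_on_add Ck_on_const Ck_on_scaleR Ck_on_bounded_linear bounded_linear_fst
        bounded_linear_snd open_UNIV)
  have P\<Phi>: "Ck_on (Suc 0) UNIV (\<lambda>u. P (\<Phi> u))"
    by (rule Ck_on_compose[OF open_UNIV _ smooth_on_UNIV_Ck[OF \<Phi>_smooth] P]) simp
  show "Ck_on (Suc 0) UNIV P'"
    unfolding P'_def by (rule Ck_on_compose[OF open_UNIV _ C P\<Phi>]) simp
  have "(P' has_derivative (\<lambda>v. dir_deriv (\<lambda>u. P (\<Phi> u)) (fst v *\<^sub>R w1 + snd v *\<^sub>R w2) (pos p s t))) (at (s, t))"
    unfolding P'_def
    by (rule has_derivative_compose[OF pos', of "\<lambda>u. P (\<Phi> u)"])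
      (use Ck_on_SucD[OF P\<Phi>] in simp)
  note dir_deriv_eq[OF this]
  then show "dir_deriv P' (1, 0) (s, t) = dir_deriv P (dir_deriv \<Phi> w1 (pos p s t)) (\<Phi> (pos p s t))"
    "dir_deriv P' (0, 1) (s, t) = dir_deriv P (dir_deriv \<Phi> w2 (pos p s t)) (\<Phi> (pos p s t))"
    by (simp_all add: dir_deriv_compose Ck_on_differentiable[OF P] \<Phi>_differentiable)
qed

lemma sq_lin_le: "(a * x + b * y)\<^sup>2 \<le> (a\<^sup>2 + b\<^sup>2) * (x\<^sup>2 + y\<^sup>2)" for a b x y :: real
  using zero_le_power2[of "a * y - b * x"] by (simp add: power2_eq_square algebra_simps)

text \<open>A map satisfying a Cauchy-Riemann type inequality has positive index at its zeros, while on
  the torus these indices sum to zero. The estimate below is the analytic form of this count.\<close>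

lemma zero_imp_identically_zero:
  fixes P Q \<alpha> \<beta> \<gamma> :: "real^2 \<Rightarrow> real"
  assumes P: "Ck_on 2 UNIV P" and Q: "Ck_on 2 UNIV Q" and per: "periodic P" "periodic Q"
    and cont: "continuous_on UNIV \<alpha>" "continuous_on UNIV \<beta>" "continuous_on UNIV \<gamma>"
    and \<alpha>: "\<And>y. \<alpha> y > 0"
    and jac: "\<And>y. jac P Q e1 e2 y \<ge> \<alpha> y * ((dir_deriv P e2 y)\<^sup>2 + (dir_deriv Q e2 y)\<^sup>2)
        - \<beta> y * ((P y)\<^sup>2 + (Q y)\<^sup>2)"
    and dt: "\<And>y. (dir_deriv P e1 y)\<^sup>2 + (dir_deriv Q e1 y)\<^sup>2
        \<le> \<gamma> y * ((dir_deriv P e2 y)\<^sup>2 + (dir_deriv Q e2 y)\<^sup>2 + (P y)\<^sup>2 + (Q y)\<^sup>2)"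
    and zero: "P y0 = 0" "Q y0 = 0"
  shows "P y = 0 \<and> Q y = 0"
proof -
  obtain p where p: "y0 = \<Phi> p" using \<Phi>_surj by (metis surjD)
  have P1: "Ck_on (Suc 0) UNIV P" and Q1: "Ck_on (Suc 0) UNIV Q"
    by (rule Ck_on_le[OF P] Ck_on_le[OF Q], simp)+
  let ?K = "cbox (0, 0) (2, 2) :: (real \<times> real) set"
  let ?x = "\<lambda>s t. \<Phi> (pos p s t)"
  let ?\<kappa> = "\<lambda>u. \<bar>chart_det \<Phi> w1 w2 u\<bar>"
  define P' where "P' z = P (\<Phi> (pos p (fst z) (snd z)))" for z
  define Q' where "Q' z = Q (\<Phi> (pos p (fst z) (snd z)))" for z
  have c\<Phi>: "continuous_on UNIV (\<lambda>u. f (\<Phi> u))" if "continuous_on UNIV f" for f :: "real^2 \<Rightarrow> real"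
    by (rule continuous_on_compose2[OF that Ck_on_continuous_on[OF smooth_on_UNIV_Ck[OF \<Phi>_smooth]]]) simp
  \<comment> \<open>Squared Hilbert-Schmidt norm of the derivative of \<open>\<Phi>\<close> on the
    lattice basis: the price for replacing derivatives in t and x by derivatives along
    \<open>w1\<close> and \<open>w2\<close>.\<close>
  define M where "M u = (dir_deriv \<Phi> w1 u $ 1)\<^sup>2 + (dir_deriv \<Phi> w1 u $ 2)\<^sup>2
    + (dir_deriv \<Phi> w2 u $ 1)\<^sup>2 + (dir_deriv \<Phi> w2 u $ 2)\<^sup>2" for u
  have "continuous_on UNIV M"
    unfolding M_def[abs_def] by (intro continuous_intros continuous_dir_deriv_\<Phi>)
  then have "continuous_on UNIV (\<lambda>u. M u * (1 + \<bar>\<gamma> (\<Phi> u)\<bar>))"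
    by (intro continuous_intros c\<Phi> cont)
  then obtain B1 where B1: "B1 > 0" "\<And>s t. (s, t) \<in> ?K \<Longrightarrow>
      \<bar>M (pos p s t) * (1 + \<bar>\<gamma> (\<Phi> (pos p s t))\<bar>)\<bar> \<le> B1"
    using compact_bound by blast
  have "continuous_on UNIV (\<lambda>u. ?\<kappa> u * \<beta> (\<Phi> u))"
    by (intro continuous_intros c\<Phi> cont continuous_chart_det)
  then obtain B2 where B2: "B2 > 0" "\<And>s t. (s, t) \<in> ?K \<Longrightarrow>
      \<bar>?\<kappa> (pos p s t) * \<beta> (?x s t)\<bar> \<le> B2"
    using compact_bound by blast
  have "continuous_on UNIV (\<lambda>u. ?\<kappa> u * \<alpha> (\<Phi> u))"
    by (intro continuous_intros c\<Phi> cont continuous_chart_det)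
  moreover have "?\<kappa> u * \<alpha> (\<Phi> u) > 0" for u
    using \<alpha> det_nonzero by simp
  ultimately obtain b where b: "b > 0" "\<And>s t. (s, t) \<in> ?K \<Longrightarrow>
      b \<le> ?\<kappa> (pos p s t) * \<alpha> (?x s t)"
    using compact_lower_bound[of "\<lambda>u. ?\<kappa> u * \<alpha> (\<Phi> u)"] by blast
  have energy: "integral ?K (log_energy P' Q' e) \<le> 4 * (B1 * (B2 / b + 1))" if e: "e > 0" for e
  proof -
    define f where "f y = reg_angle e (P y) (Q y)" for y
    have f: "Ck_on (Suc 0) UNIV f" unfolding f_def[abs_def] by (rule Ck_on_reg_angle(1)[OF e P1 Q1])
    have perf: "periodic f" using per unfolding periodic_def f_def by simp
    define J where "J = (\<lambda>(s, t). ?\<kappa> (pos p s t) * jac f Q e1 e2 (?x s t))"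
    have J0: "integral ?K J = 0"
      unfolding J_def by (rule integral_jac[OF f Q perf per(2)])
    have "continuous_on UNIV (jac f Q e1 e2)"
      unfolding jac_def[abs_def]
      by (intro continuous_intros continuous_on_dir_deriv[OF f] continuous_on_dir_deriv[OF Q1])
    then have "continuous_on UNIV (\<lambda>u. ?\<kappa> u * jac f Q e1 e2 (\<Phi> u))"
      by (intro continuous_intros c\<Phi> continuous_chart_det)
    then have cJ: "continuous_on ?K J"
      unfolding J_def by (rule continuous_pos)
    \<comment> \<open>\<open>dt\<close> trades the t-derivatives for x-derivatives and P^2 + Q^2;
      \<open>jac\<close> trades the x-derivatives for the Jacobian, whose quotient by N + e has
      integral zero. The leftover terms are multiples of N / (N + e) \<le> 1, which is why the final
      constant is independent of \<open>e\<close>.\<close>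
    have bound: "log_energy P' Q' e z \<le> B1 / b * J z + B1 * (B2 / b + 1)" if "z \<in> ?K" for z
    proof -
      obtain s t where z: "z = (s, t)" by (cases z)
      define u where "u = pos p s t"
      define x where "x = \<Phi> u"
      define N where "N = (P x)\<^sup>2 + (Q x)\<^sup>2"
      define X where "X = (dir_deriv P e2 x)\<^sup>2 + (dir_deriv Q e2 x)\<^sup>2"
      define Y where "Y = (dir_deriv P e1 x)\<^sup>2 + (dir_deriv Q e1 x)\<^sup>2"
      have N: "N \<ge> 0" "N + e > 0" "X \<ge> 0" unfolding N_def X_def using e by (auto simp: add_nonneg_pos)
      have bM: "\<bar>M u * (1 + \<bar>\<gamma> x\<bar>)\<bar> \<le> B1" "\<bar>?\<kappa> u * \<beta> x\<bar> \<le> B2" "b \<le> ?\<kappa> u * \<alpha> x"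
        using B1(2) B2(2) b(2) that unfolding z u_def x_def by blast+
      have Y: "Y \<le> \<bar>\<gamma> x\<bar> * (X + N)"
      proof -
        have "Y \<le> \<gamma> x * (X + N)" using dt[of x] unfolding Y_def X_def N_def by (simp add: add.assoc)
        also have "\<dots> \<le> \<bar>\<gamma> x\<bar> * (X + N)" using N by (intro mult_right_mono) auto
        finally show ?thesis .
      qed
      have DP: "dir_deriv P v x = v $ 1 * dir_deriv P e1 x + v $ 2 * dir_deriv P e2 x"
        and DQ: "dir_deriv Q v x = v $ 1 * dir_deriv Q e1 x + v $ 2 * dir_deriv Q e2 x" for v
        unfolding real_scaleR_def[symmetric]
        by (rule dir_deriv_expand[OF Ck_on_differentiable[OF P1 UNIV_I]]
            dir_deriv_expand[OF Ck_on_differentiable[OF Q1 UNIV_I]])+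
      have "(dir_deriv P (dir_deriv \<Phi> w1 u) x)\<^sup>2 + (dir_deriv P (dir_deriv \<Phi> w2 u) x)\<^sup>2
          + (dir_deriv Q (dir_deriv \<Phi> w1 u) x)\<^sup>2 + (dir_deriv Q (dir_deriv \<Phi> w2 u) x)\<^sup>2
        \<le> M u * (X + Y)"
        unfolding DP[of "dir_deriv \<Phi> w1 u"] DP[of "dir_deriv \<Phi> w2 u"]
          DQ[of "dir_deriv \<Phi> w1 u"] DQ[of "dir_deriv \<Phi> w2 u"]
        using sq_lin_le[of "dir_deriv \<Phi> w1 u $ 1" "dir_deriv P e1 x" "dir_deriv \<Phi> w1 u $ 2" "dir_deriv P e2 x"]
          sq_lin_le[of "dir_deriv \<Phi> w2 u $ 1" "dir_deriv P e1 x" "dir_deriv \<Phi> w2 u $ 2" "dir_deriv P e2 x"]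
          sq_lin_le[of "dir_deriv \<Phi> w1 u $ 1" "dir_deriv Q e1 x" "dir_deriv \<Phi> w1 u $ 2" "dir_deriv Q e2 x"]
          sq_lin_le[of "dir_deriv \<Phi> w2 u $ 1" "dir_deriv Q e1 x" "dir_deriv \<Phi> w2 u $ 2" "dir_deriv Q e2 x"]
        unfolding M_def X_def Y_def by (simp add: algebra_simps)
      also have "\<dots> \<le> M u * ((1 + \<bar>\<gamma> x\<bar>) * (X + N))"
        using Y N unfolding M_def by (intro mult_left_mono) (auto simp: algebra_simps)
      also have "\<dots> \<le> B1 * (X + N)"
        using bM(1) N by (simp add: mult.assoc[symmetric] mult_right_mono)
      finally have "log_energy P' Q' e z \<le> B1 * (X + N) / (N + e)"
        using dir_deriv_pos(2,3)[OF P1, of p s t] dir_deriv_pos(2,3)[OF Q1, of p s t] N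
        unfolding log_energy_def z P'_def[abs_def] Q'_def[abs_def] fst_conv snd_conv
        by (simp add: u_def x_def N_def add.assoc add.left_commute divide_right_mono)
      also have "\<dots> = B1 * (X / (N + e)) + B1 * (N / (N + e))"
        by (simp add: add_divide_distrib distrib_left)
      also have "\<dots> \<le> B1 * ((J z + B2) / b) + B1 * 1"
      proof (intro add_mono mult_left_mono)
        show "N / (N + e) \<le> 1" using N e by simp
        have "b * X \<le> ?\<kappa> u * \<alpha> x * X" using bM(3) N by (intro mult_right_mono) auto
        also have "\<dots> \<le> ?\<kappa> u * (jac P Q e1 e2 x + \<beta> x * N)"
          using mult_left_mono[OF jac[of x], of "?\<kappa> u"] unfolding X_def N_def by (simp add: algebra_simps)
        also have "\<dots> \<le> ?\<kappa> u * jac P Q e1 e2 x + B2 * N"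
          using mult_right_mono[OF order_trans[OF abs_ge_self bM(2)] N(1)] by (simp add: algebra_simps)
        finally have "b * X / (N + e) \<le> (?\<kappa> u * jac P Q e1 e2 x + B2 * N) / (N + e)"
          using N by (intro divide_right_mono) auto
        also have "\<dots> = J z + B2 * (N / (N + e))"
        proof -
          have "J z = ?\<kappa> u * jac P Q e1 e2 x / (N + e)"
            unfolding J_def z f_def[abs_def] prod.case jac_reg_angle[OF e P1 Q1]
            by (simp add: u_def x_def N_def)
          then show ?thesis by (simp add: add_divide_distrib)
        qed
        also have "\<dots> \<le> J z + B2 * 1"
          using N e B2(1) by (intro add_left_mono mult_left_mono) auto
        finally show "X / (N + e) \<le> (J z + B2) / b"
          using b(1) by (simp add: pos_le_divide_eq mult.commute)
      qed (use B1(1) in auto)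
      also have "\<dots> = B1 / b * J z + B1 * (B2 / b + 1)"
        by (simp add: add_divide_distrib algebra_simps)
      finally show ?thesis .
    qed
    have cE: "continuous_on ?K (log_energy P' Q' e)"
      unfolding P'_def[abs_def] Q'_def[abs_def]
      by (rule log_energy_continuous_on[OF dir_deriv_pos(1)[OF P1] dir_deriv_pos(1)[OF Q1] e])
    have "integral ?K (log_energy P' Q' e) \<le> integral ?K (\<lambda>z. B1 / b * J z + B1 * (B2 / b + 1))"
      by (intro integral_le integrable_continuous cE bound continuous_intros cJ)
    also have "\<dots> = B1 / b * integral ?K J + integral ?K (\<lambda>z. B1 * (B2 / b + 1))"
      by (subst Henstock_Kurzweil_Integration.integral_add)
        (use b(1) in \<open>auto intro!: integrable_continuous continuous_intros cJ\<close>)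
    \<comment> \<open>The factor 4 is the area of the doubled square; the Jacobian term integrates
      to zero.\<close>
    also have "\<dots> = 4 * (B1 * (B2 / b + 1))"
      unfolding J0 by (simp add: content_Pair)
    finally show ?thesis .
  qed
  have zero': "P' 0 = 0" "Q' 0 = 0"
    using zero by (simp_all add: P'_def Q'_def pos_def p)
  obtain q where q: "y = \<Phi> q" using \<Phi>_surj by (metis surjD)
  obtain s t where st: "q - p = s *\<^sub>R w1 + t *\<^sub>R w2" using span by blast
  \<comment> \<open>A representative modulo the lattice, shifted by one period into [1, 2] x [0, 1]
    and thus away from the zero at the origin.\<close>
  define s' where "s' = frac s + 1"
  define t' where "t' = frac t"
  have "P' (s', t') = 0 \<and> Q' (s', t') = 0"
    by (rule zero_of_bounded_log_energy[OF dir_deriv_pos(1)[OF P1, of p, folded P'_def[abs_def]]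
          dir_deriv_pos(1)[OF Q1, of p, folded Q'_def[abs_def]] zero' energy])
      (auto simp: s'_def t'_def frac_ge_0 frac_lt_1 less_imp_le)
  moreover have per_eq: "f (\<Phi> (pos p s' t')) = f y" if "periodic f" for f :: "real^2 \<Rightarrow> real"
  proof -
    have "pos p s' t' = q + of_int (1 - \<lfloor>s\<rfloor>) *\<^sub>R w1 + of_int (- \<lfloor>t\<rfloor>) *\<^sub>R w2"
      using st unfolding pos_def s'_def t'_def frac_def by (simp add: algebra_simps)
    then show ?thesis
      using periodic_of_int[of "\<lambda>u. f (\<Phi> u)" w2] periodic_of_int[of "\<lambda>u. f (\<Phi> u)" w1]
        that unfolding periodic_def q by metis
  qed
  ultimately show ?thesis
    using per_eq[OF per(1)] per_eq[OF per(2)] by (simp add: P'_def Q'_def)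
qed

end

section \<open>The quasi-linear system\<close>

lemma smooth_on_const: "smooth_on S (\<lambda>x. c)"
  by (simp add: smooth_on_def Ck_on_const)

lemma smooth_on_mult:
  fixes f h :: "'a::euclidean_space \<Rightarrow> real"
  shows "open S \<Longrightarrow> smooth_on S f \<Longrightarrow> smooth_on S h \<Longrightarrow> smooth_on S (\<lambda>x. f x * h x)"
  by (simp add: smooth_on_def Ck_on_mult)

lemma smooth_on_diff:
  "open S \<Longrightarrow> smooth_on S f \<Longrightarrow> smooth_on S h \<Longrightarrow> smooth_on S (\<lambda>x. f x - h x)"
  by (simp add: smooth_on_def Ck_on_diff)

lemma smooth_on_uminus: "open S \<Longrightarrow> smooth_on S f \<Longrightarrow> smooth_on S (\<lambda>x. - f x)"
  by (simp add: smooth_on_def Ck_on_uminus)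

lemma smooth_on_divide:
  fixes f h :: "'a::euclidean_space \<Rightarrow> real"
  shows "open S \<Longrightarrow> smooth_on S f \<Longrightarrow> smooth_on S h \<Longrightarrow> (\<And>x. x \<in> S \<Longrightarrow> h x \<noteq> 0)
    \<Longrightarrow> smooth_on S (\<lambda>x. f x / h x)"
  by (simp add: smooth_on_def Ck_on_divide)

text \<open>Keeps the roots in a compact disc while points of the elliptic set converge to its
  boundary. For |z| > 1 every lower power is at most |z|^2, and division by |z|^2 leaves the sum of
  the coefficients.\<close>

lemma cubic_root_bound:
  assumes "cubic c2 c1 c0 z = 0"
  shows "cmod z \<le> 1 + \<bar>c2\<bar> + \<bar>c1\<bar> + \<bar>c0\<bar>"
proof (rule ccontr)
  define M where "M = \<bar>c2\<bar> + \<bar>c1\<bar> + \<bar>c0\<bar>"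
  define r where "r = cmod z"
  assume "\<not> ?thesis"
  then have r: "r > 1 + M" unfolding M_def r_def by simp
  have "M \<ge> 0" unfolding M_def by simp
  then have r1: "r > 1" using r by simp
  have "z ^ 3 = - (of_real c2 * z\<^sup>2 + of_real c1 * z + of_real c0)"
    using assms unfolding cubic_def by (simp only: eq_neg_iff_add_eq_0 add.assoc)
  then have "r ^ 3 = cmod (of_real c2 * z\<^sup>2 + of_real c1 * z + of_real c0)"
    unfolding r_def by (metis norm_minus_cancel norm_power)
  also have "\<dots> \<le> cmod (of_real c2 * z\<^sup>2) + cmod (of_real c1 * z) + cmod (of_real c0)"
    by (meson norm_triangle_ineq norm_triangle_mono order_refl)
  also have "\<dots> = \<bar>c2\<bar> * r\<^sup>2 + \<bar>c1\<bar> * r + \<bar>c0\<bar>"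
    by (simp add: norm_mult norm_power r_def)
  also have "\<dots> \<le> \<bar>c2\<bar> * r\<^sup>2 + \<bar>c1\<bar> * r\<^sup>2 + \<bar>c0\<bar> * r\<^sup>2"
  proof (intro add_mono mult_left_mono)
    show "r \<le> r\<^sup>2" using r1 by (simp add: power2_eq_square)
    have "1 \<le> r\<^sup>2" using r1 by (simp add: one_le_power less_imp_le)
    then show "\<bar>c0\<bar> \<le> \<bar>c0\<bar> * r\<^sup>2" by (simp add: mult_le_cancel_left1)
  qed auto
  also have "\<dots> = M * r\<^sup>2" unfolding M_def by (simp add: algebra_simps)
  finally have "r * r\<^sup>2 \<le> M * r\<^sup>2" by (simp add: power3_eq_cube power2_eq_square)
  then have "r \<le> M" using r1 by (simp add: mult_le_cancel_right)
  then show False using r by simp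
qed

text \<open>The cube is the lowest integral power of the positive part that is twice continuously
  differentiable, as the Jacobian integrals require of their second function.\<close>

lemma Ck_on_max_power:
  "Ck_on (Suc (Suc 0)) UNIV (\<lambda>t::real. (max 0 t) ^ 3)"
  "((\<lambda>t::real. (max 0 t) ^ 3) has_real_derivative 3 * (max 0 t)\<^sup>2) (at t)"
proof -
  have D: "((\<lambda>t::real. (max 0 t) ^ Suc (Suc n)) has_real_derivative of_nat (Suc (Suc n)) * (max 0 t) ^ Suc n) (at t)"
    for n t
  proof (cases "t = 0")
    case True
    have "((\<lambda>t::real. (max 0 t) ^ Suc (Suc n)) has_real_derivative 0) (at 0)"
      unfolding DERIV_def
    proof (rule Lim_null_comparison)
      show "\<forall>\<^sub>F h in at 0. norm ((max 0 (0 + h) ^ Suc (Suc n) - max 0 (0::real) ^ Suc (Suc n)) / h)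
          \<le> \<bar>h\<bar> ^ Suc n"
      proof (rule always_eventually, intro allI)
        fix h :: real
        show "norm ((max 0 (0 + h) ^ Suc (Suc n) - max 0 (0::real) ^ Suc (Suc n)) / h) \<le> \<bar>h\<bar> ^ Suc n"
        proof (cases "h > 0")
          case True
          then show ?thesis by (simp add: max_def)
        next
          case False
          then have h0: "max 0 (0 + h) = 0" by simp
          show ?thesis
            unfolding h0 max.idem by (simp only: diff_self div_0 norm_zero zero_le_power abs_ge_zero)
        qed
      qed
      have "((\<lambda>h::real. \<bar>h\<bar> ^ Suc n) \<longlongrightarrow> \<bar>0\<bar> ^ Suc n) (at 0)"
        by (intro tendsto_intros)
      then show "((\<lambda>h::real. \<bar>h\<bar> ^ Suc n) \<longlongrightarrow> 0) (at 0)" by simp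
    qed
    then show ?thesis using True by simp
  next
    case False
    show ?thesis
    proof (cases "t > 0")
      case True
      have "((\<lambda>t::real. t ^ Suc (Suc n)) has_real_derivative of_nat (Suc (Suc n)) * t ^ Suc n) (at t)"
        by (rule derivative_eq_intros refl)+ simp
      then have "((\<lambda>t::real. (max 0 t) ^ Suc (Suc n)) has_real_derivative of_nat (Suc (Suc n)) * t ^ Suc n) (at t)"
        by (rule has_field_derivative_transform_within_open[of _ _ _ "{0<..}"]) (use True in auto)
      then show ?thesis using True by simp
    next
      case False
      have "((\<lambda>t::real. 0) has_real_derivative 0) (at t)" by simp
      then have "((\<lambda>t::real. (max 0 t) ^ Suc (Suc n)) has_real_derivative 0) (at t)"
        by (rule has_field_derivative_transform_within_open[of _ _ _ "{..<0}"])
          (use False \<open>t \<noteq> 0\<close> in auto)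
      then show ?thesis using False by simp
    qed
  qed
  have D3: "((\<lambda>t::real. (max 0 t) ^ 3) has_real_derivative 3 * (max 0 t)\<^sup>2) (at t)" for t
    using D[of "Suc 0" t] by (simp only: numeral_3_eq_3 numeral_2_eq_2 of_nat_Suc) simp
  have D2: "((\<lambda>t::real. (max 0 t)\<^sup>2) has_real_derivative 2 * max 0 t) (at t)" for t
    using D[of 0 t] by (simp add: numeral_2_eq_2)
  have "Ck_on 0 UNIV (\<lambda>t::real. 2 * max 0 t)"
    by (auto intro!: continuous_intros)
  then have "Ck_on (Suc 0) UNIV (\<lambda>t::real. (max 0 t)\<^sup>2)"
    by (rule Ck_on_real_SucI[OF D2])
  then have "Ck_on (Suc 0) UNIV (\<lambda>t::real. 3 * (max 0 t)\<^sup>2)"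
    by (intro Ck_on_mult Ck_on_const open_UNIV)
  then show "Ck_on (Suc (Suc 0)) UNIV (\<lambda>t::real. (max 0 t) ^ 3)"
    by (rule Ck_on_real_SucI[OF D3])
  show "((\<lambda>t::real. (max 0 t) ^ 3) has_real_derivative 3 * (max 0 t)\<^sup>2) (at t)"
    by (rule D3)
qed

text \<open>Multiplication by the integrating factor exp h, with h' = q, makes the solution
  constant.\<close>

lemma linear_ode_zero:
  fixes f q :: "real \<Rightarrow> real"
  assumes "continuous_on {a..b} q"
    and f: "\<And>t. t \<in> {a..b} \<Longrightarrow> (f has_real_derivative - (q t * f t)) (at t within {a..b})"
    and c: "c \<in> {a..b}" "f c = 0" and t: "t \<in> {a..b}"
  shows "f t = 0"
proof -
  obtain h where h: "\<And>x. x \<in> {a..b} \<Longrightarrow> (h has_vector_derivative q x) (at x within {a..b})"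
    using antiderivative_continuous[OF assms(1)] by blast
  have "((\<lambda>x. f x * exp (h x)) has_real_derivative 0) (at x within {a..b})" if x: "x \<in> {a..b}" for x
    using h[OF x] unfolding has_real_derivative_iff_has_vector_derivative[symmetric]
    by (auto intro!: derivative_eq_intros f[OF x] simp: algebra_simps)
  then obtain k where "\<And>x. x \<in> {a..b} \<Longrightarrow> f x * exp (h x) = k"
    using has_derivative_zero_constant[of "{a..b}" "\<lambda>x. f x * exp (h x)"]
    by (auto simp: has_field_derivative_def lambda_zero)
  then have "f t * exp (h t) = f c * exp (h c)"
    using c(1) t by simp
  then show ?thesis using c by simp
qed

section \<open>The system for the coefficients and its cubic differential\<close>

locale cubic_system = periodic_chart +
  fixes a0 a1 g :: "real^2 \<Rightarrow> real"
  assumes smooth: "smooth_on UNIV a0" "smooth_on UNIV a1" "smooth_on UNIV g"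
    and g_pos: "\<And>y. g y > 0"
    and per: "periodic a0" "periodic a1" "periodic g"
    and pde0: "\<And>y. dir_deriv a0 e1 y + a1 y * dir_deriv g e2 y = 0"
    and pde1: "\<And>y. dir_deriv a1 e1 y + g y * dir_deriv a0 e2 y + (2 * g y - 3 * a0 y) * dir_deriv g e2 y = 0"
    and pde2: "\<And>y. dir_deriv g e1 y + g y * dir_deriv a1 e2 y + (3 - 2 * a1 y) * dir_deriv g e2 y = 0"
begin

lemma g_nonzero: "g y \<noteq> 0"
  using g_pos[of y] by simp

lemma smooth_Ck: "Ck_on k UNIV a0" "Ck_on k UNIV a1" "Ck_on k UNIV g"
  using smooth by (simp_all add: smooth_on_UNIV_Ck)

lemma a0_deriv: "(a0 has_derivative frechet_derivative a0 (at y)) (at y)"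
  and a1_deriv: "(a1 has_derivative frechet_derivative a1 (at y)) (at y)"
  and g_deriv: "(g has_derivative frechet_derivative g (at y)) (at y)"
  by (rule Ck_on_SucD[OF smooth_Ck(1) UNIV_I] Ck_on_SucD[OF smooth_Ck(2) UNIV_I]
      Ck_on_SucD[OF smooth_Ck(3) UNIV_I])+

lemma differentiable: "a0 differentiable (at y)" "a1 differentiable (at y)" "g differentiable (at y)"
  by (rule differentiableI, rule a0_deriv a1_deriv g_deriv)+

text \<open>On the unit circle the integral is \<open>(\<alpha> cos 3\<phi> + \<beta> sin 3\<phi>) / 4\<close> plus terms in \<open>cos \<phi>\<close> and
  \<open>sin \<phi>\<close>, with \<open>\<alpha> = a0 - g\<close> and \<open>\<beta> = a1 - 1\<close>; in isothermal coordinates \<open>\<alpha> - \<i> \<beta>\<close> is the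
  coefficient of a holomorphic cubic differential.\<close>

lemma cubic_differential_zero:
  assumes "a0 y0 = g y0" "a1 y0 = 1"
  shows "a0 y = g y \<and> a1 y = 1"
proof -
  define P where "P y = a0 y - g y" for y
  define Q where "Q y = a1 y - 1" for y
  have DP: "dir_deriv P v y = dir_deriv a0 v y - dir_deriv g v y" for v y
    unfolding P_def by (intro dir_deriv_eq has_derivative_diff a0_deriv g_deriv)
  have DQ: "dir_deriv Q v y = dir_deriv a1 v y" for v y
    unfolding Q_def by (rule dir_deriv_eq, rule has_derivative_eq_rhs,
        rule has_derivative_diff[OF a1_deriv has_derivative_const]) simp
  \<comment> \<open>With \<open>Qt\<close>, these are Cauchy-Riemann equations up to the factor
    \<open>g\<close> and terms of order zero with coefficient g_x.\<close>
  have Pt: "dir_deriv P e1 y = g y * dir_deriv Q e2 y - 3 * Q y * dir_deriv g e2 y" for y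
    using pde0[of y] pde2[of y] unfolding DP DQ Q_def by algebra
  have Qt: "dir_deriv Q e1 y = - g y * dir_deriv P e2 y + 3 * P y * dir_deriv g e2 y" for y
    using pde1[of y] unfolding DP DQ P_def by algebra
  have PQ: "Ck_on 2 UNIV P" "Ck_on 2 UNIV Q"
    unfolding P_def Q_def by (intro Ck_on_diff smooth_Ck Ck_on_const open_UNIV)+
  have perPQ: "periodic P" "periodic Q"
    using per unfolding periodic_def P_def Q_def by simp_all
  note c = Ck_on_continuous_on[OF smooth_Ck(3)[of 0]] continuous_on_dir_deriv[OF smooth_Ck(3)]
  have cont: "continuous_on UNIV (\<lambda>y. g y / 2)"
    "continuous_on UNIV (\<lambda>y. 9 * (dir_deriv g e2 y)\<^sup>2 / (2 * g y))"
    "continuous_on UNIV (\<lambda>y. 2 * (g y)\<^sup>2 + 18 * (dir_deriv g e2 y)\<^sup>2)"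
    by (intro continuous_intros c; simp add: g_nonzero)+
  have "P y = 0 \<and> Q y = 0"
  proof (rule zero_imp_identically_zero[OF PQ perPQ cont, of y0])
    show "P y0 = 0" "Q y0 = 0" using assms by (simp_all add: P_def Q_def)
  next
    fix y
    let ?g = "g y" and ?h = "dir_deriv g e2 y" and ?p = "dir_deriv P e2 y" and ?q = "dir_deriv Q e2 y"
    show "g y / 2 > 0" using g_pos by simp
    \<comment> \<open>Completing the square absorbs the mixed terms 3 g_x (P P_x + Q Q_x) at the
      cost of half of the quadratic form g (P_x^2 + Q_x^2).\<close>
    have "jac P Q e1 e2 y - (?g / 2 * (?p\<^sup>2 + ?q\<^sup>2) - 9 * ?h\<^sup>2 / (2 * ?g) * ((P y)\<^sup>2 + (Q y)\<^sup>2))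
      = ((?g * ?p - 3 * ?h * P y)\<^sup>2 + (?g * ?q - 3 * ?h * Q y)\<^sup>2) / (2 * ?g)"
      unfolding jac_def Pt Qt using g_pos[of y]
      by (simp add: field_simps power2_eq_square)
    moreover have "\<dots> \<ge> 0" using g_pos[of y] by simp
    ultimately show "?g / 2 * (?p\<^sup>2 + ?q\<^sup>2) - 9 * ?h\<^sup>2 / (2 * ?g) * ((P y)\<^sup>2 + (Q y)\<^sup>2) \<le> jac P Q e1 e2 y"
      by linarith
    have sq: "(a + b)\<^sup>2 \<le> 2 * a\<^sup>2 + 2 * b\<^sup>2" for a b :: real
      using sum_squares_bound[of a b] by (simp add: power2_sum)
    have "(dir_deriv P e1 y)\<^sup>2 + (dir_deriv Q e1 y)\<^sup>2
        \<le> 2 * (?g * ?q)\<^sup>2 + 2 * (- (3 * Q y * ?h))\<^sup>2 + (2 * (- ?g * ?p)\<^sup>2 + 2 * (3 * P y * ?h)\<^sup>2)"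
      unfolding Pt Qt using sq[of "?g * ?q" "- (3 * Q y * ?h)"] sq[of "- ?g * ?p" "3 * P y * ?h"]
      by (simp only: diff_conv_add_uminus)
    also have "\<dots> = (2 * ?g\<^sup>2) * (?p\<^sup>2 + ?q\<^sup>2) + (18 * ?h\<^sup>2) * ((P y)\<^sup>2 + (Q y)\<^sup>2)"
      by algebra
    also have "\<dots> \<le> (2 * ?g\<^sup>2 + 18 * ?h\<^sup>2) * (?p\<^sup>2 + ?q\<^sup>2 + ((P y)\<^sup>2 + (Q y)\<^sup>2))"
      unfolding ring_distribs(1) ring_distribs(2)
      by (simp add: add_mono)
    finally show "(dir_deriv P e1 y)\<^sup>2 + (dir_deriv Q e1 y)\<^sup>2
        \<le> (2 * ?g\<^sup>2 + 18 * ?h\<^sup>2) * (?p\<^sup>2 + ?q\<^sup>2 + (P y)\<^sup>2 + (Q y)\<^sup>2)"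
      by (simp only: add.assoc)
  qed
  then show ?thesis by (simp add: P_def Q_def)
qed

end

locale proper_cubic_system = cubic_system +
  assumes proper: "\<And>y. \<not> (a0 y = g y \<and> a1 y = 1)"
begin

text \<open>Coefficients of the cubic in s after division by its leading coefficient
  \<open>g\<close>, which is the normalized a2. Its roots times \<open>g\<close> are the eigenvalues
  of the system matrix.\<close>

definition c2 :: "real^2 \<Rightarrow> real" where "c2 y = (2 * a1 y - 3) / g y"
definition c1 :: "real^2 \<Rightarrow> real" where "c1 y = (3 * a0 y - 2 * g y) / g y"
definition c0 :: "real^2 \<Rightarrow> real" where "c0 y = - a1 y / g y"

sublocale fam: cubic_family c2 c1 c0
  unfolding c2_def[abs_def] c1_def[abs_def] c0_def[abs_def]
  by unfold_locales
    (intro smooth_on_divide smooth_on_diff smooth_on_mult smooth_on_uminus smooth smooth_on_const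
      open_UNIV g_nonzero)+

abbreviation "El \<equiv> fam.elliptic"
abbreviation "s \<equiv> fam.upper_root"

lemma cubic_eq:
  "of_real (g y) * cubic (c2 y) (c1 y) (c0 y) z
    = of_real (g y) * z ^ 3 + (2 * of_real (a1 y) - 3) * z\<^sup>2 + (3 * of_real (a0 y) - 2 * of_real (g y)) * z
      - of_real (a1 y)"
proof -
  have "g y * c2 y = 2 * a1 y - 3" "g y * c1 y = 3 * a0 y - 2 * g y" "g y * c0 y = - a1 y"
    using g_nonzero[of y] by (simp_all add: c2_def c1_def c0_def)
  from this[THEN arg_cong[where f = complex_of_real]]
  have "of_real (g y) * of_real (c2 y) = 2 * of_real (a1 y) - (3 :: complex)"
    "of_real (g y) * of_real (c1 y) = 3 * of_real (a0 y) - 2 * (of_real (g y) :: complex)"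
    "of_real (g y) * of_real (c0 y) = - (of_real (a1 y) :: complex)"
    by simp_all
  then show ?thesis unfolding cubic_def by algebra
qed

lemma s_Im: "y \<in> El \<Longrightarrow> Im (s y) > 0"
  by (rule fam.upper_root(1))

lemma s_eq:
  assumes "y \<in> El"
  shows "of_real (g y) * (s y) ^ 3 + (2 * of_real (a1 y) - 3) * (s y)\<^sup>2
      + (3 * of_real (a0 y) - 2 * of_real (g y)) * s y - of_real (a1 y) = 0"
  using fam.upper_root(2)[OF assms] unfolding cubic_eq[symmetric] by simp

text \<open>At an imaginary unit the cubic equals \<open>3 (1 - a1) \<plusminus> 3 \<i> (a0 - g)\<close>.\<close>

lemma root_not_imaginary_unit:
  fixes z :: complex
  assumes "of_real (g y) * z ^ 3 + (2 * of_real (a1 y) - 3) * z\<^sup>2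
      + (3 * of_real (a0 y) - 2 * of_real (g y)) * z - of_real (a1 y) = 0"
  shows "1 + z\<^sup>2 \<noteq> 0"
proof
  assume z: "1 + z\<^sup>2 = 0"
  have "of_real (g y) * z ^ 3 + (2 * of_real (a1 y) - 3) * z\<^sup>2
      + (3 * of_real (a0 y) - 2 * of_real (g y)) * z - of_real (a1 y)
    = of_real (3 - 3 * a1 y) + of_real (3 * (a0 y - g y)) * z
      + (1 + z\<^sup>2) * (of_real (g y) * z + 2 * of_real (a1 y) - 3)"
    by (simp add: algebra_simps power2_eq_square power3_eq_cube)
  then have 0: "of_real (3 - 3 * a1 y) + of_real (3 * (a0 y - g y)) * z = 0"
    using assms z by simp
  have "z\<^sup>2 = - 1" using z by (simp add: add_eq_0_iff)
  then have "Re z = 0" "Im z \<noteq> 0"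
    by (auto simp: complex_eq_iff power2_eq_square) (metis mult_zero_right not_square_less_zero zero_less_one
        neg_0_less_iff_less neg_less_0_iff_less less_numeral_extra(1))+
  then have "a0 y = g y" "a1 y = 1"
    using 0 by (auto simp: complex_eq_iff)
  then show False using proper by blast
qed

text \<open>The integral at the momentum with p1 / g = 1 and p2 = z. When z is the tangent of the
  angle, the value on the unit circle is, up to sign, G / (1 + z^2)^(3/2).\<close>

definition G :: "real^2 \<Rightarrow> complex \<Rightarrow> complex" where
  "G y z = of_real (a0 y) + of_real (a1 y) * z + of_real (g y) * z\<^sup>2 + z ^ 3"

text \<open>The numerator of the derivative of G / (1 + z^2)^(3/2) is G' (1 + z^2) - 3 z G, and its
  terms in z^4 cancel: it is - g times the monic cubic. So s is a critical point.\<close>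

lemma G_critical:
  assumes "y \<in> El"
  shows "(of_real (a1 y) + 2 * of_real (g y) * s y + 3 * (s y)\<^sup>2) * (1 + (s y)\<^sup>2) = 3 * s y * G y (s y)"
  using s_eq[OF assms] unfolding G_def by algebra

text \<open>A critical point with critical value zero would be a non-real double zero of the real
  polynomial G.\<close>

lemma G_nonzero:
  assumes y: "y \<in> El"
  shows "G y (s y) \<noteq> 0"
proof
  assume 0: "G y (s y) = 0"
  then have "of_real (a1 y) + 2 * of_real (g y) * s y + 3 * (s y)\<^sup>2 = 0"
    using G_critical[OF y] root_not_imaginary_unit[OF s_eq[OF y]] by simp
  then have "Im (s y) = 0"
    using 0 by (intro cubic_double_root_real[of "g y" "a1 y" "a0 y"])
      (simp_all add: cubic_def G_def algebra_simps)
  then show False using s_Im[OF y] by simp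
qed

text \<open>The differential of \<open>G\<close> with the root held fixed: only the coefficients a0,
  a1 and g vary.\<close>

definition E :: "real^2 \<Rightarrow> real^2 \<Rightarrow> complex" where
  "E v y = of_real (dir_deriv a0 v y) + of_real (dir_deriv a1 v y) * s y + of_real (dir_deriv g v y) * (s y)\<^sup>2"

text \<open>The square of a non-real critical value of the integral on the unit circle; it is a Riemann
  invariant of the system.\<close>

definition w :: "real^2 \<Rightarrow> complex" where
  "w y = (G y (s y))\<^sup>2 / (1 + (s y)\<^sup>2) ^ 3"

definition \<kappa> :: "real^2 \<Rightarrow> complex" where
  "\<kappa> y = 2 * G y (s y) / (1 + (s y)\<^sup>2) ^ 3"

lemma \<kappa>_nonzero: "y \<in> El \<Longrightarrow> \<kappa> y \<noteq> 0"
  unfolding \<kappa>_def using G_nonzero root_not_imaginary_unit[OF s_eq] by simp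

text \<open>Since s is critical for the function whose value is \<open>w\<close>, the terms with ds
  cancel (\<open>crit\<close>) and only the variation of the coefficients remains.\<close>

lemma w_derivative:
  assumes y: "y \<in> El"
  shows "(w has_derivative (\<lambda>v. \<kappa> y * E v y)) (at y)"
proof -
  let ?s = "s y" and ?G = "G y (s y)"
  define H where "H = of_real (a1 y) + 2 * of_real (g y) * ?s + 3 * ?s\<^sup>2"
  define q where "q = 1 + ?s\<^sup>2"
  have q: "q \<noteq> 0" unfolding q_def by (rule root_not_imaginary_unit[OF s_eq[OF y]])
  have crit: "H * q = 3 * ?s * ?G" unfolding H_def q_def by (rule G_critical[OF y])
  note ds = has_derivative_frechetI[OF fam.upper_root_differentiable_at[OF y]]
  have dG: "((\<lambda>y. G y (s y)) has_derivative (\<lambda>v. E v y + H * dir_deriv s v y)) (at y)"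
    unfolding G_def
    by (rule has_derivative_eq_rhs, (rule derivative_intros a0_deriv a1_deriv g_deriv ds)+)
      (auto simp: fun_eq_iff E_def H_def algebra_simps power2_eq_square power3_eq_cube)
  have dq: "((\<lambda>y. (1 + (s y)\<^sup>2) ^ 3) has_derivative (\<lambda>v. 6 * ?s * q\<^sup>2 * dir_deriv s v y)) (at y)"
    by (rule has_derivative_eq_rhs, (rule derivative_intros ds)+)
      (auto simp: fun_eq_iff q_def algebra_simps power2_eq_square)
  have dG2: "((\<lambda>y. (G y (s y))\<^sup>2) has_derivative (\<lambda>v. 2 * ?G * (E v y + H * dir_deriv s v y))) (at y)"
    by (rule has_derivative_eq_rhs, (rule derivative_intros dG)+)
      (auto simp: fun_eq_iff algebra_simps)
  have "(w has_derivative (\<lambda>v. (2 * ?G * (E v y + H * dir_deriv s v y) * q ^ 3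
      - ?G\<^sup>2 * (6 * ?s * q\<^sup>2 * dir_deriv s v y)) / (q ^ 3 * q ^ 3))) (at y)"
    unfolding w_def[abs_def]
    using has_derivative_divide'[OF dG2 dq] q unfolding q_def by simp
  then show ?thesis
  proof (rule has_derivative_eq_rhs, intro ext)
    fix v
    have "2 * ?G * (E v y + H * dir_deriv s v y) * q ^ 3 - ?G\<^sup>2 * (6 * ?s * q\<^sup>2 * dir_deriv s v y)
      = 2 * ?G * E v y * q ^ 3"
      using crit by algebra
    moreover have "\<kappa> y = 2 * ?G / q ^ 3" by (simp add: \<kappa>_def q_def)
    moreover have "2 * ?G * E v y * r / (r * r) = 2 * ?G / r * E v y" for r
      by (cases "r = 0") (simp_all add: field_simps)
    ultimately show "(2 * ?G * (E v y + H * dir_deriv s v y) * q ^ 3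
      - ?G\<^sup>2 * (6 * ?s * q\<^sup>2 * dir_deriv s v y)) / (q ^ 3 * q ^ 3) = \<kappa> y * E v y"
      by (simp only:)
  qed
qed

text \<open>The row (1, s, s^2) is a left eigenvector of the system matrix for the eigenvalue g s:
  its first two entries are immediate, and the third is the cubic equation for s. Applied to the
  system it gives w_t = - g s w_x after multiplication by \<open>\<kappa>\<close>.\<close>

lemma E_characteristic:
  assumes "y \<in> El"
  shows "E e1 y = - (of_real (g y) * s y * E e2 y)"
proof -
  have r: "of_real (dir_deriv a0 e1 y) = - (of_real (a1 y) * of_real (dir_deriv g e2 y) :: complex)"
    "of_real (dir_deriv a1 e1 y) = - (of_real (g y) * of_real (dir_deriv a0 e2 y)
      + (2 * of_real (g y) - 3 * of_real (a0 y)) * of_real (dir_deriv g e2 y) :: complex)"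
    "of_real (dir_deriv g e1 y) = - (of_real (g y) * of_real (dir_deriv a1 e2 y)
      + (3 - 2 * of_real (a1 y)) * of_real (dir_deriv g e2 y) :: complex)"
  proof -
    have "dir_deriv a0 e1 y = - (a1 y * dir_deriv g e2 y)" using pde0[of y] by linarith
    then show "of_real (dir_deriv a0 e1 y) = - (of_real (a1 y) * of_real (dir_deriv g e2 y) :: complex)" by simp
    have "dir_deriv a1 e1 y = - (g y * dir_deriv a0 e2 y + (2 * g y - 3 * a0 y) * dir_deriv g e2 y)"
      using pde1[of y] by linarith
    then show "of_real (dir_deriv a1 e1 y) = - (of_real (g y) * of_real (dir_deriv a0 e2 y)
      + (2 * of_real (g y) - 3 * of_real (a0 y)) * of_real (dir_deriv g e2 y) :: complex)" by simp
    have "dir_deriv g e1 y = - (g y * dir_deriv a1 e2 y + (3 - 2 * a1 y) * dir_deriv g e2 y)"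
      using pde2[of y] by linarith
    then show "of_real (dir_deriv g e1 y) = - (of_real (g y) * of_real (dir_deriv a1 e2 y)
      + (3 - 2 * of_real (a1 y)) * of_real (dir_deriv g e2 y) :: complex)" by simp
  qed
  show ?thesis
    unfolding E_def r using s_eq[OF assms] by algebra
qed

lemma Ck_on_w: "Ck_on k El w"
proof -
  have c: "Ck_on k El f" if "\<And>k. Ck_on k UNIV f" for f :: "real^2 \<Rightarrow> real"
    using Ck_on_subset[OF that] by simp
  show ?thesis
    unfolding w_def[abs_def] G_def
    by (rule Ck_on_divide Ck_on_add Ck_on_mult Ck_on_power Ck_on_of_real fam.open_elliptic
        c[OF smooth_Ck(1)] c[OF smooth_Ck(2)] c[OF smooth_Ck(3)] fam.Ck_on_upper_root Ck_on_const
          power_not_zero root_not_imaginary_unit s_eq | assumption)+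
qed

lemma s_periodic:
  assumes "a0 y = a0 y'" "a1 y = a1 y'" "g y = g y'"
  shows "y \<in> El \<longleftrightarrow> y' \<in> El" "s y = s y'" "w y = w y'"
  using assms by (simp_all add: fam.elliptic_def fam.upper_root_def w_def G_def c2_def c1_def c0_def)


lemma dir_deriv_w: "y \<in> El \<Longrightarrow> dir_deriv w v y = \<kappa> y * E v y"
  by (rule dir_deriv_eq[OF w_derivative])

lemma Im_w_derivative: "y \<in> El \<Longrightarrow> ((\<lambda>y. Im (w y)) has_derivative (\<lambda>v. Im (dir_deriv w v y))) (at y)"
  and Re_w_derivative: "y \<in> El \<Longrightarrow> ((\<lambda>y. Re (w y)) has_derivative (\<lambda>v. Re (dir_deriv w v y))) (at y)"
  using has_derivative_Im[OF w_derivative] has_derivative_Re[OF w_derivative] by (simp_all add: dir_deriv_w)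

section \<open>Constancy of the Riemann invariant\<close>

definition level :: "real \<Rightarrow> (real^2) set" where
  "level d = {y \<in> El. d \<le> (Im (w y))\<^sup>2}"

text \<open>The level sets do not reach the boundary of the elliptic set, where \<open>w\<close> becomes real.\<close>

lemma closed_level:
  assumes d: "d > 0"
  shows "closed (level d)"
  unfolding closed_sequential_limits
proof (intro allI impI, elim conjE)
  fix x l assume x: "\<forall>n. x n \<in> level d" and l: "x \<longlonglongrightarrow> l"
  have xE: "x n \<in> El" and xd: "d \<le> (Im (w (x n)))\<^sup>2" for n
    using x by (auto simp: level_def)
  have lim: "(\<lambda>n. f (x n)) \<longlonglongrightarrow> f l" if "Ck_on 0 UNIV f" for f :: "real^2 \<Rightarrow> real"
    using isCont_tendsto_compose[OF Ck_on_UNIV_isCont[OF that] l] .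
  note lims = lim[OF smooth_Ck(1)] lim[OF smooth_Ck(2)] lim[OF smooth_Ck(3)]
  have c_lims: "(\<lambda>n. c2 (x n)) \<longlonglongrightarrow> c2 l" "(\<lambda>n. c1 (x n)) \<longlonglongrightarrow> c1 l" "(\<lambda>n. c0 (x n)) \<longlonglongrightarrow> c0 l"
    unfolding c2_def c1_def c0_def by (intro tendsto_intros lims; simp add: g_nonzero)+
  have "(\<lambda>n. 1 + \<bar>c2 (x n)\<bar> + \<bar>c1 (x n)\<bar> + \<bar>c0 (x n)\<bar>) \<longlonglongrightarrow> 1 + \<bar>c2 l\<bar> + \<bar>c1 l\<bar> + \<bar>c0 l\<bar>"
    by (intro tendsto_intros c_lims)
  then have "Bseq (\<lambda>n. 1 + \<bar>c2 (x n)\<bar> + \<bar>c1 (x n)\<bar> + \<bar>c0 (x n)\<bar>)"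
    by (intro convergent_imp_Bseq convergentI)
  then obtain B where B: "\<And>n. \<bar>1 + \<bar>c2 (x n)\<bar> + \<bar>c1 (x n)\<bar> + \<bar>c0 (x n)\<bar>\<bar> \<le> B"
    unfolding Bseq_def by auto
  have "s (x n) \<in> cball 0 B" for n
  proof -
    have "cmod (s (x n)) \<le> B"
      using cubic_root_bound[OF fam.upper_root(2)[OF xE[of n]]] B[of n] by linarith
    then show ?thesis by simp
  qed
  \<comment> \<open>A limit root along a subsequence. It may lie on the real line, but it is not an
    imaginary unit, so \<open>w\<close> converges along this subsequence too.\<close>
  then obtain z r where r: "strict_mono r" "((\<lambda>n. s (x n)) \<circ> r) \<longlonglongrightarrow> z"
    using compact_cball[of "0 :: complex" B] unfolding compact_def by metis
  have z: "(\<lambda>n. s (x (r n))) \<longlonglongrightarrow> z" using r(2) by (simp add: o_def)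
  note sub = LIMSEQ_subseq_LIMSEQ[OF _ r(1), unfolded o_def]
  have "(\<lambda>n. cubic (c2 (x (r n))) (c1 (x (r n))) (c0 (x (r n))) (s (x (r n)))) \<longlonglongrightarrow> cubic (c2 l) (c1 l) (c0 l) z"
    unfolding cubic_def by (intro tendsto_intros z sub[OF c_lims(1)] sub[OF c_lims(2)] sub[OF c_lims(3)])
  then have root: "cubic (c2 l) (c1 l) (c0 l) z = 0"
    using fam.upper_root(2)[OF xE] by (simp add: LIMSEQ_const_iff)
  then have nz: "1 + z\<^sup>2 \<noteq> 0"
    using root_not_imaginary_unit cubic_eq by (metis mult_zero_right)
  have "(\<lambda>n. Im (s (x (r n)))) \<longlonglongrightarrow> Im z" by (intro tendsto_intros z)
  then have "Im z \<ge> 0"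
    by (rule LIMSEQ_le_const) (use s_Im[OF xE] in \<open>auto intro: less_imp_le\<close>)
  have wl: "(\<lambda>n. w (x (r n))) \<longlonglongrightarrow> (G l z)\<^sup>2 / (1 + z\<^sup>2) ^ 3"
    unfolding w_def G_def
    by (intro tendsto_intros z sub[OF lims(1)] sub[OF lims(2)] sub[OF lims(3)]) (use nz in simp)
  have "(\<lambda>n. (Im (w (x (r n))))\<^sup>2) \<longlonglongrightarrow> (Im ((G l z)\<^sup>2 / (1 + z\<^sup>2) ^ 3))\<^sup>2"
    by (intro tendsto_intros wl)
  then have ge: "d \<le> (Im ((G l z)\<^sup>2 / (1 + z\<^sup>2) ^ 3))\<^sup>2"
    by (rule LIMSEQ_le_const) (use xd in auto)
  \<comment> \<open>A real limit root would give a real limit of \<open>w\<close>, against (Im w)^2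
    \<ge> d > 0. Hence the limit point is elliptic with upper root \<open>z\<close>.\<close>
  have "Im z \<noteq> 0"
  proof
    assume "Im z = 0"
    then have "z = of_real (Re z)" by (simp add: complex_eq_iff)
    then obtain c where c: "z = of_real c" by blast
    have "(G l z)\<^sup>2 / (1 + z\<^sup>2) ^ 3
        = of_real ((a0 l + a1 l * c + g l * c\<^sup>2 + c ^ 3)\<^sup>2 / (1 + c\<^sup>2) ^ 3)"
      unfolding c G_def by simp
    then have "Im ((G l z)\<^sup>2 / (1 + z\<^sup>2) ^ 3) = 0" by (simp only: Im_complex_of_real)
    then show False using ge d by simp
  qed
  then have "Im z > 0" using \<open>Im z \<ge> 0\<close> by simp
  then have "l \<in> El" "s l = z"
    using root fam.upper_root_eqI by (auto simp: fam.elliptic_def)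
  then show "l \<in> level d"
    using ge by (simp add: level_def w_def)
qed

text \<open>With \<open>u + \<i> v = w\<close> and a cut-off \<open>m\<close> vanishing near \<open>v = 0\<close>, the functions \<open>v m\<close> and
  \<open>u m\<close> extend by zero to the whole torus, and their Jacobian has a sign.\<close>

definition cutoff :: "real \<Rightarrow> real \<Rightarrow> real" where
  "cutoff d v = (max 0 (v\<^sup>2 - d)) ^ 3"

definition cutoff' :: "real \<Rightarrow> real \<Rightarrow> real" where
  "cutoff' d v = 3 * (max 0 (v\<^sup>2 - d))\<^sup>2 * (2 * v)"

lemma cutoff_derivative: "(cutoff d has_real_derivative cutoff' d v) (at v)"
  unfolding cutoff_def cutoff'_def
  by (rule DERIV_chain2[OF Ck_on_max_power(2)]) (auto intro!: derivative_eq_intros)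

lemma Ck_on_cutoff: "Ck_on 2 UNIV (cutoff d)"
proof -
  have "Ck_on (Suc (Suc 0)) UNIV (\<lambda>v::real. v\<^sup>2 - d)"
    by (rule Ck_on_diff Ck_on_power Ck_on_bounded_linear[OF bounded_linear_ident] Ck_on_const open_UNIV)+
  then show ?thesis
    unfolding cutoff_def[abs_def] numeral_2_eq_2
    by - (rule Ck_on_compose[OF open_UNIV _ _ Ck_on_max_power(1)], simp_all only: subset_UNIV)
qed

definition P where "P d y = (if y \<in> El then Im (w y) * cutoff d (Im (w y)) else 0)"
definition Q where "Q d y = (if y \<in> El then Re (w y) * cutoff d (Im (w y)) else 0)"

lemma cutoff_level:
  assumes "y \<notin> level d"
  shows "P d y = 0" "Q d y = 0"
  using assms by (auto simp: P_def Q_def level_def cutoff_def)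

text \<open>The elliptic set and the complement of the closed level set are open and cover the
  plane; on the second set \<open>h\<close> is zero.\<close>

lemma Ck_on_extend:
  assumes d: "d > 0" and "Ck_on k El f" "\<And>y. y \<in> El \<Longrightarrow> h y = f y" "\<And>y. y \<notin> level d \<Longrightarrow> h y = 0"
  shows "Ck_on k UNIV (h :: real^2 \<Rightarrow> real)"
proof -
  have "Ck_on k (El \<union> - level d) h"
  proof (rule Ck_on_Un)
    show "Ck_on k El h"
      by (rule Ck_on_cong[OF fam.open_elliptic _ assms(2)]) (simp add: assms(3))
    show "Ck_on k (- level d) h"
      by (rule Ck_on_cong[OF _ _ Ck_on_const[of k _ 0]])
        (use assms(4) closed_level[OF d] in \<open>auto simp: open_Compl\<close>)
  qed (use fam.open_elliptic closed_level[OF d] in \<open>auto simp: open_Compl\<close>)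
  moreover have "El \<union> - level d = UNIV" by (auto simp: level_def)
  ultimately show ?thesis by simp
qed

lemma Ck_on_P_Q:
  assumes "d > 0"
  shows "Ck_on 2 UNIV (P d)" "Ck_on 2 UNIV (Q d)"
proof -
  have I: "Ck_on 2 El (\<lambda>y. Im (w y))" and R: "Ck_on 2 El (\<lambda>y. Re (w y))"
    by (intro Ck_on_Im Ck_on_Re fam.open_elliptic Ck_on_w)+
  have C: "Ck_on 2 El (\<lambda>y. cutoff d (Im (w y)))"
    by (rule Ck_on_compose[OF fam.open_elliptic _ I Ck_on_cutoff]) simp
  show "Ck_on 2 UNIV (P d)"
    by (rule Ck_on_extend[OF assms Ck_on_mult[OF fam.open_elliptic I C]])
      (use cutoff_level in \<open>auto simp: P_def\<close>)
  show "Ck_on 2 UNIV (Q d)"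
    by (rule Ck_on_extend[OF assms Ck_on_mult[OF fam.open_elliptic R C]])
      (use cutoff_level in \<open>auto simp: Q_def\<close>)
qed

lemma periodic_P_Q: "periodic (P d)" "periodic (Q d)"
proof -
  have "P d (\<Phi> (u + v)) = P d (\<Phi> u) \<and> Q d (\<Phi> (u + v)) = Q d (\<Phi> u)" if "v = w1 \<or> v = w2" for u v
  proof -
    have "a0 (\<Phi> (u + v)) = a0 (\<Phi> u)" "a1 (\<Phi> (u + v)) = a1 (\<Phi> u)" "g (\<Phi> (u + v)) = g (\<Phi> u)"
      using per that unfolding periodic_def by auto
    note s_periodic[OF this]
    then show ?thesis by (simp add: P_def Q_def)
  qed
  then show "periodic (P d)" "periodic (Q d)" unfolding periodic_def by auto
qed

text \<open>Write w = u + \<i> v and m for the cut-off at v. Then dP = (m + v m') dv, and the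
  dv-term of dQ drops out, leaving (m + v m') m dv \<and> du. The equation w_t = - g s w_x turns dv
  \<and> du into - g Im s |w_x|^2, which has a fixed sign because Im s > 0.\<close>

lemma jac_P_Q:
  assumes y: "y \<in> El"
  shows "jac (P d) (Q d) e1 e2 y = - ((cutoff d (Im (w y)) + Im (w y) * cutoff' d (Im (w y)))
    * cutoff d (Im (w y)) * (g y * Im (s y) * (cmod (dir_deriv w e2 y))\<^sup>2))"
proof -
  let ?v = "Im (w y)" and ?u = "Re (w y)"
  have dc: "((\<lambda>y. cutoff d (Im (w y))) has_derivative (\<lambda>v. cutoff' d ?v * Im (dir_deriv w v y))) (at y)"
    using DERIV_compose_FDERIV[OF cutoff_derivative Im_w_derivative[OF y]] by (simp add: mult.commute)
  have "((\<lambda>y. Im (w y) * cutoff d (Im (w y))) has_derivative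
      (\<lambda>v. ?v * (cutoff' d ?v * Im (dir_deriv w v y)) + Im (dir_deriv w v y) * cutoff d ?v)) (at y)"
    by (rule has_derivative_mult[OF Im_w_derivative[OF y] dc])
  then have "(P d has_derivative
      (\<lambda>v. ?v * (cutoff' d ?v * Im (dir_deriv w v y)) + Im (dir_deriv w v y) * cutoff d ?v)) (at y)"
    by (rule has_derivative_transform_within_open[OF _ fam.open_elliptic y]) (simp add: P_def)
  note DP = dir_deriv_eq[OF this]
  have "((\<lambda>y. Re (w y) * cutoff d (Im (w y))) has_derivative
      (\<lambda>v. ?u * (cutoff' d ?v * Im (dir_deriv w v y)) + Re (dir_deriv w v y) * cutoff d ?v)) (at y)"
    by (rule has_derivative_mult[OF Re_w_derivative[OF y] dc])
  then have "(Q d has_derivative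
      (\<lambda>v. ?u * (cutoff' d ?v * Im (dir_deriv w v y)) + Re (dir_deriv w v y) * cutoff d ?v)) (at y)"
    by (rule has_derivative_transform_within_open[OF _ fam.open_elliptic y]) (simp add: Q_def)
  note DQ = dir_deriv_eq[OF this]
  define a where "a = Re (dir_deriv w e2 y)"
  define b where "b = Im (dir_deriv w e2 y)"
  have t: "dir_deriv w e1 y = - (of_real (g y) * s y * dir_deriv w e2 y)"
    unfolding dir_deriv_w[OF y] E_characteristic[OF y] by simp
  have r: "Re (dir_deriv w e1 y) = - (g y * (Re (s y) * a - Im (s y) * b))"
    and i: "Im (dir_deriv w e1 y) = - (g y * (Re (s y) * b + Im (s y) * a))"
    unfolding t a_def b_def by (simp_all add: algebra_simps)
  have n: "(cmod (dir_deriv w e2 y))\<^sup>2 = a\<^sup>2 + b\<^sup>2"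
    unfolding a_def b_def by (rule cmod_power2)
  show ?thesis
    unfolding jac_def DP[of e1] DP[of e2] DQ[of e1] DQ[of e2] r i n a_def[symmetric] b_def[symmetric]
    by algebra
qed

lemma dir_deriv_w_zero_off_real:
  assumes y: "y \<in> El" and v: "Im (w y) \<noteq> 0"
  shows "dir_deriv w e2 y = 0"
proof -
  \<comment> \<open>Half of the value at \<open>y\<close>, so that the cut-off is positive
    there.\<close>
  define d where "d = (Im (w y))\<^sup>2 / 2"
  have d: "d > 0" using v by (simp add: d_def)
  have nn': "0 \<le> v * cutoff' d v" for v
  proof -
    have "v * cutoff' d v = 6 * v\<^sup>2 * (max 0 (v\<^sup>2 - d))\<^sup>2"
      by (simp add: cutoff'_def power2_eq_square)
    then show ?thesis by simp
  qed
  have nn: "0 \<le> cutoff d v + v * cutoff' d v" "0 \<le> cutoff d v" for v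
    using nn'[of v] by (simp_all add: cutoff_def)
  have le: "jac (P d) (Q d) e1 e2 y' \<le> 0" for y'
  proof (cases "y' \<in> El")
    case True
    show ?thesis
      unfolding jac_P_Q[OF True] neg_le_0_iff_le
      by (intro mult_nonneg_nonneg nn less_imp_le[OF g_pos] less_imp_le[OF s_Im[OF True]]) simp
  next
    case False
    have "((\<lambda>y. 0) has_derivative (\<lambda>v. 0)) (at y')" by simp
    then have "(P d has_derivative (\<lambda>v. 0)) (at y')"
      by (rule has_derivative_transform_within_open[of _ _ _ _ "- level d"])
        (use False closed_level[OF d] cutoff_level(1) in \<open>auto simp: level_def open_Compl\<close>)
    then show ?thesis by (simp add: jac_def dir_deriv_eq)
  qed
  have "jac (P d) (Q d) e1 e2 y = 0"
    by (rule jac_nonpos_imp_zero[OF Ck_on_le[OF Ck_on_P_Q(1)[OF d]] Ck_on_P_Q(2)[OF d] periodic_P_Q le]) simp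
  moreover have "cutoff d (Im (w y)) > 0"
    unfolding cutoff_def d_def using v by (simp add: max_def)
  moreover from this have "cutoff d (Im (w y)) + Im (w y) * cutoff' d (Im (w y)) > 0"
    using nn' by (rule add_pos_nonneg)
  ultimately have "(cmod (dir_deriv w e2 y))\<^sup>2 = 0"
    unfolding jac_P_Q[OF y] using g_pos[of y] s_Im[OF y] by (simp add: g_nonzero)
  then show ?thesis by simp
qed

text \<open>The cut-off argument covers only points with Im w \<noteq> 0. If w_x \<noteq> 0 at some
  point, then also nearby, so Im w vanishes near it and dw is real there; but w_t = - g s w_x with
  non-real s then forces w_x = 0.\<close>

lemma E_zero:
  assumes y: "y \<in> El"
  shows "E v y = 0"
proof -
  have e2: "E e2 y = 0"
  proof (rule ccontr)
    assume "E e2 y \<noteq> 0"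
    then have ne: "dir_deriv w e2 y \<noteq> 0"
      unfolding dir_deriv_w[OF y] using \<kappa>_nonzero[OF y] by simp
    have "continuous_on El (dir_deriv w e2)"
      using Ck_on_continuous_on[OF Ck_on_dir_deriv[OF Ck_on_w]] .
    then have S: "open (El \<inter> dir_deriv w e2 -` (- {0}))"
      by (rule continuous_open_preimage[OF _ fam.open_elliptic]) (simp add: open_Compl)
    have "((\<lambda>y. 0) has_derivative (\<lambda>v. 0)) (at y)" by simp
    then have "((\<lambda>y. Im (w y)) has_derivative (\<lambda>v. 0)) (at y)"
    proof (rule has_derivative_transform_within_open[OF _ S])
      show "y \<in> El \<inter> dir_deriv w e2 -` (- {0})" using y ne by simp
      show "0 = Im (w y')" if "y' \<in> El \<inter> dir_deriv w e2 -` (- {0})" for y'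
        using dir_deriv_w_zero_off_real[of y'] that by auto
    qed
    from fun_cong[OF has_derivative_unique[OF Im_w_derivative[OF y] this]]
    have I: "Im (dir_deriv w v y) = 0" for v .
    have "dir_deriv w e1 y = - (of_real (g y) * s y * dir_deriv w e2 y)"
      unfolding dir_deriv_w[OF y] E_characteristic[OF y] by simp
    then have "g y * (Im (s y) * Re (dir_deriv w e2 y)) = 0"
      using I[of e1] I[of e2] by (simp add: algebra_simps)
    then have "Re (dir_deriv w e2 y) = 0" using g_nonzero[of y] s_Im[OF y] by simp
    then show False using ne I[of e2] by (simp add: complex_eq_iff)
  qed
  moreover have "E e1 y = 0" using E_characteristic[OF y] e2 by simp
  moreover have "dir_deriv a0 v y = v $ 1 *\<^sub>R dir_deriv a0 e1 y + v $ 2 *\<^sub>R dir_deriv a0 e2 y"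
    "dir_deriv a1 v y = v $ 1 *\<^sub>R dir_deriv a1 e1 y + v $ 2 *\<^sub>R dir_deriv a1 e2 y"
    "dir_deriv g v y = v $ 1 *\<^sub>R dir_deriv g e1 y + v $ 2 *\<^sub>R dir_deriv g e2 y"
    by (rule dir_deriv_expand differentiable)+
  then have "E v y = of_real (v $ 1) * E e1 y + of_real (v $ 2) * E e2 y"
    unfolding E_def by (simp add: algebra_simps)
  ultimately show ?thesis by simp
qed


text \<open>The real quadratic polynomial da0 + da1 z + dg z^2 has the non-real root s, so it equals
  dg (z - s) (z - cnj s).\<close>

lemma gradient_relations:
  assumes y: "y \<in> El"
  shows "dir_deriv a1 v y = - 2 * Re (s y) * dir_deriv g v y"
    "dir_deriv a0 v y = (cmod (s y))\<^sup>2 * dir_deriv g v y"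
proof -
  let ?a = "dir_deriv a0 v y" and ?b = "dir_deriv a1 v y" and ?c = "dir_deriv g v y"
  obtain x z where s: "s y = Complex x z" by (cases "s y")
  have z: "z > 0" using s_Im[OF y] s by simp
  have im: "?b * z + ?c * (2 * x * z) = 0" and re: "?a + ?b * x + ?c * (x\<^sup>2 - z\<^sup>2) = 0"
    using arg_cong[OF E_zero[OF y, of v], of Im] arg_cong[OF E_zero[OF y, of v], of Re]
    unfolding E_def s by (simp_all add: power2_eq_square algebra_simps)
  have "z * (?b + 2 * x * ?c) = 0" using im by (simp add: algebra_simps)
  then have b: "?b = - 2 * x * ?c" using z by simp
  then show "?b = - 2 * Re (s y) * ?c" by (simp add: s)
  show "?a = (cmod (s y))\<^sup>2 * ?c"
    using re unfolding b s cmod_power2 complex.sel by algebra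
qed

section \<open>Simple waves along straight characteristics\<close>

definition lam :: "real^2 \<Rightarrow> real" where
  "lam y = 3 - 2 * a1 y - 2 * g y * Re (s y)"

text \<open>\<open>lam\<close> is the real eigenvalue: the trace 3 - 2 a1 of the system matrix less
  the conjugate pair g s and g cnj s. The equation for \<open>g\<close> is the third row of the
  system; a0 and a1 follow because their gradients are multiples of that of
  \<open>g\<close>.\<close>

lemma simple_wave:
  assumes y: "y \<in> El"
  shows "dir_deriv g e1 y = - lam y * dir_deriv g e2 y"
    "dir_deriv a0 e1 y = - lam y * dir_deriv a0 e2 y"
    "dir_deriv a1 e1 y = - lam y * dir_deriv a1 e2 y"
proof -
  show g: "dir_deriv g e1 y = - lam y * dir_deriv g e2 y"
    using pde2[of y] gradient_relations(1)[OF y, of e2] unfolding lam_def by algebra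
  show "dir_deriv a0 e1 y = - lam y * dir_deriv a0 e2 y"
    "dir_deriv a1 e1 y = - lam y * dir_deriv a1 e2 y"
    unfolding gradient_relations[OF y] g by simp_all
qed

text \<open>The differentials of the coefficients are multiples of dg; implicit differentiation of
  the cubic passes this on to the root, and so to \<open>lam\<close>. It makes \<open>lam\<close>
  solve the same transport equation as \<open>g\<close>, which is then Burgers' equation.\<close>

lemma lam_derivative:
  assumes y: "y \<in> El"
  obtains \<sigma> where "(lam has_derivative (\<lambda>v. \<sigma> * dir_deriv g v y)) (at y)"
proof -
  note rel = gradient_relations[OF y]
  define k2 where "k2 = (- 4 * Re (s y) * g y - (2 * a1 y - 3)) / (g y * g y)"
  define k1 where "k1 = ((3 * (cmod (s y))\<^sup>2 - 2) * g y - (3 * a0 y - 2 * g y)) / (g y * g y)"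
  define k0 where "k0 = (2 * Re (s y) * g y + a1 y) / (g y * g y)"
  have "(c2 has_derivative
      (\<lambda>v. ((2 * dir_deriv a1 v y) * g y - (2 * a1 y - 3) * dir_deriv g v y) / (g y * g y))) (at y)"
    unfolding c2_def[abs_def]
    by (rule has_derivative_divide'[OF _ g_deriv g_nonzero])
      (auto intro!: derivative_eq_intros a1_deriv)
  note c2' = dir_deriv_eq[OF this]
  have D2: "dir_deriv c2 v y = k2 * dir_deriv g v y" for v
    unfolding c2' k2_def rel(1)[of v] by (simp add: algebra_simps)
  have "(c1 has_derivative
      (\<lambda>v. ((3 * dir_deriv a0 v y - 2 * dir_deriv g v y) * g y - (3 * a0 y - 2 * g y) * dir_deriv g v y) / (g y * g y))) (at y)"
    unfolding c1_def[abs_def]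
    by (rule has_derivative_divide'[OF _ g_deriv g_nonzero])
      (auto intro!: derivative_eq_intros a0_deriv g_deriv)
  note c1' = dir_deriv_eq[OF this]
  have D1: "dir_deriv c1 v y = k1 * dir_deriv g v y" for v
    unfolding c1' k1_def rel(2)[of v] by (simp add: algebra_simps)
  have "(c0 has_derivative
      (\<lambda>v. ((- dir_deriv a1 v y) * g y - (- a1 y) * dir_deriv g v y) / (g y * g y))) (at y)"
    unfolding c0_def[abs_def]
    by (rule has_derivative_divide'[OF has_derivative_minus[OF a1_deriv] g_deriv g_nonzero])
  note c0' = dir_deriv_eq[OF this]
  have D0: "dir_deriv c0 v y = k0 * dir_deriv g v y" for v
    unfolding c0' k0_def rel(1)[of v] by (simp add: algebra_simps)
  define \<sigma> where "\<sigma> = - (of_real k2 * (s y)\<^sup>2 + of_real k1 * s y + of_real k0)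
    / (3 * (s y)\<^sup>2 + 2 * of_real (c2 y) * s y + of_real (c1 y))"
  have Ds: "dir_deriv s v y = of_real (dir_deriv g v y) * \<sigma>" for v
    unfolding fam.dir_deriv_upper_root[OF y] D2[of v] D1[of v] D0[of v] \<sigma>_def
    by (simp add: algebra_simps)
  have "(lam has_derivative (\<lambda>v. - (2 * dir_deriv a1 v y)
      - 2 * (g y * Re (dir_deriv s v y) + dir_deriv g v y * Re (s y)))) (at y)"
    unfolding lam_def[abs_def]
    by (rule has_derivative_eq_rhs, (rule derivative_intros a1_deriv g_deriv has_derivative_Re
          has_derivative_frechetI[OF fam.upper_root_differentiable_at[OF y]])+)
      (simp add: fun_eq_iff algebra_simps)
  then have "(lam has_derivative (\<lambda>v. (2 * Re (s y) - 2 * g y * Re \<sigma>) * dir_deriv g v y)) (at y)"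
    unfolding Ds rel by (rule has_derivative_eq_rhs) (simp add: fun_eq_iff algebra_simps)
  then show ?thesis using that by blast
qed

lemma lam_characteristic:
  assumes y: "y \<in> El"
  shows "lam differentiable (at y)" "dir_deriv lam e1 y = - lam y * dir_deriv lam e2 y"
proof -
  obtain \<sigma> where d: "(lam has_derivative (\<lambda>v. \<sigma> * dir_deriv g v y)) (at y)"
    using lam_derivative[OF y] by blast
  then show "lam differentiable (at y)" by (auto simp: differentiable_def)
  show "dir_deriv lam e1 y = - lam y * dir_deriv lam e2 y"
    unfolding dir_deriv_eq[OF d] simple_wave(1)[OF y] by simp
qed

lemma Ck_on_lam: "Ck_on k El lam"
proof -
  have c: "Ck_on k El f" if "\<And>k. Ck_on k UNIV f" for f :: "real^2 \<Rightarrow> real"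
    using Ck_on_subset[OF that] by simp
  show ?thesis
    unfolding lam_def[abs_def]
    by (rule Ck_on_diff Ck_on_mult Ck_on_const Ck_on_Re fam.open_elliptic
        c[OF smooth_Ck(1)] c[OF smooth_Ck(2)] c[OF smooth_Ck(3)] fam.Ck_on_upper_root)+
qed

lemma dir_deriv_line:
  fixes f :: "real^2 \<Rightarrow> real"
  assumes "f differentiable (at y)"
  shows "dir_deriv f (e1 + l *\<^sub>R e2) y = dir_deriv f e1 y + l * dir_deriv f e2 y"
  using dir_deriv_expand[OF assms, of "e1 + l *\<^sub>R e2"] by (simp add: axis_def)

text \<open>\<open>T\<close> is described by a0, a1 and g, which are defined on the whole plane, so
  its closedness needs no knowledge of where the line goes. Ellipticity and \<open>lam\<close> are
  determined by these three values and therefore reappear at every parameter in \<open>T\<close>;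
  this gives openness, and the line never leaves the elliptic set.\<close>

lemma characteristic_line:
  assumes y: "y \<in> El"
  shows "a0 (y + t *\<^sub>R (e1 + lam y *\<^sub>R e2)) = a0 y \<and> a1 (y + t *\<^sub>R (e1 + lam y *\<^sub>R e2)) = a1 y
    \<and> g (y + t *\<^sub>R (e1 + lam y *\<^sub>R e2)) = g y"
proof -
  define l where "l = lam y"
  define c where "c t = y + t *\<^sub>R (e1 + l *\<^sub>R e2)" for t
  define T where "T = {t. a0 (c t) = a0 y} \<inter> {t. a1 (c t) = a1 y} \<inter> {t. g (c t) = g y}"
  have cc: "continuous_on UNIV c" unfolding c_def by (intro continuous_intros)
  have "closed T"
    unfolding T_def
    by (intro closed_Int closed_Collect_eq continuous_intros
        continuous_on_compose2[OF Ck_on_continuous_on[OF smooth_Ck(1)[of 0]] cc]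
        continuous_on_compose2[OF Ck_on_continuous_on[OF smooth_Ck(2)[of 0]] cc]
        continuous_on_compose2[OF Ck_on_continuous_on[OF smooth_Ck(3)[of 0]] cc] subset_UNIV)
  moreover have "open T"
    unfolding open_contains_cball
  proof
    fix t1 assume t1: "t1 \<in> T"
    then have eq: "a0 (c t1) = a0 y" "a1 (c t1) = a1 y" "g (c t1) = g y" by (auto simp: T_def)
    have E1: "c t1 \<in> El" and lam1: "lam (c t1) = l"
      using s_periodic[OF eq] y eq by (simp_all add: lam_def l_def)
    have "open (c -` El)" by (rule open_vimage[OF fam.open_elliptic cc])
    then obtain r where r: "r > 0" "cball t1 r \<subseteq> c -` El"
      using E1 unfolding open_contains_cball by blast
    define I where "I = {t1 - r..t1 + r}"
    have IE: "c t \<in> El" if "t \<in> I" for t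
    proof -
      have "t \<in> cball t1 r" using that by (auto simp: I_def dist_real_def abs_le_iff)
      then show ?thesis using r(2) by auto
    qed
    have line: "((\<lambda>t. f (c t)) has_real_derivative dir_deriv f e1 (c t) + l * dir_deriv f e2 (c t)) (at t)"
      if "f differentiable (at (c t))" for f :: "real^2 \<Rightarrow> real" and t
      using has_real_derivative_along_line[OF that[unfolded c_def]] dir_deriv_line[OF that]
      unfolding c_def by simp
    have lam_l: "lam (c t) = l" if t: "t \<in> I" for t
    proof -
      have "continuous_on I (\<lambda>t. dir_deriv lam e2 (c t))"
        by (rule continuous_on_compose2[OF Ck_on_continuous_on[OF Ck_on_dir_deriv[OF Ck_on_lam]]
              continuous_on_subset[OF cc]]) (use IE in auto)
      \<comment> \<open>By Burgers' equation f = lam - l satisfies f' = - lam_x f along the line,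
        and f vanishes at \<open>t1\<close>.\<close>
      then have "lam (c t) - l = 0"
        unfolding I_def
      proof (rule linear_ode_zero[where f = "\<lambda>t. lam (c t) - l" and c = t1])
        fix t assume "t \<in> {t1 - r..t1 + r}"
        then have E: "c t \<in> El" using IE by (simp add: I_def)
        have "((\<lambda>t. lam (c t) - l) has_real_derivative
            dir_deriv lam e1 (c t) + l * dir_deriv lam e2 (c t) - 0) (at t)"
          by (intro DERIV_diff line lam_characteristic(1) E DERIV_const)
        then show "((\<lambda>t. lam (c t) - l) has_real_derivative - (dir_deriv lam e2 (c t) * (lam (c t) - l)))
            (at t within {t1 - r..t1 + r})"
          unfolding lam_characteristic(2)[OF E]
          by (rule has_field_derivative_at_within[OF DERIV_cong]) (simp add: algebra_simps)
      qed (use r(1) t lam1 in \<open>auto simp: I_def\<close>)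
      then show ?thesis by simp
    qed
    have const: "f (c t) = f (c t1)"
      if t: "t \<in> I" and f: "\<And>y. f differentiable (at y)"
        and w: "\<And>y. y \<in> El \<Longrightarrow> dir_deriv f e1 y = - lam y * dir_deriv f e2 y"
      for f :: "real^2 \<Rightarrow> real" and t
    proof -
      have "((\<lambda>t. f (c t)) has_real_derivative 0) (at x within I)" if "x \<in> I" for x
        by (rule has_field_derivative_at_within[OF DERIV_cong[OF line[OF f]]])
          (simp add: w[OF IE[OF that]] lam_l[OF that])
      then obtain k where "\<And>x. x \<in> I \<Longrightarrow> f (c x) = k"
        using has_derivative_zero_constant[of I "\<lambda>x. f (c x)"]
        by (auto simp: has_field_derivative_def lambda_zero I_def)
      moreover have "t1 \<in> I" using r(1) by (simp add: I_def)
      ultimately show ?thesis using t by simp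
    qed
    have "cball t1 r \<subseteq> T"
    proof
      fix t assume "t \<in> cball t1 r"
      then have t: "t \<in> I" by (auto simp: I_def dist_real_def)
      show "t \<in> T"
        using const[OF t differentiable(1) simple_wave(2)] const[OF t differentiable(2) simple_wave(3)]
          const[OF t differentiable(3) simple_wave(1)] eq by (simp add: T_def)
    qed
    then show "\<exists>e>0. cball t1 e \<subseteq> T" using r(1) by blast
  qed
  moreover have "0 \<in> T" by (simp add: T_def c_def)
  ultimately have "T = UNIV" using clopen[of T] by blast
  then have "t \<in> T" by simp
  then show ?thesis by (simp add: T_def c_def l_def)
qed

text \<open>Along its characteristic line \<open>lam\<close> is constant, and two lines of different slopes meet.\<close>

lemma lam_unique:
  assumes y: "y \<in> El" and z: "z \<in> El"
  shows "lam y = lam z"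
proof (rule ccontr)
  assume ne: "lam y \<noteq> lam z"
  \<comment> \<open>Intersection of the two lines: equal first coordinates give t in terms of t',
    equal second coordinates then determine t'.\<close>
  define t' where "t' = (z $ 2 - y $ 2 - lam y * (z $ 1 - y $ 1)) / (lam y - lam z)"
  define t where "t = t' + z $ 1 - y $ 1"
  have t': "t' * (lam y - lam z) = z $ 2 - y $ 2 - lam y * (z $ 1 - y $ 1)"
    using ne unfolding t'_def by simp
  have meet: "y + t *\<^sub>R (e1 + lam y *\<^sub>R e2) = z + t' *\<^sub>R (e1 + lam z *\<^sub>R e2)"
    using t' by (simp add: vec_eq_iff forall_2 axis_def t_def algebra_simps)
  have on_line: "lam (y + t *\<^sub>R (e1 + lam y *\<^sub>R e2)) = lam y" if "y \<in> El" for y t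
    using s_periodic(2)[of "y + t *\<^sub>R (e1 + lam y *\<^sub>R e2)" y] characteristic_line[OF that, of t]
    by (simp add: lam_def)
  show False using on_line[OF y, of t] on_line[OF z, of t'] meet ne by simp
qed

end

section \<open>Constant speed and integration to the reducible form\<close>

context proper_cubic_system
begin

text \<open>Compare the integral with k1 (g \<xi> + l \<eta>)^3 + k2 (\<xi>^2 + \<eta>^2) (g \<xi> +
  l \<eta>), where \<xi> = p1 / g and \<eta> = p2. For l \<noteq> 0 the coefficients of \<eta>^3 and
  \<xi> \<eta>^2, equal to 1 and g, fix k1 and k2 as functions of l alone; the two other
  coefficients then become these equations, free of k1 and k2.\<close>

definition reducible_point :: "real \<Rightarrow> real^2 \<Rightarrow> bool" where
  "reducible_point l y \<longleftrightarrow> 2 * l\<^sup>2 * (a1 y - (3 - l) / 2) = (3 * l - 3) * (g y)\<^sup>2 \<and>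
     l * a0 y = (3 - l) * g y / 3 + a1 y * g y / 3"

lemma reducible_coefficients:
  assumes r: "reducible_point l y" and l: "l \<noteq> 0"
  defines "k1 \<equiv> (l - 1) / (2 * l ^ 3)" and "k2 \<equiv> (3 - l) / (2 * l)"
  shows "k1 * l ^ 3 + k2 * l = 1" "3 * k1 * g y * l\<^sup>2 + k2 * g y = g y"
    "3 * k1 * (g y)\<^sup>2 * l + k2 * l = a1 y" "k1 * (g y) ^ 3 + k2 * g y = a0 y"
proof -
  have k1: "2 * l ^ 3 * k1 = l - 1" and k2: "2 * l * k2 = 3 - l"
    using l unfolding k1_def k2_def by simp_all
  have r1: "2 * l\<^sup>2 * (a1 y - (3 - l) / 2) = (3 * l - 3) * (g y)\<^sup>2"
    and r2: "l * a0 y = (3 - l) * g y / 3 + a1 y * g y / 3"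
    using r by (simp_all add: reducible_point_def)
  show 1: "k1 * l ^ 3 + k2 * l = 1" using k1 k2 by (simp add: algebra_simps)
  have "2 * l * (3 * k1 * g y * l\<^sup>2 + k2 * g y) = 3 * (2 * l ^ 3 * k1) * g y + (2 * l * k2) * g y"
    by (simp add: algebra_simps power2_eq_square power3_eq_cube)
  also have "\<dots> = 2 * l * g y" unfolding k1 k2 by (simp add: algebra_simps)
  finally show "3 * k1 * g y * l\<^sup>2 + k2 * g y = g y" using l by simp
  have "2 * l\<^sup>2 * (3 * k1 * (g y)\<^sup>2 * l + k2 * l) = 3 * (2 * l ^ 3 * k1) * (g y)\<^sup>2 + (2 * l * k2) * l\<^sup>2"
    by (simp add: algebra_simps power2_eq_square power3_eq_cube)
  also have "\<dots> = 2 * l\<^sup>2 * a1 y" 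
  proof -
    have "2 * l\<^sup>2 * a1 y - l\<^sup>2 * (3 - l) = (3 * l - 3) * (g y)\<^sup>2"
      unfolding r1[symmetric] by (simp add: field_simps)
    then show ?thesis unfolding k1 k2 by algebra
  qed
  finally show a1: "3 * k1 * (g y)\<^sup>2 * l + k2 * l = a1 y" using l by simp
  have "3 * l * (k1 * (g y) ^ 3 + k2 * g y) = (3 * k1 * (g y)\<^sup>2 * l + k2 * l) * g y + (2 * l * k2) * g y"
    by (simp add: algebra_simps power2_eq_square power3_eq_cube)
  also have "\<dots> = 3 * l * a0 y"
  proof -
    have "3 * (l * a0 y) = (3 - l) * g y + a1 y * g y" unfolding r2 by simp
    then show ?thesis unfolding a1 k2 by algebra
  qed
  finally show "k1 * (g y) ^ 3 + k2 * g y = a0 y" using l by simp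
qed

context
  fixes l :: real
  assumes lam_const: "\<And>y. y \<in> El \<Longrightarrow> lam y = l"
begin

text \<open>The first relation eliminates Re s from \<open>gradient_relations\<close> by means of
  lam = l; the second is the first row of the system with a0_t = - l a0_x.\<close>

lemma constant_speed_relations:
  assumes y: "y \<in> El"
  shows "g y * dir_deriv a1 v y = (l - 3 + 2 * a1 y) * dir_deriv g v y"
    "l * dir_deriv a0 v y = a1 y * dir_deriv g v y"
proof -
  have "- 2 * g y * Re (s y) = l - 3 + 2 * a1 y"
    using lam_const[OF y] unfolding lam_def by linarith
  then show "g y * dir_deriv a1 v y = (l - 3 + 2 * a1 y) * dir_deriv g v y"
    unfolding gradient_relations[OF y] by algebra
  note w = simple_wave[OF y, unfolded lam_const[OF y]]
  have 2: "l * dir_deriv a0 e2 y = a1 y * dir_deriv g e2 y"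
    using pde0[of y] unfolding w by simp
  then have 1: "l * dir_deriv a0 e1 y = a1 y * dir_deriv g e1 y"
    unfolding w by simp
  have "dir_deriv a0 v y = v $ 1 * dir_deriv a0 e1 y + v $ 2 * dir_deriv a0 e2 y"
    and "dir_deriv g v y = v $ 1 * dir_deriv g e1 y + v $ 2 * dir_deriv g e2 y"
    unfolding real_scaleR_def[symmetric] by (rule dir_deriv_expand differentiable)+
  then show "l * dir_deriv a0 v y = a1 y * dir_deriv g v y"
    using 1 2 by algebra
qed

text \<open>\<open>kk\<close> and \<open>ll\<close> are constants of integration of
  \<open>constant_speed_relations\<close>. The first relation says that a1 - (3 - l) / 2 varies like
  g^2; the second uses that a1 dg is one third of (3 - l) dg + d(a1 g).\<close>

definition kk :: "real^2 \<Rightarrow> real" where "kk y = (a1 y - (3 - l) / 2) / (g y * g y)"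
definition ll :: "real^2 \<Rightarrow> real" where "ll y = l * a0 y - (3 - l) * g y / 3 - a1 y * g y / 3"

lemma kk_derivative: assumes y: "y \<in> El" shows "(kk has_derivative (\<lambda>v. 0)) (at y)"
proof -
  have "(kk has_derivative (\<lambda>v. (dir_deriv a1 v y * (g y * g y)
      - (a1 y - (3 - l) / 2) * (g y * dir_deriv g v y + dir_deriv g v y * g y)) / ((g y * g y) * (g y * g y)))) (at y)"
    unfolding kk_def[abs_def]
    by (rule has_derivative_divide'[OF _ has_derivative_mult[OF g_deriv g_deriv]])
      (use g_nonzero[of y] in \<open>auto intro!: derivative_eq_intros a1_deriv\<close>)
  moreover have "dir_deriv a1 v y * (g y * g y)
      - (a1 y - (3 - l) / 2) * (g y * dir_deriv g v y + dir_deriv g v y * g y) = 0" for v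
  proof -
    define b where "b = (3 - l) / 2"
    have "2 * b = 3 - l" by (simp add: b_def)
    then show ?thesis
      unfolding b_def[symmetric] using constant_speed_relations(1)[OF y, of v] by algebra
  qed
  ultimately show ?thesis by (simp only: div_0)
qed

lemma ll_derivative: assumes y: "y \<in> El" shows "(ll has_derivative (\<lambda>v. 0)) (at y)"
proof -
  have "(ll has_derivative (\<lambda>v. l * dir_deriv a0 v y - (3 - l) * dir_deriv g v y / 3
      - (a1 y * dir_deriv g v y + dir_deriv a1 v y * g y) / 3)) (at y)"
    unfolding ll_def[abs_def]
    by (auto intro!: derivative_eq_intros a0_deriv a1_deriv g_deriv simp: fun_eq_iff)
  moreover have "l * dir_deriv a0 v y - (3 - l) * dir_deriv g v y / 3
      - (a1 y * dir_deriv g v y + dir_deriv a1 v y * g y) / 3 = 0" for v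
    using constant_speed_relations[OF y, of v] by (simp add: field_simps)
  ultimately show ?thesis by (simp only:)
qed

lemma reducible_point_iff:
  "reducible_point l y \<longleftrightarrow> 2 * l\<^sup>2 * kk y = 3 * l - 3 \<and> ll y = 0"
proof -
  have "a1 y - (3 - l) / 2 = kk y * (g y)\<^sup>2"
    unfolding kk_def power2_eq_square using g_nonzero[of y] by simp
  then have "2 * l\<^sup>2 * (a1 y - (3 - l) / 2) = (2 * l\<^sup>2 * kk y) * (g y)\<^sup>2" by simp
  then show ?thesis
    unfolding reducible_point_def ll_def using g_nonzero[of y] by auto
qed

text \<open>Reducibility is a condition on \<open>kk\<close> and \<open>ll\<close>, which have zero
  derivative. It is thus open and closed within the elliptic set and can spread over a component,
  also to points with g_x = 0.\<close>

lemma reducible_point_locally_constant: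
  assumes y: "y \<in> El"
  obtains e where "e > 0" "ball y e \<subseteq> El" "\<And>z. z \<in> ball y e \<Longrightarrow> reducible_point l z = reducible_point l y"
proof -
  obtain e where e: "e > 0" "ball y e \<subseteq> El"
    using fam.open_elliptic y open_contains_ball by blast
  have const: "f z = f y" if z: "z \<in> ball y e" and f: "\<And>z. z \<in> El \<Longrightarrow> (f has_derivative (\<lambda>v. 0)) (at z)"
    for f :: "real^2 \<Rightarrow> real" and z
  proof -
    obtain c where "\<And>x. x \<in> ball y e \<Longrightarrow> f x = c"
      using has_derivative_zero_constant[OF convex_ball, of y e f]
        has_derivative_at_withinI[OF f] subsetD[OF e(2)] by metis
    then show ?thesis using z e(1) by simp
  qed
  show ?thesis
    using that[OF e] const[OF _ kk_derivative] const[OF _ ll_derivative] reducible_point_iff by simp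
qed

lemma open_reducible:
  "open {y \<in> El. reducible_point l y}" "open {y \<in> El. \<not> reducible_point l y}"
  unfolding open_contains_ball
  using reducible_point_locally_constant by (auto simp: subset_iff) metis+

lemma nonflat_reducible_point:
  assumes y: "y \<in> El" and ne: "dir_deriv g e2 y \<noteq> 0"
  shows "l \<noteq> 0" "reducible_point l y"
proof -
  define S where "S y = g y * (3 * l - 3 - 2 * l\<^sup>2 * kk y) - 3 * ll y" for y
  have S0: "S z = 0" if z: "z \<in> El" "dir_deriv g e2 z \<noteq> 0" for z
  proof -
    note w = simple_wave[OF z(1), unfolded lam_const[OF z(1)]]
    have p: "- l * dir_deriv a1 e2 z + g z * dir_deriv a0 e2 z + (2 * g z - 3 * a0 z) * dir_deriv g e2 z = 0"
      using pde1[of z] unfolding w by simp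
    have kg: "kk z * (g z)\<^sup>2 = a1 z - (3 - l) / 2"
      unfolding kk_def power2_eq_square using g_nonzero[of z] by simp
    have "dir_deriv g e2 z * (g z * S z) = 0"
      using p constant_speed_relations[OF z(1), of e2] kg unfolding S_def ll_def by algebra
    then show ?thesis using z(2) g_nonzero[of z] by simp
  qed
  have "continuous_on UNIV (dir_deriv g e2)"
    by (rule continuous_on_dir_deriv[OF smooth_Ck(3)])
  then have op: "open (El \<inter> dir_deriv g e2 -` (- {0}))"
    by (intro open_Int fam.open_elliptic open_vimage) (auto simp: open_Compl)
  have "((\<lambda>y. 0) has_derivative (\<lambda>v. 0)) (at y)" by simp
  then have S1: "(S has_derivative (\<lambda>v. 0)) (at y)"
    by (rule has_derivative_transform_within_open[OF _ op]) (use y ne S0 in auto)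
  have S2: "(S has_derivative (\<lambda>v. dir_deriv g v y * (3 * l - 3 - 2 * l\<^sup>2 * kk y))) (at y)"
    unfolding S_def[abs_def]
    by (rule has_derivative_eq_rhs, (rule derivative_intros g_deriv kk_derivative[OF y] ll_derivative[OF y])+)
      (simp add: fun_eq_iff)
  have "dir_deriv g e2 y * (3 * l - 3 - 2 * l\<^sup>2 * kk y) = 0"
    by (rule fun_cong[OF has_derivative_unique[OF S2 S1]])
  then have k: "2 * l\<^sup>2 * kk y = 3 * l - 3" using ne by simp
  then show "l \<noteq> 0" by auto
  have "ll y = 0" using S0[OF y ne] k unfolding S_def by simp
  then show "reducible_point l y" using k reducible_point_iff by simp
qed

end

lemma flat_or_reducible_locally:
  obtains l where "\<And>y. y \<in> El \<Longrightarrow> dir_deriv g e1 y = - l * dir_deriv g e2 y"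
    "\<And>y. y \<in> El \<Longrightarrow> dir_deriv g e2 y \<noteq> 0 \<Longrightarrow> l \<noteq> 0 \<and> reducible_point l y"
    "open {y \<in> El. reducible_point l y}" "open {y \<in> El. \<not> reducible_point l y}"
proof (cases "El = {}")
  case True
  then show ?thesis using that[of 0] by simp
next
  case False
  then obtain y0 where "y0 \<in> El" by blast
  then have c: "\<And>y. y \<in> El \<Longrightarrow> lam y = lam y0" using lam_unique by blast
  show ?thesis
    by (rule that[of "lam y0"])
      (use simple_wave(1) c nonflat_reducible_point[OF c] open_reducible[OF c] in \<open>simp_all\<close>)
qed

end

section \<open>Point transformations are symplectic\<close>

locale plane_diffeo =
  fixes \<Phi> :: "real^2 \<Rightarrow> real^2"
  assumes diffeo: "diffeomorphism \<Phi>"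
begin

definition \<Psi> :: "real^2 \<Rightarrow> real^2" where "\<Psi> = inv \<Phi>"

lemma bij: "bij \<Phi>" and Ck_on_\<Phi>: "Ck_on k UNIV \<Phi>" and Ck_on_\<Psi>: "Ck_on k UNIV \<Psi>"
  using diffeo by (simp_all add: diffeomorphism_def smooth_on_def \<Psi>_def)

lemma \<Psi>_\<Phi>: "\<Psi> (\<Phi> u) = u" and \<Phi>_\<Psi>: "\<Phi> (\<Psi> y) = y"
  using bij by (simp_all add: \<Psi>_def bij_is_inj bij_is_surj surj_f_inv_f)

lemma \<Phi>_diff: "\<Phi> differentiable (at u)" and \<Psi>_diff: "\<Psi> differentiable (at y)"
  by (rule Ck_on_differentiable[OF Ck_on_\<Phi> UNIV_I] Ck_on_differentiable[OF Ck_on_\<Psi> UNIV_I])+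

lemma D\<Psi>_D\<Phi>: "dir_deriv \<Psi> (dir_deriv \<Phi> v u) (\<Phi> u) = v"
proof -
  have "dir_deriv \<Psi> (dir_deriv \<Phi> v u) (\<Phi> u) = dir_deriv (\<lambda>u. \<Psi> (\<Phi> u)) v u"
    by (rule dir_deriv_compose[symmetric, OF \<Psi>_diff \<Phi>_diff])
  also have "\<dots> = v" unfolding \<Psi>_\<Phi> by (rule dir_deriv_eq[OF has_derivative_ident])
  finally show ?thesis .
qed

lemma D\<Phi>_D\<Psi>: "dir_deriv \<Phi> (dir_deriv \<Psi> v (\<Phi> u)) u = v"
proof -
  have "dir_deriv \<Phi> (dir_deriv \<Psi> v (\<Phi> u)) (\<Psi> (\<Phi> u)) = dir_deriv (\<lambda>y. \<Phi> (\<Psi> y)) v (\<Phi> u)"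
    by (rule dir_deriv_compose[symmetric, OF \<Phi>_diff \<Psi>_diff])
  also have "\<dots> = v" unfolding \<Phi>_\<Psi> by (rule dir_deriv_eq[OF has_derivative_ident])
  finally show ?thesis unfolding \<Psi>_\<Phi> .
qed

lemma linear_D\<Phi>: "linear (frechet_derivative \<Phi> (at u))" and linear_D\<Psi>: "linear (frechet_derivative \<Psi> (at y))"
  by (rule linear_frechet_derivative \<Phi>_diff \<Psi>_diff)+

text \<open>The coordinate vector fields of t and x, written in the linear coordinates of the
  plane.\<close>

definition frame :: "2 \<Rightarrow> real^2 \<Rightarrow> real^2" where
  "frame j u = dir_deriv \<Psi> (axis j 1) (\<Phi> u)"

lemma D\<Phi>_frame: "dir_deriv \<Phi> (frame j u) u = axis j 1"
  unfolding frame_def by (rule D\<Phi>_D\<Psi>)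

lemma frame_expand: "v = dir_deriv \<Phi> v u $ 1 *\<^sub>R frame 1 u + dir_deriv \<Phi> v u $ 2 *\<^sub>R frame 2 u"
proof -
  have "v = dir_deriv \<Psi> (dir_deriv \<Phi> v u) (\<Phi> u)" by (rule D\<Psi>_D\<Phi>[symmetric])
  then show ?thesis
    unfolding frame_def using dir_deriv_expand[OF \<Psi>_diff] by metis
qed

lemma Ck_on_frame: "Ck_on k UNIV (frame j)"
  unfolding frame_def[abs_def]
  by (rule Ck_on_compose[OF open_UNIV _ Ck_on_\<Phi> Ck_on_dir_deriv[OF Ck_on_\<Psi>]]) simp

lemma frame_deriv: "dir_deriv (frame j) (frame i u) u = dir_deriv (dir_deriv \<Psi> (axis j 1)) (axis i 1) (\<Phi> u)"
proof -
  have "dir_deriv (frame j) (frame i u) u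
      = dir_deriv (dir_deriv \<Psi> (axis j 1)) (dir_deriv \<Phi> (frame i u) u) (\<Phi> u)"
    unfolding frame_def[of j, abs_def]
    by (rule dir_deriv_compose[OF Ck_on_differentiable[OF Ck_on_dir_deriv[OF Ck_on_\<Psi>] UNIV_I] \<Phi>_diff])
  then show ?thesis unfolding D\<Phi>_frame .
qed

text \<open>Coordinate vector fields have zero Lie bracket, by the symmetry of the second
  derivatives of \<open>\<Psi>\<close>.\<close>

lemma frame_commute: "dir_deriv (frame j) (frame i u) u = dir_deriv (frame i) (frame j u) u"
  unfolding frame_deriv by (rule dir_deriv_commute[OF Ck_on_\<Psi>])

definition momenta :: "phase \<Rightarrow> real^2" where
  "momenta z = (\<chi> j. snd z \<bullet> frame j (fst z))"

lemma adjoint_momenta: "adjoint (frechet_derivative \<Phi> (at u)) (momenta (u, p)) = p"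
proof -
  have "adjoint (frechet_derivative \<Phi> (at u)) (momenta (u, p)) \<bullet> w = p \<bullet> w" for w
  proof -
    have "adjoint (frechet_derivative \<Phi> (at u)) (momenta (u, p)) \<bullet> w = momenta (u, p) \<bullet> dir_deriv \<Phi> w u"
      by (rule adjoint_clauses(2)[OF linear_D\<Phi>])
    also have "\<dots> = p \<bullet> (dir_deriv \<Phi> w u $ 1 *\<^sub>R frame 1 u + dir_deriv \<Phi> w u $ 2 *\<^sub>R frame 2 u)"
      by (simp add: momenta_def inner_vec_def sum_2 algebra_simps)
    also have "\<dots> = p \<bullet> w" by (simp only: frame_expand[symmetric])
    finally show ?thesis .
  qed
  then show ?thesis by (metis vector_eq_rdot)
qed

definition transform :: "phase \<Rightarrow> phase" where
  "transform z = (\<Phi> (fst z), momenta z)"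

lemma momenta_has_derivative:
  "(momenta has_derivative (\<lambda>v. \<chi> j. p \<bullet> dir_deriv (frame j) (fst v) u + snd v \<bullet> frame j u)) (at (u, p))"
proof -
  have "((\<lambda>z. momenta z $ j) has_derivative (\<lambda>v. p \<bullet> dir_deriv (frame j) (fst v) u + snd v \<bullet> frame j u)) (at (u, p))"
    for j
  proof -
    have "((\<lambda>z. frame j (fst z)) has_derivative (\<lambda>v. dir_deriv (frame j) (fst v) u)) (at (u, p))"
      by (rule has_derivative_compose[OF has_derivative_fst[OF has_derivative_ident], of "frame j"])
        (use Ck_on_SucD[OF Ck_on_frame UNIV_I] in simp)
    from has_derivative_inner[OF has_derivative_snd[OF has_derivative_ident] this]
    show ?thesis unfolding momenta_def by simp
  qed
  then show ?thesis
    by (subst has_derivative_componentwise_within)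
      (auto simp: Basis_vec_def inner_axis)
qed

lemma transform_has_derivative:
  "(transform has_derivative (\<lambda>v. (dir_deriv \<Phi> (fst v) u,
     \<chi> j. p \<bullet> dir_deriv (frame j) (fst v) u + snd v \<bullet> frame j u))) (at (u, p))"
proof -
  have "((\<lambda>z. \<Phi> (fst z)) has_derivative (\<lambda>v. dir_deriv \<Phi> (fst v) u)) (at (u, p))"
    by (rule has_derivative_compose[OF has_derivative_fst[OF has_derivative_ident], of \<Phi>])
      (use has_derivative_frechetI[OF \<Phi>_diff] in simp)
  from has_derivative_Pair[OF this momenta_has_derivative]
  show ?thesis unfolding transform_def[abs_def] by simp
qed

lemma phase_expand:
  assumes "linear (L :: phase \<Rightarrow> real)"
  shows "L (a, b) = a $ 1 * L (e1, 0) + a $ 2 * L (e2, 0) + b $ 1 * L (0, e1) + b $ 2 * L (0, e2)"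
proof -
  have "(a, b) = a $ 1 *\<^sub>R (e1, 0) + a $ 2 *\<^sub>R (e2, 0) + b $ 1 *\<^sub>R (0, e1) + b $ 2 *\<^sub>R (0, e2)"
    using vec2_expand[of a] vec2_expand[of b] by (simp add: add.assoc)
  then show ?thesis
    by (simp only: linear_add[OF assms] linear_scale[OF assms] real_scaleR_def)
qed

text \<open>The matrices \<open>m\<close> of d\<Phi> and \<open>n\<close> of the frame are inverse
  to each other, which yields the canonical bracket. The terms \<open>k\<close>, from
  differentiating the frame, enter only through one antisymmetric combination, and
  \<open>sym\<close> makes it zero.\<close>

lemma poisson_bracket_transform:
  fixes V W :: "phase \<Rightarrow> real"
  assumes V: "V differentiable (at (transform (u, p)))" and W: "W differentiable (at (transform (u, p)))"
  shows "poisson_bracket (\<lambda>z. V (transform z)) (\<lambda>z. W (transform z)) (u, p)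
    = poisson_bracket V W (transform (u, p))"
proof -
  define k where "k j v = p \<bullet> dir_deriv (frame j) v u" for j v
  have D: "frechet_derivative (\<lambda>z. L (transform z)) (at (u, p)) v
      = frechet_derivative L (at (transform (u, p))) (dir_deriv \<Phi> (fst v) u, \<chi> j. k j (fst v) + snd v \<bullet> frame j u)"
    if "L differentiable (at (transform (u, p)))" for L :: "phase \<Rightarrow> real" and v
    unfolding k_def
    by (rule dir_deriv_eq[OF has_derivative_compose[OF transform_has_derivative has_derivative_frechetI[OF that]]])
  have k_lin: "k j v = v $ 1 * k j e1 + v $ 2 * k j e2" for j v
    unfolding k_def
    by (subst dir_deriv_expand[OF Ck_on_differentiable[OF Ck_on_frame UNIV_I]]) (simp add: inner_add_right)
  have k0: "k j 0 = 0" for j using k_lin[of j 0] by simp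
  have \<Phi>0: "dir_deriv \<Phi> 0 u = 0" by (rule linear_0[OF linear_D\<Phi>])
  define m where "m j i = dir_deriv \<Phi> (axis i 1) u $ j" for i j :: 2
  define n where "n i j = frame j u $ i" for i j :: 2
  have mn: "n 1 l * m j 1 + n 2 l * m j 2 = (if j = l then 1 else 0)" for j l
  proof -
    have "dir_deriv \<Phi> (frame l u) u = frame l u $ 1 *\<^sub>R dir_deriv \<Phi> e1 u + frame l u $ 2 *\<^sub>R dir_deriv \<Phi> e2 u"
      by (rule dir_deriv_expand[OF \<Phi>_diff])
    from arg_cong[OF this, of "\<lambda>v. v $ j"] show ?thesis
      unfolding D\<Phi>_frame m_def n_def by (auto simp: axis_def)
  qed
  have sym: "n 1 2 * k 1 e1 + n 2 2 * k 1 e2 = n 1 1 * k 2 e1 + n 2 1 * k 2 e2"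
    using frame_commute[where j = 1 and i = 2 and u = u] k_lin[of 1 "frame 2 u"] k_lin[of 2 "frame 1 u"]
    unfolding k_def n_def by simp
  define V1 where "V1 i = frechet_derivative V (at (transform (u, p))) (axis i 1, 0)" for i :: 2
  define V2 where "V2 i = frechet_derivative V (at (transform (u, p))) (0, axis i 1)" for i :: 2
  define W1 where "W1 i = frechet_derivative W (at (transform (u, p))) (axis i 1, 0)" for i :: 2
  define W2 where "W2 i = frechet_derivative W (at (transform (u, p))) (0, axis i 1)" for i :: 2
  have VE: "frechet_derivative V (at (transform (u, p))) (a, b)
      = a $ 1 * V1 1 + a $ 2 * V1 2 + b $ 1 * V2 1 + b $ 2 * V2 2"
    and WE: "frechet_derivative W (at (transform (u, p))) (a, b)
      = a $ 1 * W1 1 + a $ 2 * W1 2 + b $ 1 * W2 1 + b $ 2 * W2 2" for a b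
    unfolding V1_def V2_def W1_def W2_def
    by (rule phase_expand[OF linear_frechet_derivative[OF V]] phase_expand[OF linear_frechet_derivative[OF W]])+
  have Vu: "frechet_derivative (\<lambda>z. V (transform z)) (at (u, p)) (axis i 1, 0)
      = m 1 i * V1 1 + m 2 i * V1 2 + k 1 (axis i 1) * V2 1 + k 2 (axis i 1) * V2 2"
    and Vp: "frechet_derivative (\<lambda>z. V (transform z)) (at (u, p)) (0, axis i 1) = n i 1 * V2 1 + n i 2 * V2 2"
    and Wu: "frechet_derivative (\<lambda>z. W (transform z)) (at (u, p)) (axis i 1, 0)
      = m 1 i * W1 1 + m 2 i * W1 2 + k 1 (axis i 1) * W2 1 + k 2 (axis i 1) * W2 2"
    and Wp: "frechet_derivative (\<lambda>z. W (transform z)) (at (u, p)) (0, axis i 1) = n i 1 * W2 1 + n i 2 * W2 2" for i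
    unfolding D[OF V] D[OF W] VE WE m_def n_def
    by (simp_all add: k0 \<Phi>0 inner_axis inner_axis')
  have mn': "n 1 1 * m 1 1 + n 2 1 * m 1 2 = 1" "n 1 2 * m 1 1 + n 2 2 * m 1 2 = 0"
    "n 1 1 * m 2 1 + n 2 1 * m 2 2 = 0" "n 1 2 * m 2 1 + n 2 2 * m 2 2 = 1"
    using mn[of 1 1] mn[of 2 1] mn[of 1 2] mn[of 2 2] by simp_all
  have "poisson_bracket (\<lambda>z. V (transform z)) (\<lambda>z. W (transform z)) (u, p)
    = (V1 1 * W2 1 - V2 1 * W1 1) + (V1 2 * W2 2 - V2 2 * W1 2)"
    unfolding poisson_bracket_def sum_2 Vu Vp Wu Wp using mn' sym by algebra
  also have "\<dots> = poisson_bracket V W (transform (u, p))"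
    unfolding poisson_bracket_def sum_2 V1_def V2_def W1_def W2_def ..
  finally show ?thesis .
qed


lemma momenta_adjoint: "momenta (u, adjoint (frechet_derivative \<Phi> (at u)) q) = q"
proof -
  have "adjoint (frechet_derivative \<Phi> (at u)) q \<bullet> frame j u = q \<bullet> axis j 1" for j
    using adjoint_clauses(2)[OF linear_D\<Phi>, of u q "frame j u"] by (simp add: D\<Phi>_frame)
  then show ?thesis by (simp add: momenta_def vec_eq_iff inner_axis)
qed

lemma Ck_on_momenta: "Ck_on k UNIV (\<lambda>z. momenta z $ j)"
  unfolding momenta_def vec_lambda_beta
  by (intro Ck_on_inner open_UNIV Ck_on_bounded_linear bounded_linear_snd
      Ck_on_compose[OF open_UNIV _ Ck_on_bounded_linear[OF bounded_linear_fst] Ck_on_frame]) simp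

end

section \<open>The geodesic Hamiltonian in semi-geodesic coordinates\<close>

locale semigeodesic = plane_diffeo +
  fixes \<Gamma> :: "(real^2) set" and \<rho> :: "real^2 \<Rightarrow> real^2^2" and g :: "real^2 \<Rightarrow> real"
  assumes metric: "riemannian_metric \<Gamma> \<rho>"
    and g_smooth: "smooth_on UNIV g" and g_pos: "\<And>y. g y > 0"
    and metric_form: "\<And>u v w. metric_form \<rho> u v w =
      (g (\<Phi> u))\<^sup>2 * (dir_deriv \<Phi> v u $ 1) * (dir_deriv \<Phi> w u $ 1) + (dir_deriv \<Phi> v u $ 2) * (dir_deriv \<Phi> w u $ 2)"
begin

lemma g_nonzero: "g y \<noteq> 0"
  using g_pos[of y] by simp

lemma g_deriv: "(g has_derivative frechet_derivative g (at y)) (at y)"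
  by (rule Ck_on_SucD[OF smooth_on_UNIV_Ck[OF g_smooth] UNIV_I])

text \<open>\<open>matrix_inv\<close> is a choice that is meaningful for invertible matrices; here
  positive definiteness gives a trivial kernel.\<close>

lemma metric_matrix_inv: "\<rho> u *v (matrix_inv (\<rho> u) *v p) = p"
proof -
  have "v = 0" if "\<rho> u *v v = 0" for v
  proof (rule ccontr)
    assume "v \<noteq> 0"
    then have "metric_form \<rho> u v v > 0" using metric by (simp add: riemannian_metric_def)
    then show False using that by (simp add: metric_form_def)
  qed
  then have "\<exists>A. \<rho> u ** A = mat 1 \<and> A ** \<rho> u = mat 1"
    using matrix_left_invertible_ker[of "\<rho> u"] invertible_left_inverse unfolding invertible_def by blast
  from someI_ex[OF this] have "\<rho> u ** matrix_inv (\<rho> u) = mat 1"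
    unfolding matrix_inv_def by blast
  then show ?thesis
    by (simp add: matrix_vector_mul_assoc)
qed

definition kinetic :: "phase \<Rightarrow> real" where
  "kinetic z = ((snd z $ 1)\<^sup>2 / (g (fst z))\<^sup>2 + (snd z $ 2)\<^sup>2) / 2"

lemma hamiltonian_transform: "hamiltonian \<rho> z = kinetic (transform z)"
proof -
  obtain u p where z: "z = (u, p)" by (cases z)
  define v where "v = matrix_inv (\<rho> u) *v p"
  have "frame j u \<bullet> p = metric_form \<rho> u (frame j u) v" for j
    unfolding metric_form_def v_def metric_matrix_inv ..
  then have q: "momenta (u, p) $ 1 = (g (\<Phi> u))\<^sup>2 * (dir_deriv \<Phi> v u $ 1)" "momenta (u, p) $ 2 = dir_deriv \<Phi> v u $ 2"
    unfolding metric_form D\<Phi>_frame by (simp_all add: momenta_def axis_def inner_commute)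
  have "p \<bullet> v = metric_form \<rho> u v v"
    unfolding metric_form_def v_def metric_matrix_inv by (rule inner_commute)
  also have "\<dots> = (momenta (u, p) $ 1)\<^sup>2 / (g (\<Phi> u))\<^sup>2 + (momenta (u, p) $ 2)\<^sup>2"
    unfolding metric_form q using g_nonzero[of "\<Phi> u"] by (simp add: power2_eq_square)
  finally show ?thesis
    by (simp add: z hamiltonian_def kinetic_def transform_def v_def)
qed

lemma base_function_derivative:
  assumes "Ck_on (Suc 0) UNIV (f :: real^2 \<Rightarrow> real)"
  shows "((\<lambda>z. f (fst z)) has_derivative (\<lambda>v. dir_deriv f (fst v) y)) (at (y, q :: real^2))"
  by (rule has_derivative_compose[OF has_derivative_fst[OF has_derivative_ident], of f])
    (use Ck_on_SucD[OF assms UNIV_I] in simp)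

lemma fibre_function_derivative: "((\<lambda>z. snd z $ j) has_derivative (\<lambda>v. snd v $ j)) (at z)"
  by (rule bounded_linear.has_derivative[OF bounded_linear_vec_nth has_derivative_snd[OF has_derivative_ident]])

lemma g_smooth1: "Ck_on (Suc 0) UNIV g"
  by (rule smooth_on_UNIV_Ck[OF g_smooth])

text \<open>The momentum along the unit vector field in the t-direction; together with p2 it gives
  the components of a covector in an orthonormal frame.\<close>

definition unit_momentum :: "phase \<Rightarrow> real" where "unit_momentum z = snd z $ 1 / g (fst z)"

lemma unit_momentum_derivative:
  "(unit_momentum has_derivative (\<lambda>v. snd v $ 1 / g y - (q $ 1 / g y) * dir_deriv g (fst v) y / g y)) (at (y, q))"
proof -
  have "(unit_momentum has_derivative (\<lambda>v. (snd v $ 1 * g y - q $ 1 * dir_deriv g (fst v) y) / (g y * g y))) (at (y, q))"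
    unfolding unit_momentum_def[abs_def]
    using has_derivative_divide'[OF fibre_function_derivative[of 1 "(y, q)"] base_function_derivative[OF g_smooth1, of y q]]
      g_nonzero by simp
  then show ?thesis
    by (rule has_derivative_eq_rhs) (use g_nonzero[of y] in \<open>simp add: fun_eq_iff field_simps\<close>)
qed

lemma kinetic_derivative:
  "(kinetic has_derivative (\<lambda>v. (q $ 1 / g y) * (snd v $ 1 / g y - (q $ 1 / g y) * dir_deriv g (fst v) y / g y)
      + q $ 2 * snd v $ 2)) (at (y, q))"
proof -
  define U where "U v = snd v $ 1 / g y - (q $ 1 / g y) * dir_deriv g (fst v) y / g y" for v :: phase
  have dU: "(unit_momentum has_derivative U) (at (y, q))"
    unfolding U_def[abs_def] by (rule unit_momentum_derivative)
  have "kinetic = (\<lambda>z. ((unit_momentum z)\<^sup>2 + (snd z $ 2)\<^sup>2) / 2)"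
    by (simp add: kinetic_def unit_momentum_def fun_eq_iff power_divide)
  moreover have "((\<lambda>z. ((unit_momentum z)\<^sup>2 + (snd z $ 2)\<^sup>2) / 2) has_derivative
      (\<lambda>v. unit_momentum (y, q) * U v + q $ 2 * snd v $ 2)) (at (y, q))"
    by (auto intro!: derivative_eq_intros dU fibre_function_derivative simp: fun_eq_iff)
  ultimately show ?thesis by (simp add: unit_momentum_def U_def[abs_def])
qed

lemma poisson_bracket_kinetic:
  assumes "V differentiable (at (y, q))"
  shows "poisson_bracket V kinetic (y, q) =
    (q $ 1 / g y) / g y * frechet_derivative V (at (y, q)) (e1, 0) + q $ 2 * frechet_derivative V (at (y, q)) (e2, 0)
    + (q $ 1 / g y)\<^sup>2 / g y * (dir_deriv g e1 y * frechet_derivative V (at (y, q)) (0, e1)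
      + dir_deriv g e2 y * frechet_derivative V (at (y, q)) (0, e2))"
proof -
  have D0: "dir_deriv g 0 y = 0"
    using linear_0[OF has_derivative_linear[OF g_deriv]] .
  show ?thesis
    unfolding poisson_bracket_def sum_2 dir_deriv_eq[OF kinetic_derivative]
    by (simp add: D0 axis_def algebra_simps power2_eq_square add_divide_distrib)
qed

text \<open>The normalization is built in: the coefficient a2 is \<open>g\<close> itself and a3 is
  1.\<close>

definition cubic_form :: "(real^2 \<Rightarrow> real) \<Rightarrow> (real^2 \<Rightarrow> real) \<Rightarrow> phase \<Rightarrow> real" where
  "cubic_form b0 b1 z = b0 (fst z) * unit_momentum z ^ 3 + b1 (fst z) * (unit_momentum z)\<^sup>2 * snd z $ 2
     + g (fst z) * unit_momentum z * (snd z $ 2)\<^sup>2 + (snd z $ 2) ^ 3"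

text \<open>The bracket is a quartic form in \<xi> and \<eta>. The normalization makes its
  coefficients at \<xi> \<eta>^3 and \<eta>^4 vanish; the other three are the rows of the
  quasi-linear system.\<close>

lemma poisson_bracket_cubic:
  assumes b0: "Ck_on (Suc 0) UNIV b0" and b1: "Ck_on (Suc 0) UNIV b1"
  shows "cubic_form b0 b1 differentiable (at (y, q))"
    "q $ 1 = g y * \<xi> \<Longrightarrow> q $ 2 = \<eta> \<Longrightarrow> g y * poisson_bracket (cubic_form b0 b1) kinetic (y, q) =
      \<xi> ^ 4 * (dir_deriv b0 e1 y + b1 y * dir_deriv g e2 y)
      + \<xi> ^ 3 * \<eta> * (dir_deriv b1 e1 y + g y * dir_deriv b0 e2 y + (2 * g y - 3 * b0 y) * dir_deriv g e2 y)
      + \<xi>\<^sup>2 * \<eta>\<^sup>2 * (dir_deriv g e1 y + g y * dir_deriv b1 e2 y + (3 - 2 * b1 y) * dir_deriv g e2 y)"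
proof -
  define U where "U v = snd v $ 1 / g y - (q $ 1 / g y) * dir_deriv g (fst v) y / g y" for v :: phase
  define x where "x = unit_momentum (y, q)"
  have dU: "(unit_momentum has_derivative U) (at (y, q))"
    unfolding U_def[abs_def] by (rule unit_momentum_derivative)
  have d: "(cubic_form b0 b1 has_derivative (\<lambda>v. dir_deriv b0 (fst v) y * x ^ 3 + b0 y * (3 * x\<^sup>2 * U v)
      + dir_deriv b1 (fst v) y * x\<^sup>2 * q $ 2 + b1 y * (2 * x * U v) * q $ 2 + b1 y * x\<^sup>2 * snd v $ 2
      + dir_deriv g (fst v) y * x * (q $ 2)\<^sup>2 + g y * U v * (q $ 2)\<^sup>2 + g y * x * (2 * q $ 2 * snd v $ 2)
      + 3 * (q $ 2)\<^sup>2 * snd v $ 2)) (at (y, q))"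
    unfolding cubic_form_def[abs_def]
    by (rule has_derivative_eq_rhs, (rule derivative_intros dU fibre_function_derivative
          base_function_derivative b0 b1 g_smooth1)+)
      (simp add: x_def fun_eq_iff algebra_simps)
  then show dif: "cubic_form b0 b1 differentiable (at (y, q))" by (auto simp: differentiable_def)
  assume q: "q $ 1 = g y * \<xi>" "q $ 2 = \<eta>"
  have x: "x = \<xi>" unfolding x_def unit_momentum_def using q g_nonzero[of y] by simp
  have q1: "q $ 1 / g y = \<xi>" using q g_nonzero[of y] by simp
  have D0: "dir_deriv f 0 y = 0" if "Ck_on (Suc 0) UNIV f" for f :: "real^2 \<Rightarrow> real"
    using linear_0[OF has_derivative_linear[OF Ck_on_SucD[OF that UNIV_I]]] .
  have Ue: "U (e1, 0) = - \<xi> * dir_deriv g e1 y / g y" "U (e2, 0) = - \<xi> * dir_deriv g e2 y / g y"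
    "U (0, e1) = 1 / g y" "U (0, e2) = 0"
    unfolding U_def q1 by (simp_all add: axis_def D0[OF g_smooth1])
  show "g y * poisson_bracket (cubic_form b0 b1) kinetic (y, q) =
      \<xi> ^ 4 * (dir_deriv b0 e1 y + b1 y * dir_deriv g e2 y)
      + \<xi> ^ 3 * \<eta> * (dir_deriv b1 e1 y + g y * dir_deriv b0 e2 y + (2 * g y - 3 * b0 y) * dir_deriv g e2 y)
      + \<xi>\<^sup>2 * \<eta>\<^sup>2 * (dir_deriv g e1 y + g y * dir_deriv b1 e2 y + (3 - 2 * b1 y) * dir_deriv g e2 y)"
    unfolding poisson_bracket_kinetic[OF dif] dir_deriv_eq[OF d] q1 x q Ue
    using g_nonzero[of y]
    by (simp add: axis_def D0[OF g_smooth1] D0[OF b0] D0[OF b1] field_simps)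
      (simp add: algebra_simps power2_eq_square power3_eq_cube power4_eq_xxxx)
qed

definition linear_form :: "real \<Rightarrow> phase \<Rightarrow> real" where
  "linear_form l z = snd z $ 1 + l * snd z $ 2"

text \<open>The bracket is (p1 / g)^2 / g times g_t + l g_x: translation along (1, l) preserves the
  metric when \<open>g\<close> is constant in that direction, and \<open>linear_form\<close> is its
  momentum.\<close>

lemma poisson_bracket_linear:
  "linear_form l differentiable (at (y, q))"
  "dir_deriv g e1 y = - l * dir_deriv g e2 y \<Longrightarrow> poisson_bracket (linear_form l) kinetic (y, q) = 0"
proof -
  have d: "(linear_form l has_derivative (\<lambda>v. snd v $ 1 + l * snd v $ 2)) (at (y, q))"
    unfolding linear_form_def[abs_def]
    by (auto intro!: derivative_eq_intros fibre_function_derivative)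
  then show dif: "linear_form l differentiable (at (y, q))" by (auto simp: differentiable_def)
  assume "dir_deriv g e1 y = - l * dir_deriv g e2 y"
  then show "poisson_bracket (linear_form l) kinetic (y, q) = 0"
    unfolding poisson_bracket_kinetic[OF dif] dir_deriv_eq[OF d] by (simp add: axis_def)
qed

lemma cubic_form_pde:
  assumes b0: "Ck_on (Suc 0) UNIV b0" and b1: "Ck_on (Suc 0) UNIV b1"
    and F: "\<And>z. F z = cubic_form b0 b1 (transform z)"
    and int: "\<And>z. poisson_bracket F (hamiltonian \<rho>) z = 0"
  shows "dir_deriv b0 e1 y + b1 y * dir_deriv g e2 y = 0"
    "dir_deriv b1 e1 y + g y * dir_deriv b0 e2 y + (2 * g y - 3 * b0 y) * dir_deriv g e2 y = 0"
    "dir_deriv g e1 y + g y * dir_deriv b1 e2 y + (3 - 2 * b1 y) * dir_deriv g e2 y = 0"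
proof -
  define A where "A = dir_deriv b0 e1 y + b1 y * dir_deriv g e2 y"
  define B where "B = dir_deriv b1 e1 y + g y * dir_deriv b0 e2 y + (2 * g y - 3 * b0 y) * dir_deriv g e2 y"
  define C where "C = dir_deriv g e1 y + g y * dir_deriv b1 e2 y + (3 - 2 * b1 y) * dir_deriv g e2 y"
  have 0: "\<xi> ^ 4 * A + \<xi> ^ 3 * \<eta> * B + \<xi>\<^sup>2 * \<eta>\<^sup>2 * C = 0" for \<xi> \<eta>
  proof -
    define q where "q = (g y * \<xi>) *\<^sub>R e1 + \<eta> *\<^sub>R e2"
    have q: "q $ 1 = g y * \<xi>" "q $ 2 = \<eta>" by (simp_all add: q_def axis_def)
    define u where "u = \<Psi> y"
    define p where "p = adjoint (frechet_derivative \<Phi> (at u)) q"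
    have t: "transform (u, p) = (y, q)"
      unfolding transform_def p_def by (simp add: momenta_adjoint u_def \<Phi>_\<Psi>)
    have "F = (\<lambda>z. cubic_form b0 b1 (transform z))" "hamiltonian \<rho> = (\<lambda>z. kinetic (transform z))"
      using F hamiltonian_transform by auto
    then have "poisson_bracket (cubic_form b0 b1) kinetic (y, q) = 0"
      using int[of "(u, p)"] poisson_bracket_transform[of "cubic_form b0 b1" u p kinetic, unfolded t,
          OF poisson_bracket_cubic(1)[OF b0 b1] differentiableI[OF kinetic_derivative]]
      by simp
    then show ?thesis
      using poisson_bracket_cubic(2)[OF b0 b1 q] unfolding A_def B_def C_def by simp
  qed
  \<comment> \<open>Three choices of (\<xi>, \<eta>) separate the three coefficients.\<close>
  have "A = 0" using 0[of 1 0] by simp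
  moreover have "B + C = 0" "- B + C = 0" using 0[of 1 1] 0[of 1 "-1"] \<open>A = 0\<close> by simp_all
  ultimately show "dir_deriv b0 e1 y + b1 y * dir_deriv g e2 y = 0"
    "dir_deriv b1 e1 y + g y * dir_deriv b0 e2 y + (2 * g y - 3 * b0 y) * dir_deriv g e2 y = 0"
    "dir_deriv g e1 y + g y * dir_deriv b1 e2 y + (3 - 2 * b1 y) * dir_deriv g e2 y = 0"
    unfolding A_def[symmetric] B_def[symmetric] C_def[symmetric] by linarith+
qed

lemma linear_form_integral:
  assumes "dir_deriv g e1 (\<Phi> u) = - l * dir_deriv g e2 (\<Phi> u)"
  shows "poisson_bracket (\<lambda>z. linear_form l (transform z)) (hamiltonian \<rho>) (u, p) = 0"
proof -
  have t: "transform (u, p) = (\<Phi> u, momenta (u, p))" by (simp add: transform_def)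
  have "hamiltonian \<rho> = (\<lambda>z. kinetic (transform z))" using hamiltonian_transform by auto
  then have "poisson_bracket (\<lambda>z. linear_form l (transform z)) (hamiltonian \<rho>) (u, p)
      = poisson_bracket (linear_form l) kinetic (transform (u, p))"
    using poisson_bracket_transform[of "linear_form l" u p kinetic, unfolded t,
        OF poisson_bracket_linear(1) differentiableI[OF kinetic_derivative]] unfolding t by simp
  then show ?thesis
    using poisson_bracket_linear(2)[OF assms] unfolding t by simp
qed

end

section \<open>Eigenvalues of the system\<close>

text \<open>Because g \<noteq> 0, an eigenvector is determined by its third entry: rows three and
  two give the other entries, and row one becomes the characteristic equation.\<close>

lemma complex_eigenvalues_system_matrix:
  assumes g: "g \<noteq> (0 :: real)"
  shows "z \<in> complex_eigenvalues (system_matrix (vector [a0, a1, g])) \<longleftrightarrow>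
    z ^ 3 - (3 - 2 * of_real a1) * z\<^sup>2 - of_real g * (2 * of_real g - 3 * of_real a0) * z
      - (of_real g)\<^sup>2 * of_real a1 = 0"
proof -
  define ch where "ch = z ^ 3 - (3 - 2 * of_real a1) * z\<^sup>2 - of_real g * (2 * of_real g - 3 * of_real a0) * z
      - (of_real g)\<^sup>2 * (of_real a1 :: complex)"
  let ?A = "map_matrix complex_of_real (system_matrix (vector [a0, a1, g]))"
  let ?g = "of_real g :: complex" and ?a0 = "of_real a0 :: complex" and ?a1 = "of_real a1 :: complex"
  have ev: "?A *v v = z *s v \<longleftrightarrow> ?a1 * v $ 3 = z * v $ 1
      \<and> ?g * v $ 1 + (2 * ?g - 3 * ?a0) * v $ 3 = z * v $ 2
      \<and> ?g * v $ 2 + (3 - 2 * ?a1) * v $ 3 = z * v $ 3" for v :: "complex^3"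
    by (simp add: vec_eq_iff forall_3 matrix_vector_mult_def sum_3 map_matrix_def system_matrix_def
        vector_3)
  have g': "?g \<noteq> 0" using g by simp
  show ?thesis
    unfolding ch_def[symmetric]
  proof
    assume "z \<in> complex_eigenvalues (system_matrix (vector [a0, a1, g]))"
    then obtain v where v: "v \<noteq> 0" "?A *v v = z *s v" by (auto simp: complex_eigenvalues_def)
    note e = v(2)[unfolded ev]
    have "v $ 3 \<noteq> 0"
    proof
      assume 3: "v $ 3 = 0"
      then have 2: "v $ 2 = 0" using e g' by simp
      then have "v $ 1 = 0" using e 3 g' by simp
      then show False using v(1) 2 3 by (simp add: vec_eq_iff forall_3)
    qed
    moreover have "ch * v $ 3 = 0" using e unfolding ch_def by algebra
    ultimately show "ch = 0" by simp
  next
    assume 0: "ch = 0"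
    \<comment> \<open>Third entry normalised to g^2 so that no division by \<open>g\<close>
      occurs.\<close>
    define v :: "complex^3" where
      "v = vector [z * (z - 3 + 2 * ?a1) - ?g * (2 * ?g - 3 * ?a0), ?g * (z - 3 + 2 * ?a1), ?g\<^sup>2]"
    have c: "v $ 1 = z * (z - 3 + 2 * ?a1) - ?g * (2 * ?g - 3 * ?a0)" "v $ 2 = ?g * (z - 3 + 2 * ?a1)" "v $ 3 = ?g\<^sup>2"
      by (simp_all add: v_def vector_3)
    have "v $ 3 \<noteq> 0" unfolding c using g' by simp
    then have "v \<noteq> 0" by auto
    moreover have "?A *v v = z *s v"
      unfolding ev c
    proof (intro conjI)
      show "?a1 * ?g\<^sup>2 = z * (z * (z - 3 + 2 * ?a1) - ?g * (2 * ?g - 3 * ?a0))"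
        using 0 unfolding ch_def by algebra
    qed algebra+
    ultimately show "z \<in> complex_eigenvalues (system_matrix (vector [a0, a1, g]))"
      by (auto simp: complex_eigenvalues_def)
  qed
qed

text \<open>The characteristic polynomial at g z is g^3 times the monic cubic at z. A non-real
  eigenvalue or its conjugate supplies a root in the upper half plane; conversely that root, its
  conjugate and the real root give three distinct eigenvalues.\<close>

lemma (in proper_cubic_system) elliptic_point_iff:
  assumes "\<And>y. a 0 y = a0 y" "\<And>y. a (Suc 0) y = a1 y" "\<And>y. a 2 y = g y"
  shows "elliptic_point \<Phi> a u \<longleftrightarrow> \<Phi> u \<in> El"
proof -
  let ?y = "\<Phi> u"
  let ?g = "of_real (g ?y) :: complex"
  let ?c = "cubic (c2 ?y) (c1 ?y) (c0 ?y)"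
  define S where "S = complex_eigenvalues (system_matrix (vector [a 0 ?y, a 1 ?y, a 2 ?y]))"
  have g: "?g \<noteq> 0" using g_nonzero by simp
  have S: "?g * z \<in> S \<longleftrightarrow> ?c z = 0" for z
  proof -
    have "?g * z \<in> S \<longleftrightarrow> ?g\<^sup>2 * (?g * ?c z) = 0"
      unfolding S_def One_nat_def assms complex_eigenvalues_system_matrix[OF g_nonzero] cubic_eq
      by (simp only: power_mult_distrib) (simp add: algebra_simps power2_eq_square power3_eq_cube)
    then show ?thesis using g by simp
  qed
  have iff: "elliptic_point \<Phi> a u \<longleftrightarrow> card S = 3 \<and> (\<exists>z\<in>S. Im z \<noteq> 0 \<and> cnj z \<in> S)"
    by (simp add: elliptic_point_def S_def Let_def)
  have S': "z \<in> S \<longleftrightarrow> ?c (z / ?g) = 0" for z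
    using S[of "z / ?g"] g by simp
  show ?thesis
  proof
    assume "elliptic_point \<Phi> a u"
    then obtain z where z: "z \<in> S" "Im z \<noteq> 0" unfolding iff by blast
    have c1: "?c (z / ?g) = 0" using S'[of z] z(1) by simp
    have 0: "?c (z / ?g) = 0" "?c (cnj (z / ?g)) = 0"
      unfolding cubic_cnj c1 by simp_all
    have "Im (z / ?g) \<noteq> 0" using z(2) g_nonzero by simp
    then have "Im (z / ?g) > 0 \<or> Im (cnj (z / ?g)) > 0" unfolding cnj.sel by linarith
    then show "?y \<in> El" unfolding fam.elliptic_def using 0 by blast
  next
    assume E: "?y \<in> El"
    define t where "t = s ?y"
    define m where "m = - c2 ?y - 2 * Re t"
    have t: "Im t > 0" "?c t = 0" unfolding t_def by (rule fam.upper_root[OF E])+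
    have roots: "?c z = 0 \<longleftrightarrow> z = t \<or> z = cnj t \<or> z = of_real m" for z
      using cubic_factor(3)[OF t(2), of z] t(1) unfolding m_def by simp
    have "S = {?g * t, ?g * cnj t, ?g * of_real m}"
    proof (intro set_eqI)
      fix z
      show "z \<in> S \<longleftrightarrow> z \<in> {?g * t, ?g * cnj t, ?g * of_real m}"
        unfolding S' roots using g by (auto simp: divide_eq_eq mult.commute)
    qed
    moreover have "t \<noteq> cnj t" "t \<noteq> of_real m" "cnj t \<noteq> of_real m"
      using t(1) by (auto simp: complex_eq_iff)
    ultimately have "card S = 3" using g by simp
    moreover have "?g * t \<in> S" "cnj (?g * t) \<in> S" "Im (?g * t) \<noteq> 0"
      using S[of t] S[of "cnj t"] t g_nonzero by (simp_all add: cubic_cnj)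
    ultimately show "elliptic_point \<Phi> a u" unfolding iff by blast
  qed
qed

section \<open>Components in the torus\<close>

locale lattice =
  fixes \<Gamma> :: "(real^2) set" and w1 w2 :: "real^2"
  assumes lattice_eq: "\<Gamma> = {of_int i *\<^sub>R w1 + of_int j *\<^sub>R w2 | i j. True}"
    and indep: "w1 \<noteq> w2" "independent {w1, w2}"
begin

lemma lattice_group: "0 \<in> \<Gamma>" "\<gamma> \<in> \<Gamma> \<Longrightarrow> - \<gamma> \<in> \<Gamma>" "w1 \<in> \<Gamma>" "w2 \<in> \<Gamma>"
proof -
  have mem: "of_int i *\<^sub>R w1 + of_int j *\<^sub>R w2 \<in> \<Gamma>" for i j unfolding lattice_eq by blast
  show "0 \<in> \<Gamma>" "w1 \<in> \<Gamma>" "w2 \<in> \<Gamma>" using mem[of 0 0] mem[of 1 0] mem[of 0 1] by simp_all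
  assume "\<gamma> \<in> \<Gamma>"
  then obtain i j where "\<gamma> = of_int i *\<^sub>R w1 + of_int j *\<^sub>R w2" unfolding lattice_eq by blast
  then have "- \<gamma> = of_int (- i) *\<^sub>R w1 + of_int (- j) *\<^sub>R w2" by simp
  then show "- \<gamma> \<in> \<Gamma>" using mem by metis
qed

lemma torus_proj_eqD:
  assumes "torus_proj \<Gamma> u = torus_proj \<Gamma> v"
  obtains \<gamma> where "\<gamma> \<in> \<Gamma>" "u = v + \<gamma>"
proof -
  have "u \<in> torus_proj \<Gamma> u" using lattice_group(1) by (simp add: torus_proj_def)
  then have "u \<in> torus_proj \<Gamma> v" by (simp only: assms)
  then have "u - v \<in> \<Gamma>" by (simp add: torus_proj_def)
  then show ?thesis using that[of "u - v"] by simp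
qed

lemma lattice_span: "\<exists>s t. v = s *\<^sub>R w1 + t *\<^sub>R w2"
proof -
  have "UNIV \<subseteq> span {w1, w2}"
    using indep by (intro card_ge_dim_independent) auto
  then have "v \<in> span {w1, w2}" by blast
  then obtain s t where "v - s *\<^sub>R w1 = t *\<^sub>R w2"
    by (auto simp: span_breakdown_eq)
  then show ?thesis by (metis add.commute diff_add_cancel)
qed

lemma lattice_independent:
  assumes "c *\<^sub>R w1 + d *\<^sub>R w2 = 0"
  shows "c = 0 \<and> d = 0"
proof -
  have "w1 \<notin> span {w2}" "w2 \<notin> span {w1}"
    using indep unfolding dependent_def by (auto simp: insert_Diff_if)
  then have ne: "w1 \<noteq> r *\<^sub>R w2" "w2 \<noteq> r *\<^sub>R w1" for r
    by (auto simp: span_singleton)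
  have "c = 0"
  proof (rule ccontr)
    assume "c \<noteq> 0"
    have "c *\<^sub>R w1 = - d *\<^sub>R w2" using assms by (simp add: add_eq_0_iff)
    then have "(1 / c) *\<^sub>R (c *\<^sub>R w1) = (1 / c) *\<^sub>R (- d *\<^sub>R w2)" by simp
    then have "w1 = (- d / c) *\<^sub>R w2" using \<open>c \<noteq> 0\<close> by simp
    then show False using ne(1) by blast
  qed
  moreover have "w2 \<noteq> 0" using ne(2)[of 0] by simp
  ultimately show ?thesis using assms by simp
qed

context
  fixes S :: "(real^2) set" and \<Omega> :: "(real^2) set set"
  assumes comp: "\<Omega> \<in> connected_components_of (subtopology (torus \<Gamma>) (torus_proj \<Gamma> ` S))"
    and inv: "\<And>u \<gamma>. u \<in> S \<Longrightarrow> \<gamma> \<in> \<Gamma> \<Longrightarrow> u + \<gamma> \<in> S"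
begin

lemma component_subset:
  assumes "torus_proj \<Gamma> u \<in> \<Omega>"
  shows "u \<in> S"
proof -
  have "torus_proj \<Gamma> u \<in> torus_proj \<Gamma> ` S"
    using connected_components_of_subset[OF comp] assms by auto
  then obtain v where "v \<in> S" "torus_proj \<Gamma> u = torus_proj \<Gamma> v" by blast
  then show ?thesis using inv torus_proj_eqD by metis
qed

text \<open>Applied to the preimage of a small ball in (t, x): elliptic points near a point over
  \<Omega> again lie over \<Omega>, so what holds over \<Omega> holds on a neighbourhood and may be
  differentiated.\<close>

lemma component_maximal:
  assumes "connected C" "C \<subseteq> S" "u \<in> C" "torus_proj \<Gamma> u \<in> \<Omega>" "v \<in> C"
  shows "torus_proj \<Gamma> v \<in> \<Omega>"
proof -
  have "connectedin (torus \<Gamma>) (torus_proj \<Gamma> ` C)"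
    using connectedin_continuous_map_image[OF quotient_imp_continuous_map[OF quotient_map_torus]]
      assms(1) by (simp add: connectedin_iff_connected)
  then have "connectedin (subtopology (torus \<Gamma>) (torus_proj \<Gamma> ` S)) (torus_proj \<Gamma> ` C)"
    using assms(2) by (auto simp: connectedin_subtopology)
  moreover have "\<not> disjnt \<Omega> (torus_proj \<Gamma> ` C)"
    using assms(3,4) by (auto simp: disjnt_def)
  ultimately have "torus_proj \<Gamma> ` C \<subseteq> \<Omega>"
    using connected_components_of_maximal[OF comp] by blast
  then show ?thesis using assms(5) by blast
qed

text \<open>Only the image \<Omega> in the torus is known to be connected, not its preimage in the
  plane. Invariance under the lattice makes \<open>A\<close> and \<open>B\<close> full preimages, so
  their images are open and disjoint.\<close>

lemma component_clopen:
  assumes AB: "open A" "open B" "S = A \<union> B" "A \<inter> B = {}"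
    and invA: "\<And>u \<gamma>. u \<in> A \<Longrightarrow> \<gamma> \<in> \<Gamma> \<Longrightarrow> u + \<gamma> \<in> A" and invB: "\<And>u \<gamma>. u \<in> B \<Longrightarrow> \<gamma> \<in> \<Gamma> \<Longrightarrow> u + \<gamma> \<in> B"
    and u: "u \<in> A" "torus_proj \<Gamma> u \<in> \<Omega>" and v: "torus_proj \<Gamma> v \<in> \<Omega>"
  shows "v \<in> A"
proof (rule ccontr)
  assume "v \<notin> A"
  then have vB: "v \<in> B" using component_subset[OF v] AB(3) by blast
  have vim: "torus_proj \<Gamma> -` torus_proj \<Gamma> ` C = C" if "\<And>u \<gamma>. u \<in> C \<Longrightarrow> \<gamma> \<in> \<Gamma> \<Longrightarrow> u + \<gamma> \<in> C" for C
  proof (intro equalityI subsetI)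
    fix x assume "x \<in> torus_proj \<Gamma> -` torus_proj \<Gamma> ` C"
    then obtain y where "y \<in> C" "torus_proj \<Gamma> x = torus_proj \<Gamma> y" by auto
    then show "x \<in> C" using that torus_proj_eqD by metis
  qed auto
  have op: "openin (torus \<Gamma>) (torus_proj \<Gamma> ` A)" "openin (torus \<Gamma>) (torus_proj \<Gamma> ` B)"
    unfolding openin_torus using vim[OF invA] vim[OF invB] AB(1,2) by auto
  have "connectedin (torus \<Gamma>) \<Omega>"
    using connectedin_connected_components_of[OF comp] by (simp add: connectedin_subtopology)
  then have "\<not> (\<exists>E1 E2. openin (torus \<Gamma>) E1 \<and> openin (torus \<Gamma>) E2 \<and> \<Omega> \<subseteq> E1 \<union> E2 \<and>
      E1 \<inter> E2 \<inter> \<Omega> = {} \<and> E1 \<inter> \<Omega> \<noteq> {} \<and> E2 \<inter> \<Omega> \<noteq> {})"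
    unfolding connectedin by (rule conjunct2)
  moreover have "\<Omega> \<subseteq> torus_proj \<Gamma> ` A \<union> torus_proj \<Gamma> ` B"
    using connected_components_of_subset[OF comp] AB(3) by auto
  moreover have "torus_proj \<Gamma> ` A \<inter> torus_proj \<Gamma> ` B \<inter> \<Omega> = {}"
  proof (rule ccontr)
    assume "torus_proj \<Gamma> ` A \<inter> torus_proj \<Gamma> ` B \<inter> \<Omega> \<noteq> {}"
    then obtain x y where "x \<in> A" "y \<in> B" "torus_proj \<Gamma> x = torus_proj \<Gamma> y" by blast
    then have "x \<in> A \<inter> B" using invB torus_proj_eqD by (metis IntI)
    then show False using AB(4) by blast
  qed
  moreover have "torus_proj \<Gamma> ` A \<inter> \<Omega> \<noteq> {}" "torus_proj \<Gamma> ` B \<inter> \<Omega> \<noteq> {}"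
    using u v vB by blast+
  ultimately show False using op by metis
qed

end

end

section \<open>Periodicity of the coordinate expressions\<close>

locale cubic_torus = lattice \<Gamma> w1 w2 + semigeodesic \<Phi> \<Gamma> \<rho> g
  for \<Gamma> :: "(real^2) set" and w1 w2 :: "real^2" and \<Phi> :: "real^2 \<Rightarrow> real^2"
    and \<rho> :: "real^2 \<Rightarrow> real^2^2" and g :: "real^2 \<Rightarrow> real" +
  fixes F :: "phase \<Rightarrow> real" and a0 a1 :: "real^2 \<Rightarrow> real" and \<alpha> :: "real^2 \<Rightarrow> real^2"
  assumes a_smooth: "smooth_on UNIV a0" "smooth_on UNIV a1"
    and F_form: "\<And>z. F z = cubic_form a0 a1 (transform z)"
    and F_integral: "\<And>z. poisson_bracket F (hamiltonian \<rho>) z = 0"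
    and F_periodic: "\<And>u p \<gamma>. \<gamma> \<in> \<Gamma> \<Longrightarrow> F (u + \<gamma>, p) = F (u, p)"
    and liouville: "regular_liouville_torus \<Gamma> \<rho> F \<alpha>"
    and geodesics: "\<And>u. dir_deriv \<Phi> (matrix_inv (\<rho> u) *v \<alpha> u) u $ 1 = 0"
begin

lemma chart_det_nonzero: "chart_det \<Phi> w1 w2 u \<noteq> 0"
proof
  assume 0: "chart_det \<Phi> w1 w2 u = 0"
  define b where "b i = dir_deriv \<Phi> w1 u $ i" for i
  define c where "c i = dir_deriv \<Phi> w2 u $ i" for i
  have det: "b 1 * c 2 - c 1 * b 2 = 0" using 0 unfolding chart_det_def b_def c_def .
  have zero: "x = 0 \<and> y = 0" if "x * b 1 + y * c 1 = 0" "x * b 2 + y * c 2 = 0" for x y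
  proof -
    have "dir_deriv \<Phi> (x *\<^sub>R w1 + y *\<^sub>R w2) u = x *\<^sub>R dir_deriv \<Phi> w1 u + y *\<^sub>R dir_deriv \<Phi> w2 u"
      by (simp add: linear_add[OF linear_D\<Phi>] linear_scale[OF linear_D\<Phi>])
    also have "\<dots> = 0" using that by (simp add: vec_eq_iff forall_2 b_def c_def)
    finally have "x *\<^sub>R w1 + y *\<^sub>R w2 = 0"
      using D\<Psi>_D\<Phi>[where v = "x *\<^sub>R w1 + y *\<^sub>R w2" and u = u] linear_0[OF linear_D\<Psi>] by simp
    then show ?thesis by (rule lattice_independent)
  qed
  \<comment> \<open>If the determinant vanishes, the coefficients (c 1, - b 1) and (c 2, - b 2) give
    combinations of \<open>w1\<close> and \<open>w2\<close> that d\<Phi> annihilates.\<close>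
  have "c 1 = 0 \<and> - b 1 = 0" by (rule zero) (use det in \<open>simp_all add: algebra_simps\<close>)
  moreover have "c 2 = 0 \<and> - b 2 = 0" by (rule zero) (use det in \<open>simp_all add: algebra_simps\<close>)
  ultimately show False using zero[of 1 0] by simp
qed

sublocale chart: periodic_chart \<Phi> w1 w2
  using diffeo lattice_span chart_det_nonzero bij
  by unfold_locales (simp_all add: diffeomorphism_def bij_is_surj)

text \<open>The covectors of the Liouville torus are constant multiples of \<open>dx\<close>; hence \<open>dx\<close> is periodic, and
  so is \<open>g dt\<close>, first up to sign by the metric and then exactly by orientation.\<close>

definition speed :: "real^2 \<Rightarrow> real" where "speed u = \<alpha> u \<bullet> frame 2 u"

text \<open>The velocity \<open>v\<close> of the geodesic satisfies dt(v) = 0, so lowering its index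
  with the semi-geodesic metric leaves dx(v) dx.\<close>

lemma \<alpha>_speed: "w \<bullet> \<alpha> u = dir_deriv \<Phi> w u $ 2 * speed u"
  and hamiltonian_speed: "hamiltonian \<rho> (u, \<alpha> u) = (speed u)\<^sup>2 / 2"
proof -
  define v where "v = matrix_inv (\<rho> u) *v \<alpha> u"
  have v1: "dir_deriv \<Phi> v u $ 1 = 0" unfolding v_def by (rule geodesics)
  have \<alpha>: "w \<bullet> \<alpha> u = dir_deriv \<Phi> w u $ 2 * dir_deriv \<Phi> v u $ 2" for w
    using metric_form[of u w v] v1 unfolding metric_form_def v_def metric_matrix_inv by simp
  have s: "speed u = dir_deriv \<Phi> v u $ 2"
    unfolding speed_def inner_commute[of "\<alpha> u"] \<alpha> D\<Phi>_frame by (simp add: axis_def)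
  then show "w \<bullet> \<alpha> u = dir_deriv \<Phi> w u $ 2 * speed u" using \<alpha> by simp
  have "\<alpha> u \<bullet> v = (speed u)\<^sup>2" using \<alpha>[of v] s by (simp add: inner_commute power2_eq_square)
  then show "hamiltonian \<rho> (u, \<alpha> u) = (speed u)\<^sup>2 / 2" by (simp add: hamiltonian_def v_def)
qed

text \<open>On the zero section the differential of the Hamiltonian vanishes, contrary to the
  independence of dF and dH along the Liouville torus.\<close>

lemma speed_nonzero: "speed u \<noteq> 0"
proof
  assume "speed u = 0"
  then have "\<alpha> u = 0" using \<alpha>_speed[of "\<alpha> u" u] by simp
  have t: "transform (u, 0) = (\<Phi> u, 0)"
    by (simp add: transform_def momenta_def vec_eq_iff)
  have "(kinetic has_derivative (\<lambda>v. 0)) (at (transform (u, 0)))"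
    unfolding t using kinetic_derivative[of 0 "\<Phi> u"] by simp
  from has_derivative_compose[OF transform_has_derivative this]
  have "((\<lambda>z. kinetic (transform z)) has_derivative (\<lambda>v. 0)) (at (u, 0))" .
  then have "frechet_derivative (hamiltonian \<rho>) (at (u, \<alpha> u)) w = 0" for w
    unfolding \<open>\<alpha> u = 0\<close> hamiltonian_transform[abs_def] by (simp add: dir_deriv_eq)
  then have "0 * frechet_derivative F (at (u, \<alpha> u)) w + 1 * frechet_derivative (hamiltonian \<rho>) (at (u, \<alpha> u)) w = 0" for w
    by simp
  then have "(0::real) = 0 \<and> (1::real) = 0"
    using liouville unfolding regular_liouville_torus_def by blast
  then show False by simp
qed

text \<open>The constant value of the Hamiltonian fixes the square; a continuous function on the
  plane without zeros keeps its sign.\<close>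

lemma speed_constant: "speed u = speed v"
proof -
  have "continuous_on UNIV \<alpha>"
    using liouville Ck_on_continuous_on[OF smooth_on_UNIV_Ck] unfolding regular_liouville_torus_def by blast
  then have "continuous_on UNIV speed"
    unfolding speed_def[abs_def] by (intro continuous_intros Ck_on_continuous_on[OF Ck_on_frame])
  then have conn: "connected (range speed)" by (intro connected_continuous_image connected_UNIV)
  obtain h where "\<And>u. hamiltonian \<rho> (u, \<alpha> u) = h"
    using liouville unfolding regular_liouville_torus_def by blast
  then have "(speed u)\<^sup>2 = (speed v)\<^sup>2" using hamiltonian_speed[of u] hamiltonian_speed[of v] by simp
  moreover have "speed u \<noteq> - speed v"
  proof
    assume eq: "speed u = - speed v"
    have "0 \<in> range speed"
    proof (cases "speed v > 0")
      case True
      then show ?thesis using conn eq unfolding connected_iff_interval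
        by (metis less_imp_le neg_le_0_iff_le rangeI)
    next
      case False
      then show ?thesis using conn eq unfolding connected_iff_interval
        by (metis neg_0_le_iff_le not_less rangeI)
    qed
    then show False using speed_nonzero by (metis imageE)
  qed
  ultimately show ?thesis by (simp add: power2_eq_iff)
qed

lemma coframe_periodic:
  assumes \<gamma>: "\<gamma> \<in> \<Gamma>"
  shows "dir_deriv \<Phi> w (u + \<gamma>) $ 2 = dir_deriv \<Phi> w u $ 2"
    "g (\<Phi> (u + \<gamma>)) * dir_deriv \<Phi> w (u + \<gamma>) $ 1 = g (\<Phi> u) * dir_deriv \<Phi> w u $ 1"
proof -
  have "\<alpha> (u + \<gamma>) = \<alpha> u" using liouville \<gamma> unfolding regular_liouville_torus_def by blast
  then show X: "dir_deriv \<Phi> w (u + \<gamma>) $ 2 = dir_deriv \<Phi> w u $ 2" for w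
    using \<alpha>_speed[of w u] \<alpha>_speed[of w "u + \<gamma>"] speed_constant[of "u + \<gamma>" u] speed_nonzero[of u] by simp
  define A where "A w = g (\<Phi> u) * dir_deriv \<Phi> w u $ 1" for w
  define B where "B w = g (\<Phi> (u + \<gamma>)) * dir_deriv \<Phi> w (u + \<gamma>) $ 1" for w
  have "\<rho> (u + \<gamma>) = \<rho> u" using metric \<gamma> by (simp add: riemannian_metric_def)
  then have "metric_form \<rho> (u + \<gamma>) v w = metric_form \<rho> u v w" for v w by (simp add: metric_form_def)
  \<comment> \<open>With dx periodic, periodicity of the metric leaves equality of the squares of
    the forms \<open>A\<close> and \<open>B\<close>, which fixes \<open>B\<close> up to one sign for
    all vectors.\<close>
  then have BA: "B v * B w = A v * A w" for v w
    unfolding metric_form X A_def B_def by (simp add: power2_eq_square algebra_simps)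
  define f where "f = frame 1 u"
  have Af: "A f = g (\<Phi> u)" unfolding A_def f_def D\<Phi>_frame by (simp add: axis_def)
  have "B f * B f = A f * A f" by (rule BA)
  then have "B f = A f \<or> B f = - A f" by (simp add: square_eq_iff)
  \<comment> \<open>The other sign would reverse the orientation of the coframe and with it the sign
    of g times \<open>chart_det\<close>, which is constant on the plane.\<close>
  moreover have "B f \<noteq> - A f"
  proof
    assume neg: "B f = - A f"
    have BnA: "B w = - A w" for w
    proof -
      have "g (\<Phi> u) * (B w + A w) = 0" using BA[of w f] unfolding neg Af by (simp add: algebra_simps)
      then show ?thesis using g_nonzero[of "\<Phi> u"] by (simp add: add_eq_0_iff2)
    qed
    have "g (\<Phi> (u + \<gamma>)) * chart_det \<Phi> w1 w2 (u + \<gamma>) = B w1 * dir_deriv \<Phi> w2 u $ 2 - B w2 * dir_deriv \<Phi> w1 u $ 2"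
      unfolding chart_det_def X B_def by (simp add: algebra_simps)
    also have "\<dots> = - (g (\<Phi> u) * chart_det \<Phi> w1 w2 u)"
      unfolding BnA chart_det_def A_def by (simp add: algebra_simps)
    finally have "g (\<Phi> (u + \<gamma>)) * chart_det \<Phi> w1 w2 (u + \<gamma>) = - (g (\<Phi> u) * chart_det \<Phi> w1 w2 u)" .
    moreover have "g (\<Phi> (u + \<gamma>)) * chart_det \<Phi> w1 w2 (u + \<gamma>) * (g (\<Phi> u) * chart_det \<Phi> w1 w2 u) > 0"
      using chart.chart_det_sign g_pos[of "\<Phi> u"] g_pos[of "\<Phi> (u + \<gamma>)"]
      by (auto simp: mult_pos_pos mult_pos_neg mult_neg_neg)
    ultimately have "- (g (\<Phi> u) * chart_det \<Phi> w1 w2 u)\<^sup>2 > 0" by (simp add: power2_eq_square)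
    then show False by simp
  qed
  ultimately have "B f = A f" by blast
  then have "B w = A w"
    using BA[of w f] g_nonzero[of "\<Phi> u"] unfolding Af by simp
  then show "g (\<Phi> (u + \<gamma>)) * dir_deriv \<Phi> w (u + \<gamma>) $ 1 = g (\<Phi> u) * dir_deriv \<Phi> w u $ 1"
    by (simp add: A_def B_def)
qed

lemma momenta_expand: "p \<bullet> w = momenta (u, p) $ 1 * dir_deriv \<Phi> w u $ 1 + momenta (u, p) $ 2 * dir_deriv \<Phi> w u $ 2"
proof -
  have "p \<bullet> w = p \<bullet> (dir_deriv \<Phi> w u $ 1 *\<^sub>R frame 1 u + dir_deriv \<Phi> w u $ 2 *\<^sub>R frame 2 u)"
    by (simp only: frame_expand[symmetric])
  then show ?thesis by (simp add: momenta_def inner_add_right mult.commute)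
qed

lemma momenta_periodic:
  assumes \<gamma>: "\<gamma> \<in> \<Gamma>"
  shows "momenta (u + \<gamma>, p) $ 1 / g (\<Phi> (u + \<gamma>)) = momenta (u, p) $ 1 / g (\<Phi> u)"
    "momenta (u + \<gamma>, p) $ 2 = momenta (u, p) $ 2"
proof -
  have eq: "p \<bullet> w = momenta (u + \<gamma>, p) $ 1 / g (\<Phi> (u + \<gamma>)) * (g (\<Phi> u) * dir_deriv \<Phi> w u $ 1)
      + momenta (u + \<gamma>, p) $ 2 * dir_deriv \<Phi> w u $ 2" for w
    unfolding momenta_expand[of p w "u + \<gamma>"] coframe_periodic(2)[OF \<gamma>, where w = w and u = u, symmetric]
      coframe_periodic(1)[OF \<gamma>, where w = w and u = u] using g_nonzero by simp
  show "momenta (u + \<gamma>, p) $ 2 = momenta (u, p) $ 2"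
    using eq[of "frame 2 u"] unfolding D\<Phi>_frame by (simp add: axis_def momenta_def)
  show "momenta (u + \<gamma>, p) $ 1 / g (\<Phi> (u + \<gamma>)) = momenta (u, p) $ 1 / g (\<Phi> u)"
    using eq[of "frame 1 u"] g_nonzero[of "\<Phi> u"] unfolding D\<Phi>_frame by (simp add: axis_def momenta_def)
qed

lemma F_eq:
  "F (u, p) = a0 (\<Phi> u) * (momenta (u, p) $ 1 / g (\<Phi> u)) ^ 3
     + a1 (\<Phi> u) * (momenta (u, p) $ 1 / g (\<Phi> u))\<^sup>2 * momenta (u, p) $ 2
     + g (\<Phi> u) * (momenta (u, p) $ 1 / g (\<Phi> u)) * (momenta (u, p) $ 2)\<^sup>2 + (momenta (u, p) $ 2) ^ 3"
  unfolding F_form cubic_form_def transform_def unit_momentum_def by simp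

text \<open>The orthonormal components x = p1 / g and y = p2 of a covector are periodic and take all
  values, so the periodicity of F passes to its coefficients in x and y. For \<open>g\<close> this
  works because the normalization makes it one of these coefficients.\<close>

lemma coefficients_periodic:
  assumes \<gamma>: "\<gamma> \<in> \<Gamma>"
  shows "a0 (\<Phi> (u + \<gamma>)) = a0 (\<Phi> u)" "a1 (\<Phi> (u + \<gamma>)) = a1 (\<Phi> u)" "g (\<Phi> (u + \<gamma>)) = g (\<Phi> u)"
proof -
  let ?u = "u + \<gamma>"
  have eq: "a0 (\<Phi> ?u) * x ^ 3 + a1 (\<Phi> ?u) * x\<^sup>2 * y + g (\<Phi> ?u) * x * y\<^sup>2
    = a0 (\<Phi> u) * x ^ 3 + a1 (\<Phi> u) * x\<^sup>2 * y + g (\<Phi> u) * x * y\<^sup>2" for x y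
  proof -
    define p where "p = adjoint (frechet_derivative \<Phi> (at u)) ((g (\<Phi> u) * x) *\<^sub>R e1 + y *\<^sub>R e2)"
    have p: "momenta (u, p) $ 1 / g (\<Phi> u) = x" "momenta (u, p) $ 2 = y"
      unfolding p_def momenta_adjoint using g_nonzero[of "\<Phi> u"] by (simp_all add: axis_def)
    show ?thesis
      using F_periodic[OF \<gamma>, of u p] unfolding F_eq momenta_periodic[OF \<gamma>] p by simp
  qed
  show "a0 (\<Phi> ?u) = a0 (\<Phi> u)" using eq[of 1 0] by simp
  then show "a1 (\<Phi> ?u) = a1 (\<Phi> u)" "g (\<Phi> ?u) = g (\<Phi> u)"
    using eq[of 1 1] eq[of 1 "-1"] by simp_all
qed

sublocale sys: cubic_system \<Phi> w1 w2 a0 a1 g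
proof unfold_locales
  have a: "Ck_on (Suc 0) UNIV a0" "Ck_on (Suc 0) UNIV a1" using a_smooth by (simp_all only: smooth_on_UNIV_Ck)
  show "smooth_on UNIV a0" "smooth_on UNIV a1" "smooth_on UNIV g" by (rule a_smooth g_smooth)+
  show "0 < g y" for y by (rule g_pos)
  show "chart.periodic a0" "chart.periodic a1" "chart.periodic g"
    unfolding chart.periodic_def using coefficients_periodic lattice_group by blast+
  show "dir_deriv a0 e1 y + a1 y * dir_deriv g e2 y = 0"
    "dir_deriv a1 e1 y + g y * dir_deriv a0 e2 y + (2 * g y - 3 * a0 y) * dir_deriv g e2 y = 0"
    "dir_deriv g e1 y + g y * dir_deriv a1 e2 y + (3 - 2 * a1 y) * dir_deriv g e2 y = 0" for y
    using cubic_form_pde[OF a F_form F_integral] by blast+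
qed

definition F1 :: "real \<Rightarrow> phase \<Rightarrow> real" where "F1 l z = linear_form l (transform z)"

lemma F1_eq: "F1 l (u, p) = momenta (u, p) $ 1 + l * momenta (u, p) $ 2"
  by (simp add: F1_def linear_form_def transform_def)

lemma F1_homogeneous: "homogeneous_in_momenta \<Gamma> \<Omega> 1 (F1 l)"
  unfolding homogeneous_in_momenta_def
proof (intro exI[of _ "\<lambda>k u. if k = 0 then frame 1 u $ 1 + l * frame 2 u $ 1 else frame 1 u $ 2 + l * frame 2 u $ 2"]
    ballI, clarify)
  fix u p
  show "F1 l (u, p) = (\<Sum>k\<le>1. (if k = 0 then frame 1 u $ 1 + l * frame 2 u $ 1 else frame 1 u $ 2 + l * frame 2 u $ 2)
      * p $ 1 ^ (1 - k) * p $ 2 ^ k)"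
    by (simp add: F1_eq momenta_def inner_vec_def sum_2 algebra_simps)
qed

lemma F1_first_integral:
  assumes "\<And>u. torus_proj \<Gamma> u \<in> \<Omega> \<Longrightarrow> dir_deriv g e1 (\<Phi> u) = - l * dir_deriv g e2 (\<Phi> u)"
  shows "first_integral_over \<Gamma> \<rho> \<Omega> (F1 l)"
proof -
  have "Ck_on k UNIV (F1 l)" for k
    unfolding F1_def[abs_def] linear_form_def transform_def snd_conv
    by (intro Ck_on_add Ck_on_mult Ck_on_const Ck_on_momenta open_UNIV)
  then have "smooth_on (cotangent \<Gamma> \<Omega>) (F1 l)"
    unfolding smooth_on_def using Ck_on_subset by blast
  moreover have "F1 l (u + \<gamma>, p) = F1 l (u, p)" if "\<gamma> \<in> \<Gamma>" for u p \<gamma>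
    using momenta_periodic[OF that, of u p] coefficients_periodic(3)[OF that, of u] g_nonzero[of "\<Phi> u"]
    unfolding F1_eq by simp
  moreover have "poisson_bracket (F1 l) (hamiltonian \<rho>) (u, p) = 0" if "(u, p) \<in> cotangent \<Gamma> \<Omega>" for u p
    unfolding F1_def[abs_def]
    by (rule linear_form_integral, rule assms) (use that in \<open>simp add: cotangent_def\<close>)
  ultimately show ?thesis
    unfolding first_integral_over_def by auto
qed

lemma F_reducible:
  assumes "k1 * l ^ 3 + k2 * l = 1" "3 * k1 * g (\<Phi> u) * l\<^sup>2 + k2 * g (\<Phi> u) = g (\<Phi> u)"
    "3 * k1 * (g (\<Phi> u))\<^sup>2 * l + k2 * l = a1 (\<Phi> u)" "k1 * (g (\<Phi> u)) ^ 3 + k2 * g (\<Phi> u) = a0 (\<Phi> u)"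
  shows "F (u, p) = k1 * F1 l (u, p) ^ 3 + 2 * k2 * hamiltonian \<rho> (u, p) * F1 l (u, p)"
proof -
  define x where "x = momenta (u, p) $ 1 / g (\<Phi> u)"
  define y where "y = momenta (u, p) $ 2"
  have m: "momenta (u, p) $ 1 = g (\<Phi> u) * x" unfolding x_def using g_nonzero[of "\<Phi> u"] by simp
  have H: "2 * hamiltonian \<rho> (u, p) = x\<^sup>2 + y\<^sup>2"
    unfolding hamiltonian_transform by (simp add: kinetic_def transform_def x_def y_def power_divide)
  have F1: "F1 l (u, p) = g (\<Phi> u) * x + l * y" unfolding F1_eq m y_def ..
  have F: "F (u, p) = a0 (\<Phi> u) * x ^ 3 + a1 (\<Phi> u) * x\<^sup>2 * y + g (\<Phi> u) * x * y\<^sup>2 + y ^ 3"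
    unfolding F_eq x_def y_def by simp
  have "k1 * F1 l (u, p) ^ 3 + 2 * k2 * hamiltonian \<rho> (u, p) * F1 l (u, p)
      = k1 * (g (\<Phi> u) * x + l * y) ^ 3 + k2 * (x\<^sup>2 + y\<^sup>2) * (g (\<Phi> u) * x + l * y)"
    unfolding F1 H[symmetric] by (simp add: algebra_simps)
  also have "\<dots> = (k1 * (g (\<Phi> u)) ^ 3 + k2 * g (\<Phi> u)) * x ^ 3 + (3 * k1 * (g (\<Phi> u))\<^sup>2 * l + k2 * l) * x\<^sup>2 * y
      + (3 * k1 * g (\<Phi> u) * l\<^sup>2 + k2 * g (\<Phi> u)) * x * y\<^sup>2 + (k1 * l ^ 3 + k2 * l) * y ^ 3"
    by (simp add: algebra_simps power2_eq_square power3_eq_cube)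
  also have "\<dots> = F (u, p)" unfolding assms F by simp
  finally show ?thesis ..
qed


section \<open>The degenerate and the proper case\<close>

lemma degenerate_reducible:
  assumes "a0 y0 = g y0" "a1 y0 = 1"
  shows "\<exists>F1 k1 k2. first_integral_over \<Gamma> \<rho> \<Omega> F1 \<and> homogeneous_in_momenta \<Gamma> \<Omega> 1 F1 \<and>
    (\<forall>z\<in>cotangent \<Gamma> \<Omega>. F z = k1 * F1 z ^ 3 + 2 * k2 * hamiltonian \<rho> z * F1 z)"
proof -
  note deg = sys.cubic_differential_zero[OF assms]
  have "a1 = (\<lambda>_. 1)" using deg by auto
  then have "dir_deriv a1 v y = 0" for v y by simp
  then have "dir_deriv g e1 (\<Phi> u) = - 1 * dir_deriv g e2 (\<Phi> u)" for u
    using sys.pde2[of "\<Phi> u"] deg[of "\<Phi> u"] by simp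
  then have "first_integral_over \<Gamma> \<rho> \<Omega> (F1 1)" by (rule F1_first_integral)
  \<comment> \<open>With a0 = g and a1 = 1 the cubic g x^3 + x^2 y + g x y^2 + y^3 factors as (x^2 +
    y^2) (g x + y), that is 2 H F1 with l = 1.\<close>
  moreover have "F z = 0 * F1 1 z ^ 3 + 2 * 1 * hamiltonian \<rho> z * F1 1 z" for z
  proof -
    obtain u p where z: "z = (u, p)" by (cases z)
    show ?thesis
      unfolding z by (rule F_reducible) (use deg[of "\<Phi> u"] in simp_all)
  qed
  ultimately show ?thesis using F1_homogeneous by blast
qed

text \<open>Near the point \<open>g\<close> is a constant b, so (b t, x) are Euclidean
  coordinates.\<close>

lemma flat_at:
  assumes V: "r > 0" "\<And>y. y \<in> ball (\<Phi> u) r \<Longrightarrow> dir_deriv g e1 y = 0 \<and> dir_deriv g e2 y = 0"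
  shows "\<exists>V (\<phi> :: real^2 \<Rightarrow> real^2). open V \<and> u \<in> V \<and> smooth_on V \<phi> \<and> inj_on \<phi> V \<and>
    (\<forall>q\<in>V. \<forall>v w. metric_form \<rho> q v w = frechet_derivative \<phi> (at q) v \<bullet> frechet_derivative \<phi> (at q) w)"
proof -
  define b where "b = g (\<Phi> u)"
  define V where "V = \<Phi> -` ball (\<Phi> u) r"
  define \<phi> where "\<phi> q = (b * \<Phi> q $ 1) *\<^sub>R e1 + \<Phi> q $ 2 *\<^sub>R e2" for q
  have "(g has_derivative (\<lambda>v. 0)) (at y within ball (\<Phi> u) r)" if y: "y \<in> ball (\<Phi> u) r" for y
  proof -
    have "dir_deriv g v y = v $ 1 *\<^sub>R dir_deriv g e1 y + v $ 2 *\<^sub>R dir_deriv g e2 y" for v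
      by (rule dir_deriv_expand[OF differentiableI[OF g_deriv]])
    then have "frechet_derivative g (at y) = (\<lambda>v. 0)" using V(2)[OF y] by auto
    then show ?thesis using g_deriv[of y] has_derivative_at_withinI by metis
  qed
  then obtain c where c: "\<And>y. y \<in> ball (\<Phi> u) r \<Longrightarrow> g y = c"
    using has_derivative_zero_constant[OF convex_ball] by metis
  then have gb: "g (\<Phi> q) = b" if "q \<in> V" for q
    using that V(1) unfolding V_def b_def by simp
  have "open V"
    unfolding V_def by (rule open_vimage[OF open_ball Ck_on_continuous_on[OF Ck_on_\<Phi>[of 0]]])
  moreover have "u \<in> V" using V(1) by (simp add: V_def)
  moreover have "Ck_on k UNIV \<phi>" for k
    unfolding \<phi>_def[abs_def]
    by (intro Ck_on_add Ck_on_scaleR Ck_on_mult Ck_on_const Ck_on_vec_nth Ck_on_\<Phi> open_UNIV)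
  then have "smooth_on V \<phi>" unfolding smooth_on_def using Ck_on_subset by blast
  moreover have "inj_on \<phi> V"
  proof (rule inj_onI)
    fix q q' assume "\<phi> q = \<phi> q'"
    then have "\<Phi> q = \<Phi> q'"
      using g_pos[of "\<Phi> u"] by (simp add: \<phi>_def b_def vec_eq_iff forall_2 axis_def)
    then show "q = q'" using \<Psi>_\<Phi> by metis
  qed
  moreover have "metric_form \<rho> q v w = dir_deriv \<phi> v q \<bullet> dir_deriv \<phi> w q" if q: "q \<in> V" for q v w
  proof -
    have "(\<phi> has_derivative (\<lambda>v. (b * dir_deriv \<Phi> v q $ 1) *\<^sub>R e1 + dir_deriv \<Phi> v q $ 2 *\<^sub>R e2)) (at q)"
      unfolding \<phi>_def[abs_def]
      by (intro has_derivative_add has_derivative_scaleR_left has_derivative_mult_right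
          bounded_linear.has_derivative[OF bounded_linear_vec_nth] has_derivative_frechetI \<Phi>_diff)
    note d = dir_deriv_eq[OF this]
    show ?thesis
      unfolding d metric_form gb[OF q]
      by (simp add: inner_vec_def sum_2 axis_def power2_eq_square)
  qed
  ultimately show ?thesis by blast
qed

lemma proper_alternative:
  assumes proper: "\<And>y. \<not> (a0 y = g y \<and> a1 y = 1)"
    and a: "\<And>y. a 0 y = a0 y" "\<And>y. a (Suc 0) y = a1 y" "\<And>y. a 2 y = g y"
    and \<Omega>: "elliptic_region \<Gamma> \<Phi> a \<Omega>"
  shows "flat_on \<Gamma> \<rho> \<Omega> \<or> (\<exists>F1 k1 k2. first_integral_over \<Gamma> \<rho> \<Omega> F1 \<and> homogeneous_in_momenta \<Gamma> \<Omega> 1 F1 \<and>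
    (\<forall>z\<in>cotangent \<Gamma> \<Omega>. F z = k1 * F1 z ^ 3 + 2 * k2 * hamiltonian \<rho> z * F1 z))"
proof -
  interpret p: proper_cubic_system \<Phi> w1 w2 a0 a1 g
    by unfold_locales (rule proper)
  obtain l where l1: "\<And>y. y \<in> p.El \<Longrightarrow> dir_deriv g e1 y = - l * dir_deriv g e2 y"
    and l2: "\<And>y. y \<in> p.El \<Longrightarrow> dir_deriv g e2 y \<noteq> 0 \<Longrightarrow> l \<noteq> 0 \<and> p.reducible_point l y"
    and l3: "open {y \<in> p.El. p.reducible_point l y}" "open {y \<in> p.El. \<not> p.reducible_point l y}"
    using p.flat_or_reducible_locally by blast
  define S where "S = \<Phi> -` p.El"
  have ell: "{u. elliptic_point \<Phi> a u} = S"
    unfolding S_def using p.elliptic_point_iff[OF a] by auto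
  have comp: "\<Omega> \<in> connected_components_of (subtopology (torus \<Gamma>) (torus_proj \<Gamma> ` S))"
    using \<Omega> unfolding elliptic_region_def ell .
  have inv: "u + \<gamma> \<in> S" if "u \<in> S" "\<gamma> \<in> \<Gamma>" for u \<gamma>
    using p.s_periodic(1)[OF coefficients_periodic[OF that(2)]] that(1) unfolding S_def by simp
  have \<Phi>c: "continuous_on UNIV \<Phi>" by (rule Ck_on_continuous_on[OF Ck_on_\<Phi>[of 0]])
  have \<Omega>E: "\<Phi> u \<in> p.El" if "torus_proj \<Gamma> u \<in> \<Omega>" for u
    using component_subset[OF comp inv that] unfolding S_def by simp
  show ?thesis
  proof (cases "\<exists>u. torus_proj \<Gamma> u \<in> \<Omega> \<and> dir_deriv g e2 (\<Phi> u) \<noteq> 0")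
    case True
    then obtain u0 where u0: "torus_proj \<Gamma> u0 \<in> \<Omega>" "dir_deriv g e2 (\<Phi> u0) \<noteq> 0" by blast
    then have l: "l \<noteq> 0" and red: "p.reducible_point l (\<Phi> u0)" using l2[OF \<Omega>E] by blast+
    define A where "A = \<Phi> -` {y \<in> p.El. p.reducible_point l y}"
    define B where "B = \<Phi> -` {y \<in> p.El. \<not> p.reducible_point l y}"
    have per: "p.reducible_point l (\<Phi> (u + \<gamma>)) = p.reducible_point l (\<Phi> u)" if "\<gamma> \<in> \<Gamma>" for u \<gamma>
      unfolding p.reducible_point_def coefficients_periodic[OF that] ..
    \<comment> \<open>One point with g_x \<noteq> 0 is enough: reducibility there spreads over all
      of \<Omega>, since the reducible and the remaining elliptic points form two open invariant
      sets.\<close>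
    have "u \<in> A" if u: "torus_proj \<Gamma> u \<in> \<Omega>" for u
    proof (rule component_clopen[OF comp inv, of A B u0 u])
      show "open A" "open B" unfolding A_def B_def by (rule open_vimage[OF l3(1) \<Phi>c] open_vimage[OF l3(2) \<Phi>c])+
      show "S = A \<union> B" "A \<inter> B = {}" by (auto simp: A_def B_def S_def)
      show "u + \<gamma> \<in> A" if "u \<in> A" "\<gamma> \<in> \<Gamma>" for u \<gamma>
        using inv[of u \<gamma>] that per[OF that(2), of u] by (auto simp: A_def S_def)
      show "u + \<gamma> \<in> B" if "u \<in> B" "\<gamma> \<in> \<Gamma>" for u \<gamma>
        using inv[of u \<gamma>] that per[OF that(2), of u] by (auto simp: B_def S_def)
      show "u0 \<in> A" using \<Omega>E[OF u0(1)] red by (simp add: A_def)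
    qed (use u0 u in auto)
    then have R: "p.reducible_point l (\<Phi> u)" if "torus_proj \<Gamma> u \<in> \<Omega>" for u
      using that by (auto simp: A_def)
    have "F z = (l - 1) / (2 * l ^ 3) * F1 l z ^ 3 + 2 * ((3 - l) / (2 * l)) * hamiltonian \<rho> z * F1 l z"
      if "z \<in> cotangent \<Gamma> \<Omega>" for z
    proof -
      obtain u q where z: "z = (u, q)" by (cases z)
      then have "torus_proj \<Gamma> u \<in> \<Omega>" using that by (simp add: cotangent_def)
      from F_reducible[OF p.reducible_coefficients[OF R[OF this] l]] show ?thesis
        unfolding z .
    qed
    moreover have "first_integral_over \<Gamma> \<rho> \<Omega> (F1 l)"
      by (rule F1_first_integral[OF l1[OF \<Omega>E]])
    ultimately show ?thesis using F1_homogeneous by blast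
  next
    case False
    have "flat_on \<Gamma> \<rho> \<Omega>"
      unfolding flat_on_def
    proof (intro allI impI)
      fix u assume u: "torus_proj \<Gamma> u \<in> \<Omega>"
      obtain r where r: "r > 0" "ball (\<Phi> u) r \<subseteq> p.El"
        using p.fam.open_elliptic \<Omega>E[OF u] open_contains_ball by blast
      \<comment> \<open>Flatness needs g_x = 0 on a neighbourhood. The preimage of a ball of
        elliptic points is connected and contains \<open>u\<close>, so it stays over
        \<Omega>.\<close>
      define C where "C = \<Psi> ` ball (\<Phi> u) r"
      have C: "connected C"
        unfolding C_def
        by (intro connected_continuous_image connected_ball
            continuous_on_subset[OF Ck_on_continuous_on[OF Ck_on_\<Psi>[of 0]]] subset_UNIV)
      have CS: "C \<subseteq> S" using r(2) by (auto simp: C_def S_def \<Phi>_\<Psi>)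
      have uC: "u \<in> C" unfolding C_def using r(1) by (intro image_eqI[of _ _ "\<Phi> u"]) (simp_all add: \<Psi>_\<Phi>)
      have "dir_deriv g e1 y = 0 \<and> dir_deriv g e2 y = 0" if y: "y \<in> ball (\<Phi> u) r" for y
      proof -
        have "\<Psi> y \<in> C" using y by (auto simp: C_def)
        then have "torus_proj \<Gamma> (\<Psi> y) \<in> \<Omega>"
          using component_maximal[OF comp inv C CS uC u] by blast
        then have "dir_deriv g e2 (\<Phi> (\<Psi> y)) = 0" using False by blast
        then have "dir_deriv g e2 y = 0" unfolding \<Phi>_\<Psi> .
        then show ?thesis using l1[of y] y r(2) by auto
      qed
      then show "\<exists>V (\<phi> :: real^2 \<Rightarrow> real^2). open V \<and> u \<in> V \<and> smooth_on V \<phi> \<and> inj_on \<phi> V \<and>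
          (\<forall>q\<in>V. \<forall>v w. metric_form \<rho> q v w = frechet_derivative \<phi> (at q) v \<bullet> frechet_derivative \<phi> (at q) w)"
        by (rule flat_at[OF r(1)])
    qed
    then show ?thesis ..
  qed
qed

end

theorem theorem1:
  fixes \<Gamma> :: "(real^2) set" and \<rho> :: "real^2 \<Rightarrow> real^2^2" and F3 :: "phase \<Rightarrow> real"
    and \<Phi> :: "real^2 \<Rightarrow> real^2" and g :: "real^2 \<Rightarrow> real" and a :: "nat \<Rightarrow> real^2 \<Rightarrow> real"
    and \<Omega> :: "(real^2) set set"
  assumes "is_lattice \<Gamma>"
    and "riemannian_metric \<Gamma> \<rho>"
    and "first_integral_over \<Gamma> \<rho> (topspace (torus \<Gamma>)) F3"
    and "homogeneous_in_momenta \<Gamma> (topspace (torus \<Gamma>)) 3 F3"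
    and "normalized_semigeodesic \<Gamma> \<rho> 3 F3 \<Phi> g a"
    and "elliptic_region \<Gamma> \<Phi> a \<Omega>"
  shows "flat_on \<Gamma> \<rho> \<Omega> \<or>
    (\<exists>(F1 :: phase \<Rightarrow> real) (k1 :: real) (k2 :: real).
       first_integral_over \<Gamma> \<rho> \<Omega> F1 \<and> homogeneous_in_momenta \<Gamma> \<Omega> 1 F1 \<and>
       (\<forall>z\<in>cotangent \<Gamma> \<Omega>. F3 z = k1 * F1 z ^ 3 + 2 * k2 * hamiltonian \<rho> z * F1 z))"
proof -
  obtain w1 w2 where w: "w1 \<noteq> w2" "independent {w1, w2}"
      "\<Gamma> = {of_int i *\<^sub>R w1 + of_int j *\<^sub>R w2 | i j. True}"
    using assms(1) unfolding is_lattice_def by blast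
  note sg = assms(5)[unfolded normalized_semigeodesic_def]
  obtain \<alpha> where \<alpha>: "regular_liouville_torus \<Gamma> \<rho> F3 \<alpha>"
      "\<And>u. frechet_derivative \<Phi> (at u) (matrix_inv (\<rho> u) *v \<alpha> u) $ 1 = 0"
    using sg by blast
  \<comment> \<open>The indices n - 1 and n of the normalization for n = 3.\<close>
  have a: "a 2 y = g y" "a 3 y = 1" for y using sg by simp_all
  interpret s: semigeodesic \<Phi> \<Gamma> \<rho> g
    by unfold_locales (use sg assms(2) in auto)
  have cot: "cotangent \<Gamma> (topspace (torus \<Gamma>)) = UNIV"
    by (auto simp: cotangent_def topspace_torus)
  interpret t: cubic_torus \<Gamma> w1 w2 \<Phi> \<rho> g F3 "a 0" "a 1" \<alpha>
  proof unfold_locales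
    show "\<Gamma> = {of_int i *\<^sub>R w1 + of_int j *\<^sub>R w2 | i j. True}" "w1 \<noteq> w2" "independent {w1, w2}"
      by (rule w)+
    show "smooth_on UNIV (a 0)" "smooth_on UNIV (a 1)" using sg by simp_all
    show "F3 z = s.cubic_form (a 0) (a 1) (s.transform z)" for z
    proof -
      obtain u p where z: "z = (u, p)" by (cases z)
      have "F3 (u, p) = (\<Sum>k\<le>3. a k (\<Phi> u) * ((s.momenta (u, p)$1) ^ (3 - k) / g (\<Phi> u) ^ (3 - k)) * (s.momenta (u, p)$2) ^ k)"
        using sg s.adjoint_momenta[of u p] by metis
      also have "\<dots> = s.cubic_form (a 0) (a 1) (s.transform z)"
      proof -
        have "(\<Sum>k\<le>3. f k) = f 0 + f 1 + f 2 + f (3 :: nat)" for f :: "nat \<Rightarrow> real"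
          by (simp add: eval_nat_numeral)
        then show ?thesis
          unfolding z by (simp add: s.cubic_form_def s.transform_def s.unit_momentum_def a power_divide)
      qed
      finally show ?thesis using z by simp
    qed
    show "poisson_bracket F3 (hamiltonian \<rho>) z = 0" for z
      using assms(3) unfolding first_integral_over_def cot by blast
    show "F3 (u + \<gamma>, p) = F3 (u, p)" if "\<gamma> \<in> \<Gamma>" for u p \<gamma>
      using assms(3) that unfolding first_integral_over_def cot by auto
    show "regular_liouville_torus \<Gamma> \<rho> F3 \<alpha>" by (rule \<alpha>)
    show "frechet_derivative \<Phi> (at u) (matrix_inv (\<rho> u) *v \<alpha> u) $ 1 = 0" for u by (rule \<alpha>)
  qed
  show ?thesis
  \<comment> \<open>The two equations say that the cubic differential vanishes at a point; if it
    does so anywhere on the torus, it vanishes everywhere.\<close>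
  proof (cases "\<exists>y. a 0 y = g y \<and> a 1 y = 1")
    case True
    then show ?thesis using t.degenerate_reducible by blast
  next
    case False
    then have "\<not> (a 0 y = g y \<and> a 1 y = 1)" for y by blast
    moreover have "a (Suc 0) y = a 1 y" for y by simp
    ultimately show ?thesis
      using t.proper_alternative[OF _ refl _ a(1) assms(6)] by blast
  qed
qed

end
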